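(* Let $C\rightrightarrows X$ be a Lie category with a normal boundary, and let $\mathcal G(C)\subset C$ denote the set of its invertible arrows. Then $\mathcal G(C)$ is an embedded Lie subcategory of $C$ (an embedded Lie subgroupoid). More precisely: if $u(X)\subset \operatorname{Int} C$, then $\mathcal G(C)$ is open in $\operatorname{Int}C$; and if $\partial C$ is a wide subcategory of $C$, then $\mathcal G(C)$ is open in $\partial C$.
   Context: A Lie category $C\rightrightarrows X$ is a small category whose set of arrows $C$ is a smooth manifold with or without boundary and whose set of objects $X$ is a smooth manifold without boundary, such that: the source and target maps $s,t\colon C\to X$ are smooth submersions; the unit map $u\colon X\to C$, $x\mapsto 1_x$, and the composition map $m\colon C^{(2)}\to C$, $(g,h)\mapsto gh$, are smooth, where $C^{(2)}=\{(g,h)\in C\times C: s(g)=t(h)\}$; and, if $C$ has a boundary, the restrictions $s|_{\partial C},t|_{\partial C}\colon\partial C\to X$ are also submersions (then $C^{(2)}\subset C\times C$ is a submanifold with corners, so smoothness of $m$ makes sense). $C$ has a normal boundary if either $u(X)\subset \operatorname{Int}C$, or $\partial C$ is a wide subcategory of $C$ (i.e. $\partial C$ is closed under composition and $u(X)\subset\partial C$). A category without boundary has, vacuously, a normal boundary. An arrow $g$ is invertible if there is $g^{-1}\in C$ with $g^{-1}g=1_{s(g)}$ and $gg^{-1}=1_{t(g)}$. A Lie subcategory of $C$ is a Lie category together with an injective immersive smooth functor into $C$; it is embedded if this map is an embedding. *)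

theory Defs
  imports "HOL-Analysis.Analysis"
begin

section \<open>Smooth functions on subsets of Euclidean spaces\<close>

text \<open>
  Intended for open \<open>U\<close> only. Since the domain is finite-dimensional, \<open>f\<close> is \<open>k + 1\<close> times
  continuously differentiable iff it is differentiable and all its directional derivatives are
  \<open>k\<close> times continuously differentiable.
\<close>

primrec cont_diff_on ::
  "nat \<Rightarrow> 'a::euclidean_space set \<Rightarrow> ('a \<Rightarrow> 'b::real_normed_vector) \<Rightarrow> bool" where
  "cont_diff_on 0 U f \<longleftrightarrow> continuous_on U f"
| "cont_diff_on (Suc k) U f \<longleftrightarrow>
     (\<forall>x\<in>U. f differentiable (at x)) \<and>
     (\<forall>v. cont_diff_on k U (\<lambda>x. frechet_derivative f (at x) v))"

text \<open>
  Smoothness on an arbitrary set \<open>S\<close> (a relatively open part of a half-space, a submanifold with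
  corners, ...) means, as usual, existence of local smooth extensions to open sets.
\<close>

definition smooth_on ::
  "'a::euclidean_space set \<Rightarrow> ('a \<Rightarrow> 'b::real_normed_vector) \<Rightarrow> bool" where
  "smooth_on S f \<longleftrightarrow>
     (\<forall>p\<in>S. \<exists>U g. open U \<and> p \<in> U \<and> (\<forall>k. cont_diff_on k U g) \<and> (\<forall>x\<in>S \<inter> U. g x = f x))"

section \<open>Smooth manifolds with or without boundary\<close>

text \<open>
  A chart \<open>(U, \<phi>)\<close> consists of its domain and a coordinate map, relevant only on \<open>U\<close>.
\<close>

record ('a, 'e) charted =
  space_top :: "'a topology"
  atlas :: "('a set \<times> ('a \<Rightarrow> 'e)) set"

text \<open>
  The model space is a linear subspace of the Euclidean space \<open>'e\<close>, so that every dimension,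
  including \<open>0\<close>, is available; the dimension of the manifold is \<open>dim (model M)\<close>. The model
  half-space is cut out by the inward-pointing vector \<open>inward M\<close>; if this vector is \<open>0\<close>, then the
  half-space is the whole model space.
\<close>

record ('a, 'e) mfd = "('a, 'e) charted" +
  model :: "'e set"
  inward :: 'e

abbreviation points :: "('a, 'e, 'm) charted_scheme \<Rightarrow> 'a set" where
  "points M \<equiv> topspace (space_top M)"

definition half_space :: "('a, 'e::euclidean_space) mfd \<Rightarrow> 'e set" where
  "half_space M = {x \<in> model M. 0 \<le> x \<bullet> inward M}"

definition is_chart :: "('a, 'e::euclidean_space) mfd \<Rightarrow> 'a set \<Rightarrow> ('a \<Rightarrow> 'e) \<Rightarrow> bool" where
  "is_chart M U \<phi> \<longleftrightarrow>
     openin (space_top M) U \<and>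
     homeomorphic_map (subtopology (space_top M) U) (top_of_set (\<phi> ` U)) \<phi> \<and>
     (openin (top_of_set (model M)) (\<phi> ` U) \<or> openin (top_of_set (half_space M)) (\<phi> ` U))"

definition manifold :: "('a, 'e::euclidean_space) mfd \<Rightarrow> bool" where
  "manifold M \<longleftrightarrow>
     Hausdorff_space (space_top M) \<and> second_countable (space_top M) \<and>
     subspace (model M) \<and> inward M \<in> model M \<and>
     (\<forall>(U, \<phi>)\<in>atlas M. is_chart M U \<phi>) \<and>
     (\<Union>(U, \<phi>)\<in>atlas M. U) = points M \<and>
     (\<forall>(U, \<phi>)\<in>atlas M. \<forall>(V, \<psi>)\<in>atlas M. smooth_on (\<phi> ` (U \<inter> V)) (\<psi> \<circ> inv_into U \<phi>))"

definition bdry :: "('a, 'e::euclidean_space) mfd \<Rightarrow> 'a set" where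
  "bdry M = {p. \<exists>(U, \<phi>)\<in>atlas M. p \<in> U \<and> inward M \<noteq> 0 \<and>
                  openin (top_of_set (half_space M)) (\<phi> ` U) \<and> \<phi> p \<bullet> inward M = 0}"

definition int_pts :: "('a, 'e::euclidean_space) mfd \<Rightarrow> 'a set" where
  "int_pts M = points M - bdry M"

text \<open>The boundary with its induced structure of a manifold without boundary.\<close>

definition bdry_mfd :: "('a, 'e::euclidean_space) mfd \<Rightarrow> ('a, 'e) mfd" where
  "bdry_mfd M =
     \<lparr>space_top = subtopology (space_top M) (bdry M),
      atlas = (\<lambda>(U, \<phi>). (U \<inter> bdry M, \<phi>)) ` atlas M,
      model = {x \<in> model M. x \<bullet> inward M = 0},
      inward = 0\<rparr>"

text \<open>
  The product of two manifolds with boundary has corners; only its topology and its product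
  charts are needed here.
\<close>

definition prod_charted ::
  "('a, 'e, 'm) charted_scheme \<Rightarrow> ('b, 'f, 'n) charted_scheme \<Rightarrow> ('a \<times> 'b, 'e \<times> 'f) charted" where
  "prod_charted M N =
     \<lparr>space_top = prod_topology (space_top M) (space_top N),
      atlas = {(U \<times> V, map_prod \<phi> \<psi>) |U \<phi> V \<psi>. (U, \<phi>) \<in> atlas M \<and> (V, \<psi>) \<in> atlas N}\<rparr>"

subsection \<open>Smooth maps, immersions, submersions, embeddings\<close>

text \<open>
  Smoothness of \<open>f\<close> on a subset \<open>S\<close> of \<open>M\<close>. If \<open>S\<close> is an embedded submanifold (possibly with
  corners) of \<open>M\<close>, then this is smoothness with respect to the submanifold structure of \<open>S\<close>.
\<close>

definition smooth_map_on ::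
  "('a, 'e::euclidean_space, 'm) charted_scheme \<Rightarrow> 'a set \<Rightarrow>
   ('b, 'f::euclidean_space, 'n) charted_scheme \<Rightarrow> ('a \<Rightarrow> 'b) \<Rightarrow> bool" where
  "smooth_map_on M S N f \<longleftrightarrow>
     continuous_map (subtopology (space_top M) S) (space_top N) f \<and>
     (\<forall>(U, \<phi>)\<in>atlas M. \<forall>(V, \<psi>)\<in>atlas N.
        smooth_on (\<phi> ` (U \<inter> S \<inter> f -` V)) (\<psi> \<circ> f \<circ> inv_into U \<phi>))"

abbreviation smooth_map ::
  "('a, 'e::euclidean_space, 'm) charted_scheme \<Rightarrow>
   ('b, 'f::euclidean_space, 'n) charted_scheme \<Rightarrow> ('a \<Rightarrow> 'b) \<Rightarrow> bool" where
  "smooth_map M N f \<equiv> smooth_map_on M (points M) N f"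

text \<open>
  \<open>D\<close> represents the differential of \<open>f\<close> at \<open>p\<close> in the given charts. It is determined on
  \<open>model M\<close> (also at boundary points) but not outside of it.
\<close>

definition differential_in_charts ::
  "'a set \<times> ('a \<Rightarrow> 'e::euclidean_space) \<Rightarrow> 'b set \<times> ('b \<Rightarrow> 'f::euclidean_space) \<Rightarrow>
   ('a \<Rightarrow> 'b) \<Rightarrow> 'a \<Rightarrow> ('e \<Rightarrow> 'f) \<Rightarrow> bool" where
  "differential_in_charts c d f p D \<longleftrightarrow>
     (case c of (U, \<phi>) \<Rightarrow> case d of (V, \<psi>) \<Rightarrow>
        ((\<psi> \<circ> f \<circ> inv_into U \<phi>) has_derivative D) (at (\<phi> p) within \<phi> ` (U \<inter> f -` V)))"

definition submersion ::
  "('a, 'e::euclidean_space) mfd \<Rightarrow> ('b, 'f::euclidean_space) mfd \<Rightarrow> ('a \<Rightarrow> 'b) \<Rightarrow> bool" where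
  "submersion M N f \<longleftrightarrow>
     smooth_map M N f \<and>
     (\<forall>c\<in>atlas M. \<forall>d\<in>atlas N. \<forall>p \<in> fst c \<inter> f -` fst d.
        \<exists>D. differential_in_charts c d f p D \<and> D ` model M = model N)"

definition immersion ::
  "('a, 'e::euclidean_space) mfd \<Rightarrow> ('b, 'f::euclidean_space) mfd \<Rightarrow> ('a \<Rightarrow> 'b) \<Rightarrow> bool" where
  "immersion M N f \<longleftrightarrow>
     smooth_map M N f \<and>
     (\<forall>c\<in>atlas M. \<forall>d\<in>atlas N. \<forall>p \<in> fst c \<inter> f -` fst d.
        \<exists>D. differential_in_charts c d f p D \<and> inj_on D (model M))"

definition smooth_embedding ::
  "('a, 'e::euclidean_space) mfd \<Rightarrow> ('b, 'f::euclidean_space) mfd \<Rightarrow> ('a \<Rightarrow> 'b) \<Rightarrow> bool" where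
  "smooth_embedding M N f \<longleftrightarrow>
     immersion M N f \<and> embedding_map (space_top M) (space_top N) f"

section \<open>Lie categories\<close>

record ('c, 'e, 'x, 'f) lie_cat =
  arrows :: "('c, 'e) mfd"
  objects :: "('x, 'f) mfd"
  src :: "'c \<Rightarrow> 'x"
  tgt :: "'c \<Rightarrow> 'x"
  ident :: "'x \<Rightarrow> 'c"
  mult :: "'c \<Rightarrow> 'c \<Rightarrow> 'c"

abbreviation Arr :: "('c, 'e, 'x, 'f) lie_cat \<Rightarrow> 'c set" where
  "Arr C \<equiv> points (arrows C)"

abbreviation Obj :: "('c, 'e, 'x, 'f) lie_cat \<Rightarrow> 'x set" where
  "Obj C \<equiv> points (objects C)"

definition composable :: "('c, 'e, 'x, 'f) lie_cat \<Rightarrow> ('c \<times> 'c) set" where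
  "composable C = {(g, h). g \<in> Arr C \<and> h \<in> Arr C \<and> src C g = tgt C h}"

definition small_category :: "('c, 'e, 'x, 'f) lie_cat \<Rightarrow> bool" where
  "small_category C \<longleftrightarrow>
     src C ` Arr C \<subseteq> Obj C \<and> tgt C ` Arr C \<subseteq> Obj C \<and> ident C ` Obj C \<subseteq> Arr C \<and>
     (\<forall>x\<in>Obj C. src C (ident C x) = x \<and> tgt C (ident C x) = x) \<and>
     (\<forall>(g, h)\<in>composable C.
        mult C g h \<in> Arr C \<and> src C (mult C g h) = src C h \<and> tgt C (mult C g h) = tgt C g) \<and>
     (\<forall>g\<in>Arr C. mult C g (ident C (src C g)) = g \<and> mult C (ident C (tgt C g)) g = g) \<and>
     (\<forall>g h k. (g, h) \<in> composable C \<and> (h, k) \<in> composable C \<longrightarrow>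
        mult C (mult C g h) k = mult C g (mult C h k))"

text \<open>
  If the boundary of the manifold of arrows is empty, the conditions on its boundary hold
  vacuously.
\<close>

definition lie_category ::
  "('c, 'e::euclidean_space, 'x, 'f::euclidean_space) lie_cat \<Rightarrow> bool" where
  "lie_category C \<longleftrightarrow>
     small_category C \<and>
     manifold (arrows C) \<and> manifold (objects C) \<and> bdry (objects C) = {} \<and>
     submersion (arrows C) (objects C) (src C) \<and>
     submersion (arrows C) (objects C) (tgt C) \<and>
     smooth_map (objects C) (arrows C) (ident C) \<and>
     smooth_map_on (prod_charted (arrows C) (arrows C)) (composable C) (arrows C)
       (\<lambda>(g, h). mult C g h) \<and>
     submersion (bdry_mfd (arrows C)) (objects C) (src C) \<and>
     submersion (bdry_mfd (arrows C)) (objects C) (tgt C)"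

definition wide_subcategory :: "('c, 'e, 'x, 'f) lie_cat \<Rightarrow> 'c set \<Rightarrow> bool" where
  "wide_subcategory C S \<longleftrightarrow>
     S \<subseteq> Arr C \<and> ident C ` Obj C \<subseteq> S \<and>
     (\<forall>g\<in>S. \<forall>h\<in>S. src C g = tgt C h \<longrightarrow> mult C g h \<in> S)"

definition normal_boundary ::
  "('c, 'e::euclidean_space, 'x, 'f::euclidean_space) lie_cat \<Rightarrow> bool" where
  "normal_boundary C \<longleftrightarrow>
     ident C ` Obj C \<subseteq> int_pts (arrows C) \<or> wide_subcategory C (bdry (arrows C))"

definition is_inverse :: "('c, 'e, 'x, 'f) lie_cat \<Rightarrow> 'c \<Rightarrow> 'c \<Rightarrow> bool" where
  "is_inverse C g h \<longleftrightarrow>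
     (h, g) \<in> composable C \<and> (g, h) \<in> composable C \<and>
     mult C h g = ident C (src C g) \<and> mult C g h = ident C (tgt C g)"

definition invertibles :: "('c, 'e, 'x, 'f) lie_cat \<Rightarrow> 'c set" where
  "invertibles C = {g \<in> Arr C. \<exists>h. is_inverse C g h}"

definition arrow_inv :: "('c, 'e, 'x, 'f) lie_cat \<Rightarrow> 'c \<Rightarrow> 'c" where
  "arrow_inv C g = (THE h. is_inverse C g h)"

definition lie_groupoid ::
  "('c, 'e::euclidean_space, 'x, 'f::euclidean_space) lie_cat \<Rightarrow> bool" where
  "lie_groupoid C \<longleftrightarrow>
     lie_category C \<and> bdry (arrows C) = {} \<and> invertibles C = Arr C \<and>
     smooth_map (arrows C) (arrows C) (arrow_inv C)"

subsection \<open>Lie subcategories\<close>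

text \<open>\<open>F\<close> is the action on arrows, \<open>F\<^sub>0\<close> the action on objects.\<close>

definition is_functor ::
  "('d, 'e, 'y, 'f) lie_cat \<Rightarrow> ('c, 'e2, 'x, 'f2) lie_cat \<Rightarrow> ('d \<Rightarrow> 'c) \<Rightarrow> ('y \<Rightarrow> 'x) \<Rightarrow> bool" where
  "is_functor D C F F\<^sub>0 \<longleftrightarrow>
     F ` Arr D \<subseteq> Arr C \<and> F\<^sub>0 ` Obj D \<subseteq> Obj C \<and>
     (\<forall>g\<in>Arr D. src C (F g) = F\<^sub>0 (src D g) \<and> tgt C (F g) = F\<^sub>0 (tgt D g)) \<and>
     (\<forall>x\<in>Obj D. F (ident D x) = ident C (F\<^sub>0 x)) \<and>
     (\<forall>(g, h)\<in>composable D. F (mult D g h) = mult C (F g) (F h))"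

definition lie_subcategory ::
  "('d, 'e::euclidean_space, 'y, 'f::euclidean_space) lie_cat \<Rightarrow>
   ('c, 'e2::euclidean_space, 'x, 'f2::euclidean_space) lie_cat \<Rightarrow>
   ('d \<Rightarrow> 'c) \<Rightarrow> ('y \<Rightarrow> 'x) \<Rightarrow> bool" where
  "lie_subcategory D C F F\<^sub>0 \<longleftrightarrow>
     lie_category D \<and> is_functor D C F F\<^sub>0 \<and>
     immersion (arrows D) (arrows C) F \<and> inj_on F (Arr D) \<and>
     immersion (objects D) (objects C) F\<^sub>0 \<and> inj_on F\<^sub>0 (Obj D)"

definition embedded_lie_subcategory ::
  "('d, 'e::euclidean_space, 'y, 'f::euclidean_space) lie_cat \<Rightarrow>
   ('c, 'e2::euclidean_space, 'x, 'f2::euclidean_space) lie_cat \<Rightarrow>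
   ('d \<Rightarrow> 'c) \<Rightarrow> ('y \<Rightarrow> 'x) \<Rightarrow> bool" where
  "embedded_lie_subcategory D C F F\<^sub>0 \<longleftrightarrow>
     lie_subcategory D C F F\<^sub>0 \<and>
     smooth_embedding (arrows D) (arrows C) F \<and> smooth_embedding (objects D) (objects C) F\<^sub>0"

end

theory Submission
  imports Defs
begin

text \<open>
  Let \<open>g\<close> be an invertible arrow with inverse \<open>h\<close>. Left translation by \<open>g\<close> maps the target fibre over the
  source of \<open>g\<close> to the target fibre over the target of \<open>g\<close>, and left translation by \<open>h\<close> undoes this. All
  of the theorem rests on the differential of such a translation along the target fibres
  (\<open>translation_differential\<close>): it maps the tangent space of the fibre at an interior point injectively to the
  one at the translated point, with the differential of the translation by \<open>h\<close> as a left inverse, although in coordinates the composition is only the restriction of a smooth map that is arbitrary off the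
  composable pairs.

  The first consequence (\<open>translation_preserves_interior\<close>) is that a translation by an invertible
  arrow never moves an interior point to a boundary point. The image of a curve through an interior
  point stays on one side of the boundary, so its velocity is tangent to the boundary; but since the
  target map restricted to the boundary is still a submersion, the boundary part of a target fibre has
  one dimension less than the fibre. Writing \<open>g = g 1\<close>, it follows that all invertible arrows are interior
  if the units are; writing \<open>1 = g\<^sup>-\<^sup>1 g\<close>, that all invertible arrows are boundary points if the units
  are. In the second case, when the boundary is a wide subcategory, it is itself a Lie category, without boundary
  and with the same invertible arrows, and this reduces everything to the first case.

  The second consequence (\<open>local_right_inverse\<close>) is that near an invertible arrow the equation
  \<open>g h = 1\<close> can be solved for \<open>h\<close>, smoothly in \<open>g\<close>, by the implicit function theorem. Applying this to \<open>g\<close>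
  and then to the solution \<open>h\<close> shows that \<open>h\<close> is a two-sided inverse (\<open>local_inverse\<close>). So the
  invertible arrows form an open set and inversion is smooth. The structure maps of the
  groupoid are restrictions of those of the category, and restrictions of charts are again charts.

  Manifolds are handled through smooth extensions of coordinate expressions to open sets of the
  ambient Euclidean spaces, and tangent vectors through velocities of curves. In this way the boundary needs no
  calculus of its own; in particular the invariance of the boundary under transition maps
  (\<open>interior_coord_not_boundary\<close>) follows by the same one-sidedness argument.
\<close>

section \<open>Calculus of \<open>k\<close> times continuously differentiable maps\<close>

lemma cont_diff_on_mono: "cont_diff_on k U f \<Longrightarrow> V \<subseteq> U \<Longrightarrow> cont_diff_on k V f"
  by (induction k arbitrary: f) (auto intro: continuous_on_subset)

lemma cont_diff_on_cong:
  assumes "open U" "\<And>x. x \<in> U \<Longrightarrow> f x = g x" "cont_diff_on k U f"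
  shows "cont_diff_on k U g"
  using assms(2,3)
proof (induction k arbitrary: f g)
  case 0
  then show ?case using continuous_on_eq[of U f g] by simp
next
  case (Suc k)
  have der: "(g has_derivative frechet_derivative f (at x)) (at x)" if "x \<in> U" for x
  proof (rule has_derivative_transform_within_open[OF _ assms(1) that])
    show "(f has_derivative frechet_derivative f (at x)) (at x)"
      using Suc.prems(2) that by (simp add: frechet_derivative_works[symmetric])
  qed (simp add: Suc.prems(1))
  have eq: "frechet_derivative f (at x) v = frechet_derivative g (at x) v" if "x \<in> U" for x v
    using der[OF that] frechet_derivative_at by metis
  show ?case
    unfolding cont_diff_on.simps
  proof (intro conjI allI ballI)
    show "g differentiable at x" if "x \<in> U" for x
      using der[OF that] by (auto simp: differentiable_def)
    show "cont_diff_on k U (\<lambda>x. frechet_derivative g (at x) v)" for v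
      by (rule Suc.IH[of "\<lambda>x. frechet_derivative f (at x) v"]) (use eq Suc.prems in auto)
  qed
qed

text \<open>The derivative may be exhibited by a formula instead of by \<^const>\<open>frechet_derivative\<close>.\<close>

lemma cont_diff_on_SucI:
  assumes "open U" "\<And>x. x \<in> U \<Longrightarrow> (f has_derivative f' x) (at x)"
    and "\<And>v. cont_diff_on k U (\<lambda>x. f' x v)"
  shows "cont_diff_on (Suc k) U f"
  unfolding cont_diff_on.simps
proof (intro conjI allI ballI)
  show "f differentiable at x" if "x \<in> U" for x
    using assms(2)[OF that] by (auto simp: differentiable_def)
  show "cont_diff_on k U (\<lambda>x. frechet_derivative f (at x) v)" for v
    by (rule cont_diff_on_cong[OF assms(1) _ assms(3)[of v]]) (metis assms(2) frechet_derivative_at)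
qed

lemma cont_diff_on_SucD:
  assumes "cont_diff_on (Suc k) U f"
  shows "\<And>x. x \<in> U \<Longrightarrow> (f has_derivative frechet_derivative f (at x)) (at x)"
    and "\<And>v. cont_diff_on k U (\<lambda>x. frechet_derivative f (at x) v)"
  using assms by (simp_all add: frechet_derivative_works[symmetric])

lemma cont_diff_on_Suc_imp: "cont_diff_on (Suc k) U f \<Longrightarrow> cont_diff_on k U f"
proof (induction k arbitrary: f)
  case 0
  then show ?case
    by (auto intro!: continuous_at_imp_continuous_on differentiable_imp_continuous_within)
next
  case (Suc k)
  from Suc.prems have d: "\<forall>x\<in>U. f differentiable at x"
    and c: "\<And>v. cont_diff_on (Suc k) U (\<lambda>x. frechet_derivative f (at x) v)"
    unfolding cont_diff_on.simps(2)[of "Suc k"] by blast+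
  show ?case unfolding cont_diff_on.simps(2)[of k] using d Suc.IH[OF c] by blast
qed

lemma cont_diff_on_imp_continuous_on: "cont_diff_on k U f \<Longrightarrow> continuous_on U f"
  by (induction k) (auto dest: cont_diff_on_Suc_imp simp del: cont_diff_on.simps(2))

lemma cont_diff_on_const: "open U \<Longrightarrow> cont_diff_on k U (\<lambda>x. c)"
proof (induction k arbitrary: c)
  case (Suc k)
  show ?case by (rule cont_diff_on_SucI[where f' = "\<lambda>_ _. 0"]) (use Suc in auto)
qed simp

lemma cont_diff_on_linear:
  assumes "open U" "bounded_linear L" shows "cont_diff_on k U L"
proof (cases k)
  case 0 then show ?thesis using assms by (auto intro: linear_continuous_on)
next
  case (Suc l)
  then show ?thesis
    by (auto intro!: cont_diff_on_SucI[where f' = "\<lambda>_. L"] cont_diff_on_const assms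
        bounded_linear_imp_has_derivative simp del: cont_diff_on.simps)
qed

lemma cont_diff_on_linear_comp:
  assumes "open U" "bounded_linear L" "cont_diff_on k U f"
  shows "cont_diff_on k U (\<lambda>x. L (f x))"
  using assms(3)
proof (induction k arbitrary: f)
  case 0 then show ?case
    by (auto intro: bounded_linear.continuous_on[OF assms(2)])
next
  case (Suc k)
  note D = cont_diff_on_SucD[OF Suc.prems]
  show ?case
    by (rule cont_diff_on_SucI[OF assms(1) bounded_linear.has_derivative[OF assms(2) D(1)] Suc.IH[OF D(2)]])
qed

lemma cont_diff_on_add:
  assumes "open U" "cont_diff_on k U f" "cont_diff_on k U g"
  shows "cont_diff_on k U (\<lambda>x. f x + g x)"
  using assms(2,3)
proof (induction k arbitrary: f g)
  case 0 then show ?case by (auto intro: continuous_intros)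
next
  case (Suc k)
  note D = cont_diff_on_SucD[OF Suc.prems(1)] and E = cont_diff_on_SucD[OF Suc.prems(2)]
  show ?case
    by (rule cont_diff_on_SucI[OF assms(1) has_derivative_add[OF D(1) E(1)] Suc.IH[OF D(2) E(2)]])
qed

lemma cont_diff_on_diff:
  assumes "open U" "cont_diff_on k U f" "cont_diff_on k U g"
  shows "cont_diff_on k U (\<lambda>x. f x - g x)"
  using cont_diff_on_add[OF assms(1,2) cont_diff_on_linear_comp[OF assms(1) _ assms(3), of uminus]]
  by (simp add: bounded_linear_minus[OF bounded_linear_ident])

lemma cont_diff_on_sum:
  assumes "open U" "\<And>i. i \<in> I \<Longrightarrow> cont_diff_on k U (f i)"
  shows "cont_diff_on k U (\<lambda>x. \<Sum>i\<in>I. f i x)"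
proof (cases "finite I")
  case True
  then show ?thesis using assms(2)
    by (induction I) (simp_all add: cont_diff_on_const cont_diff_on_add assms(1))
qed (simp add: cont_diff_on_const assms(1))

lemma cont_diff_on_Pair:
  assumes "open U" "cont_diff_on k U f" "cont_diff_on k U g"
  shows "cont_diff_on k U (\<lambda>x. (f x, g x))"
  using assms(2,3)
proof (induction k arbitrary: f g)
  case 0 then show ?case by (auto intro: continuous_intros)
next
  case (Suc k)
  note D = cont_diff_on_SucD[OF Suc.prems(1)] and E = cont_diff_on_SucD[OF Suc.prems(2)]
  show ?case
    by (rule cont_diff_on_SucI[OF assms(1) has_derivative_Pair[OF D(1) E(1)] Suc.IH[OF D(2) E(2)]])
qed

lemma cont_diff_on_scaleR:
  assumes "open U" "cont_diff_on k U f" "cont_diff_on k U g"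
  shows "cont_diff_on k U (\<lambda>x. f x *\<^sub>R g x)"
  using assms(2,3)
proof (induction k arbitrary: f g)
  case 0 then show ?case by (auto intro: continuous_intros)
next
  case (Suc k)
  note D = cont_diff_on_SucD[OF Suc.prems(1)] and E = cont_diff_on_SucD[OF Suc.prems(2)]
  show ?case
    by (rule cont_diff_on_SucI[OF assms(1) has_derivative_scaleR[OF D(1) E(1)]
        cont_diff_on_add[OF assms(1)
          Suc.IH[OF cont_diff_on_Suc_imp[OF Suc.prems(1)] E(2)]
          Suc.IH[OF D(2) cont_diff_on_Suc_imp[OF Suc.prems(2)]]]])
qed

lemma linear_Basis_expansion:
  fixes L :: "'a::euclidean_space \<Rightarrow> 'b::real_vector"
  assumes "linear L" shows "L v = (\<Sum>b\<in>Basis. (v \<bullet> b) *\<^sub>R L b)"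
proof -
  have "L v = L (\<Sum>b\<in>Basis. (v \<bullet> b) *\<^sub>R b)" by (simp add: euclidean_representation)
  then show ?thesis by (simp add: linear_sum[OF assms] linear_scale[OF assms])
qed

text \<open>
  Smoothness of \<open>x \<mapsto> \<Phi> x (w x)\<close> can be checked on the coefficients of \<open>\<Phi>\<close>: this is how matrix
  products enter the directional calculus.
\<close>

lemma cont_diff_on_apply:
  fixes \<Phi> :: "'a::euclidean_space \<Rightarrow> 'b::euclidean_space \<Rightarrow> 'c::real_normed_vector"
  assumes "open U" "\<And>x. x \<in> U \<Longrightarrow> linear (\<Phi> x)"
    and "\<And>b. cont_diff_on k U (\<lambda>x. \<Phi> x b)" "cont_diff_on k U w"
  shows "cont_diff_on k U (\<lambda>x. \<Phi> x (w x))"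
proof (rule cont_diff_on_cong[OF assms(1)])
  show "cont_diff_on k U (\<lambda>x. \<Sum>b\<in>Basis. (w x \<bullet> b) *\<^sub>R \<Phi> x b)"
    by (intro cont_diff_on_sum cont_diff_on_scaleR assms
        cont_diff_on_linear_comp[of _ "\<lambda>v. v \<bullet> b" for b] bounded_linear_inner_left)
qed (simp add: linear_Basis_expansion[symmetric] assms(2))

text \<open>
  In direction \<open>v\<close> the composition has derivative \<open>\<Phi> x (w x)\<close>, where \<open>\<Phi> x\<close> is the derivative of \<open>g\<close> at
  \<open>f x\<close> and \<open>w x\<close> the derivative of \<open>f\<close> in direction \<open>v\<close>. The coefficients of \<open>\<Phi>\<close> are compositions of directional
  derivatives of \<open>g\<close> with \<open>f\<close>, so the induction must leave \<open>g\<close> free.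
\<close>

lemma cont_diff_on_compose:
  fixes f :: "'a::euclidean_space \<Rightarrow> 'b::euclidean_space" and g :: "'b \<Rightarrow> 'c::real_normed_vector"
  assumes "open U" "f ` U \<subseteq> V" "cont_diff_on k U f" "cont_diff_on k V g"
  shows "cont_diff_on k U (\<lambda>x. g (f x))"
  using assms(3,4)
proof (induction k arbitrary: g)
  case 0 then show ?case using assms(2) by (auto intro: continuous_on_compose2)
next
  case (Suc k)
  note D = cont_diff_on_SucD[OF Suc.prems(1)] and E = cont_diff_on_SucD[OF Suc.prems(2)]
  have E': "(g has_derivative frechet_derivative g (at (f x))) (at (f x))" if "x \<in> U" for x
    using that assms(2) by (intro E(1)) auto
  show ?case
    by (rule cont_diff_on_SucI[OF assms(1) has_derivative_compose[OF D(1) E']],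
        assumption, assumption,
        rule cont_diff_on_apply[OF assms(1) has_derivative_linear[OF E']
          Suc.IH[OF cont_diff_on_Suc_imp[OF Suc.prems(1)] E(2)] D(2)])
qed

text \<open>Linearity in the coefficient passes to directional derivatives by uniqueness of derivatives.\<close>

lemma linear_derivative_of_linear:
  fixes \<Phi> :: "'a::euclidean_space \<Rightarrow> 'b::euclidean_space \<Rightarrow> 'c::real_normed_vector"
  assumes "open U" "y \<in> U" "\<And>x. x \<in> U \<Longrightarrow> linear (\<Phi> x)"
    and "\<And>b. ((\<lambda>x. \<Phi> x b) has_derivative (\<lambda>u. \<Phi>' u b)) (at y)"
  shows "linear (\<Phi>' u)"
proof (rule linearI)
  show "\<Phi>' u (v + w) = \<Phi>' u v + \<Phi>' u w" for v w
  proof -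
    have "((\<lambda>x. \<Phi> x v + \<Phi> x w) has_derivative (\<lambda>u. \<Phi>' u v + \<Phi>' u w)) (at y)"
      by (intro has_derivative_add assms)
    then have "((\<lambda>x. \<Phi> x (v + w)) has_derivative (\<lambda>u. \<Phi>' u v + \<Phi>' u w)) (at y)"
      by (rule has_derivative_transform_within_open[OF _ assms(1,2)]) (simp add: assms(3) linear_add)
    from has_derivative_unique[OF this assms(4)] show ?thesis by (simp add: fun_eq_iff)
  qed
  show "\<Phi>' u (c *\<^sub>R v) = c *\<^sub>R \<Phi>' u v" for c v
  proof -
    have "((\<lambda>x. c *\<^sub>R \<Phi> x v) has_derivative (\<lambda>u. c *\<^sub>R \<Phi>' u v)) (at y)"
      by (intro has_derivative_scaleR_right assms)
    then have "((\<lambda>x. \<Phi> x (c *\<^sub>R v)) has_derivative (\<lambda>u. c *\<^sub>R \<Phi>' u v)) (at y)"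
      by (rule has_derivative_transform_within_open[OF _ assms(1,2)]) (simp add: assms(3) linear_scale)
    from has_derivative_unique[OF this assms(4)] show ?thesis by (simp add: fun_eq_iff)
  qed
qed

lemma has_derivative_apply:
  fixes \<Phi> :: "'a::euclidean_space \<Rightarrow> 'b::euclidean_space \<Rightarrow> 'c::real_normed_vector"
  assumes "open U" "y \<in> U" "\<And>x. x \<in> U \<Longrightarrow> linear (\<Phi> x)"
    and "\<And>b. ((\<lambda>x. \<Phi> x b) has_derivative (\<lambda>u. \<Phi>' u b)) (at y)"
  shows "((\<lambda>(x, w). \<Phi> x w) has_derivative (\<lambda>(u, z). \<Phi>' u w0 + \<Phi> y z)) (at (y, w0))"
proof -
  note lin' = linear_derivative_of_linear[OF assms]
  have fst_der: "((\<lambda>p. \<Phi> (fst p) b) has_derivative (\<lambda>p. \<Phi>' (fst p) b)) (at (y, w0))" for b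
    by (rule has_derivative_compose[where g = "\<lambda>x. \<Phi> x b"])
      (auto intro!: has_derivative_fst has_derivative_ident assms(4))
  have "((\<lambda>p. \<Sum>b\<in>Basis. (snd p \<bullet> b) *\<^sub>R \<Phi> (fst p) b) has_derivative
      (\<lambda>p. \<Sum>b\<in>Basis. (snd (y, w0) \<bullet> b) *\<^sub>R \<Phi>' (fst p) b + (snd p \<bullet> b) *\<^sub>R \<Phi> (fst (y, w0)) b)) (at (y, w0))"
    by (intro has_derivative_sum has_derivative_scaleR fst_der has_derivative_inner_left
        has_derivative_snd has_derivative_ident)
  moreover have "(\<lambda>p. \<Sum>b\<in>Basis. (snd (y, w0) \<bullet> b) *\<^sub>R \<Phi>' (fst p) b + (snd p \<bullet> b) *\<^sub>R \<Phi> (fst (y, w0)) b)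
      = (\<lambda>(u, z). \<Phi>' u w0 + \<Phi> y z)"
    by (auto simp: fun_eq_iff sum.distrib linear_Basis_expansion[OF lin', symmetric]
        linear_Basis_expansion[OF assms(3)[OF assms(2)], symmetric])
  ultimately have "((\<lambda>p. \<Sum>b\<in>Basis. (snd p \<bullet> b) *\<^sub>R \<Phi> (fst p) b) has_derivative
      (\<lambda>(u, z). \<Phi>' u w0 + \<Phi> y z)) (at (y, w0))" by simp
  then show ?thesis
    by (rule has_derivative_transform_within_open[where s = "U \<times> UNIV"])
      (auto simp: assms open_Times linear_Basis_expansion[OF assms(3), symmetric])
qed

section \<open>Smooth inverse and implicit functions\<close>

lemma linear_inv: "linear f \<Longrightarrow> bij f \<Longrightarrow> linear (inv f)"
  for f :: "'a::euclidean_space \<Rightarrow> 'a"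
  by (metis bij_is_inj inj_linear_imp_inv_bounded_linear bounded_linear.linear linear_conv_bounded_linear)

lemma continuous_on_apply:
  fixes \<Phi> :: "'a::euclidean_space \<Rightarrow> 'b::euclidean_space \<Rightarrow> 'c::real_normed_vector"
  assumes "\<And>x. x \<in> U \<Longrightarrow> linear (\<Phi> x)" "\<And>b. continuous_on U (\<lambda>x. \<Phi> x b)"
  shows "continuous_on (U \<times> UNIV) (\<lambda>p. \<Phi> (fst p) (snd p))"
proof (rule continuous_on_eq)
  have c: "continuous_on (U \<times> UNIV) (\<lambda>p. \<Phi> (fst p) b)" for b
    by (rule continuous_on_compose2[OF assms(2)[of b]]) (auto intro: continuous_on_fst)
  show "continuous_on (U \<times> UNIV) (\<lambda>p. \<Sum>b\<in>Basis. (snd p \<bullet> b) *\<^sub>R \<Phi> (fst p) b)"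
    by (intro continuous_intros c)
qed (auto simp: linear_Basis_expansion[OF assms(1), symmetric])

text \<open>
  Invariance of domain replaces estimates for inverse matrices: the continuous injection
  \<open>(x, w) \<mapsto> (x, \<Phi> x w)\<close> of open sets has a continuous inverse.
\<close>

lemma continuous_on_inverse_linear:
  fixes \<Phi> :: "'a::euclidean_space \<Rightarrow> 'b::euclidean_space \<Rightarrow> 'b"
  assumes "open U" "\<And>x. x \<in> U \<Longrightarrow> linear (\<Phi> x)" "\<And>x. x \<in> U \<Longrightarrow> bij (\<Phi> x)"
    and "\<And>b. continuous_on U (\<lambda>x. \<Phi> x b)"
  shows "continuous_on U (\<lambda>x. inv (\<Phi> x) v)"
proof -
  let ?f = "\<lambda>p. (fst p, \<Phi> (fst p) (snd p))" and ?g = "\<lambda>p. (fst p, inv (\<Phi> (fst p)) (snd p))"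
  have "continuous_on (U \<times> UNIV) ?f"
    using assms(2,4) by (intro continuous_on_Pair continuous_on_fst continuous_on_id continuous_on_apply)
  then have "continuous_on (?f ` (U \<times> UNIV)) ?g"
    by (rule continuous_on_inverse_open[rotated])
      (use assms in \<open>auto simp: open_Times bij_is_inj\<close>)
  moreover have "?f ` (U \<times> UNIV) = U \<times> UNIV"
  proof -
    have "(x, v) \<in> ?f ` (U \<times> UNIV)" if "x \<in> U" for x v
      by (rule image_eqI[of _ _ "(x, inv (\<Phi> x) v)"]) (use that assms(3) in \<open>auto simp: bij_is_surj surj_f_inv_f\<close>)
    then show ?thesis by auto
  qed
  ultimately have "continuous_on (U \<times> UNIV) ?g" by simp
  then have "continuous_on U (\<lambda>x. snd (?g (x, v)))"
    by (intro continuous_on_snd, elim continuous_on_compose2) (auto intro!: continuous_intros)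
  then show ?thesis by simp
qed

text \<open>
  The map \<open>(x, w) \<mapsto> (x, \<Phi> x w)\<close> has the inverse \<open>(x, v) \<mapsto> (x, \<Phi> x\<^sup>-\<^sup>1 v)\<close>, so the derivative of matrix
  inversion is a case of the derivative of an inverse map.
\<close>

lemma has_derivative_inverse_linear:
  fixes \<Phi> :: "'a::euclidean_space \<Rightarrow> 'b::euclidean_space \<Rightarrow> 'b"
  assumes "open U" "\<And>x. x \<in> U \<Longrightarrow> linear (\<Phi> x)" "\<And>x. x \<in> U \<Longrightarrow> bij (\<Phi> x)"
    and cont: "\<And>b. continuous_on U (\<lambda>x. \<Phi> x b)"
    and "y \<in> U" and der: "\<And>b. ((\<lambda>x. \<Phi> x b) has_derivative (\<lambda>u. \<Phi>' u b)) (at y)"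
  shows "((\<lambda>x. inv (\<Phi> x) v) has_derivative (\<lambda>u. - inv (\<Phi> y) (\<Phi>' u (inv (\<Phi> y) v)))) (at y)"
proof -
  let ?f = "\<lambda>p. (fst p, \<Phi> (fst p) (snd p))" and ?g = "\<lambda>p. (fst p, inv (\<Phi> (fst p)) (snd p))"
  define w where "w = inv (\<Phi> y) v"
  have \<Phi>w: "\<Phi> y w = v" and inv\<Phi>: "\<Phi> y (inv (\<Phi> y) z) = z" for z
    using assms(3)[OF assms(5)] by (auto simp: w_def bij_is_surj surj_f_inv_f)
  note lin = linear_inv[OF assms(2)[OF assms(5)] assms(3)[OF assms(5)]]
  let ?f' = "\<lambda>p. (fst p, \<Phi>' (fst p) w + \<Phi> y (snd p))"
    and ?g' = "\<lambda>p. (fst p, inv (\<Phi> y) (snd p - \<Phi>' (fst p) w))"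
  have cf: "continuous_on (U \<times> UNIV) ?f"
    using assms(2) cont by (intro continuous_on_Pair continuous_on_fst continuous_on_id continuous_on_apply)
  have "((\<lambda>(x, w). \<Phi> x w) has_derivative (\<lambda>(u, z). \<Phi>' u w + \<Phi> y z)) (at (y, w))"
    by (rule has_derivative_apply[OF assms(1,5,2) der])
  then have df: "(?f has_derivative ?f') (at (y, w))"
    by (intro has_derivative_Pair has_derivative_fst has_derivative_ident) (simp add: case_prod_beta')
  have "(?g has_derivative ?g') (at (?f (y, w)))"
  proof (rule has_derivative_inverse_strong[OF _ _ cf _ df])
    show "?f' \<circ> ?g' = id" by (auto simp: fun_eq_iff inv\<Phi>)
  qed (use assms in \<open>auto simp: open_Times bij_is_inj\<close>)
  from has_derivative_snd[OF this]
  have "((\<lambda>p. inv (\<Phi> (fst p)) (snd p)) has_derivative (\<lambda>p. inv (\<Phi> y) (snd p - \<Phi>' (fst p) w))) (at (y, v))"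
    by (simp add: \<Phi>w)
  then have d: "((\<lambda>p. inv (\<Phi> (fst p)) (snd p)) has_derivative (\<lambda>p. inv (\<Phi> y) (snd p - \<Phi>' (fst p) w)))
      (at ((\<lambda>x. (x, v)) y))" by simp
  have "((\<lambda>x. (x, v)) has_derivative (\<lambda>u. (u, 0))) (at y)"
    by (intro has_derivative_Pair has_derivative_ident has_derivative_const)
  from has_derivative_compose[OF this d]
  show ?thesis by (simp add: linear_neg[OF lin] w_def)
qed

text \<open>
  The derivative \<open>- \<Phi>\<^sup>-\<^sup>1 \<Phi>' \<Phi>\<^sup>-\<^sup>1 v\<close> involves \<open>\<Phi>\<^sup>-\<^sup>1\<close> itself and one derivative of \<open>\<Phi>\<close>, so each order of
  differentiability of \<open>\<Phi>\<close> yields the same order for its inverse, without loss.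
\<close>

lemma cont_diff_on_inverse_linear:
  fixes \<Phi> :: "'a::euclidean_space \<Rightarrow> 'b::euclidean_space \<Rightarrow> 'b"
  assumes "open U" "\<And>x. x \<in> U \<Longrightarrow> linear (\<Phi> x)" "\<And>x. x \<in> U \<Longrightarrow> bij (\<Phi> x)"
    and "\<And>b. cont_diff_on k U (\<lambda>x. \<Phi> x b)"
  shows "cont_diff_on k U (\<lambda>x. inv (\<Phi> x) v)"
  using assms(4)
proof (induction k arbitrary: v)
  case 0
  then show ?case using continuous_on_inverse_linear[OF assms(1-3)] by simp
next
  case (Suc k)
  note D = cont_diff_on_SucD[OF Suc.prems] and C = cont_diff_on_Suc_imp[OF Suc.prems]
  let ?D = "\<lambda>x u b. frechet_derivative (\<lambda>x. \<Phi> x b) (at x) u"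
  have linD: "linear (\<lambda>b. ?D x u b)" if "x \<in> U" for x u
    by (rule linear_derivative_of_linear[OF assms(1) that assms(2) D(1)[OF that]])
  show ?case
  proof (rule cont_diff_on_SucI[OF assms(1)])
    show "((\<lambda>x. inv (\<Phi> x) v) has_derivative (\<lambda>u. - inv (\<Phi> x) (?D x u (inv (\<Phi> x) v)))) (at x)" if "x \<in> U" for x
      by (intro has_derivative_inverse_linear[OF assms(1-3)] that D(1)
          cont_diff_on_imp_continuous_on[OF Suc.prems])
    show "cont_diff_on k U (\<lambda>x. - inv (\<Phi> x) (?D x u (inv (\<Phi> x) v)))" for u
    proof (rule cont_diff_on_linear_comp[OF assms(1) bounded_linear_minus[OF bounded_linear_ident]])
      have w: "cont_diff_on k U (\<lambda>x. ?D x u (inv (\<Phi> x) v))"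
        by (rule cont_diff_on_apply[OF assms(1) linD D(2) Suc.IH[OF C]])
      show "cont_diff_on k U (\<lambda>x. inv (\<Phi> x) (?D x u (inv (\<Phi> x) v)))"
        by (rule cont_diff_on_apply[OF assms(1) linear_inv[OF assms(2,3)] Suc.IH[OF C] w])
    qed
  qed
qed

abbreviation smooth_in :: "'a::euclidean_space set \<Rightarrow> ('a \<Rightarrow> 'b::real_normed_vector) \<Rightarrow> bool" where
  "smooth_in U f \<equiv> \<forall>k. cont_diff_on k U f"

lemma smooth_in_derivative:
  assumes "smooth_in U f" "x \<in> U"
  shows "(f has_derivative frechet_derivative f (at x)) (at x)"
  using assms cont_diff_on_SucD(1) by blast

text \<open>
  The inverse is once differentiable by the inverse function theorem, with derivative the inverse of
  the derivative of \<open>f\<close>; since matrix inversion preserves \<open>k\<close>-fold differentiability, its higher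
  smoothness follows by induction.
\<close>

theorem smooth_inverse_function:
  fixes f :: "'a::euclidean_space \<Rightarrow> 'a"
  assumes "open U" "smooth_in U f" "x0 \<in> U" "(f has_derivative f') (at x0)" "inj f'"
  obtains U' V g where "open U'" "U' \<subseteq> U" "x0 \<in> U'" "open V" "homeomorphism U' V f g" "smooth_in V g"
proof -
  let ?D = "\<lambda>x. frechet_derivative f (at x)"
  define B where "B x = Blinfun (?D x)" for x
  have B: "blinfun_apply (B x) = ?D x" if "x \<in> U" for x
    unfolding B_def using smooth_in_derivative[OF assms(2) that]
    by (simp add: bounded_linear_Blinfun_apply has_derivative_bounded_linear)
  have cD: "cont_diff_on k U (\<lambda>x. ?D x v)" for k v
    using assms(2) cont_diff_on_SucD(2) by blast
  have f': "f' = ?D x0"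
    using frechet_derivative_at[OF assms(4)] .
  have blf: "bounded_linear f'" using assms(4) has_derivative_bounded_linear by blast
  have lin: "linear f'" using blf bounded_linear.linear by blast
  then obtain h where h: "linear h" "h \<circ> f' = id"
    using linear_injective_left_inverse assms(5) by blast
  define H where "H = Blinfun h"
  have H: "blinfun_apply H = h"
    unfolding H_def using h(1) by (simp add: bounded_linear_Blinfun_apply linear_conv_bounded_linear)
  obtain U' V g g' where g: "open U'" "U' \<subseteq> U" "x0 \<in> U'" "open V" "homeomorphism U' V f g"
    "\<And>y. y \<in> V \<Longrightarrow> (g has_derivative (g' y)) (at y)"
    "\<And>y. y \<in> V \<Longrightarrow> g' y = inv (blinfun_apply (B (g y)))"
    "\<And>y. y \<in> V \<Longrightarrow> bij (blinfun_apply (B (g y)))"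
  proof (rule inverse_function_theorem[OF assms(1) _ _ assms(3), of f B H])
    show "(f has_derivative blinfun_apply (B x)) (at x)" if "x \<in> U" for x
      using smooth_in_derivative[OF assms(2) that] by (simp add: B that)
    show "continuous_on U B"
    proof (rule continuous_on_blinfun_componentwise)
      show "continuous_on U (\<lambda>x. blinfun_apply (B x) i)" for i
        by (rule continuous_on_eq[OF cont_diff_on_imp_continuous_on[OF cD[of 0 i]]]) (simp add: B)
    qed
    show "H o\<^sub>L B x0 = id_blinfun"
      using h(2) by (intro blinfun_eqI) (simp add: H B assms(3) f' fun_eq_iff)
  qed blast
  have gU: "g y \<in> U" if "y \<in> V" for y
    using g(2,5) that by (auto simp: homeomorphism_def)
  have "cont_diff_on k V g" for k
  proof (induction k)
    case 0
    then show ?case using g(5) by (simp add: homeomorphism_def)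
  next
    case (Suc k)
    show ?case
    proof (rule cont_diff_on_SucI[OF g(4,6)])
      have "cont_diff_on k V (\<lambda>y. inv (?D (g y)) v)" for v
      proof (rule cont_diff_on_inverse_linear[OF g(4)])
        show "linear (?D (g y))" if "y \<in> V" for y
          using smooth_in_derivative[OF assms(2) gU[OF that]] by (rule has_derivative_linear)
        show "bij (?D (g y))" if "y \<in> V" for y
          using g(8)[OF that] by (simp add: B gU that)
        show "cont_diff_on k V (\<lambda>y. ?D (g y) b)" for b
          by (rule cont_diff_on_compose[OF g(4) _ Suc cD]) (use gU in auto)
      qed
      then show "cont_diff_on k V (\<lambda>y. g' y v)" for v
        by (rule cont_diff_on_cong[OF g(4), rotated]) (simp add: g(7) B gU)
    qed
  qed
  then show thesis using g that by blast
qed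

text \<open>Implicit functions arise by inverting \<open>(p, x) \<mapsto> (p, F (p, x))\<close>.\<close>

theorem smooth_implicit_function:
  fixes F :: "'p::euclidean_space \<times> 'a::euclidean_space \<Rightarrow> 'a"
  assumes "open U" "smooth_in U F" "(p0, x0) \<in> U" "(F has_derivative D) (at (p0, x0))"
    and "\<And>v. D (0, v) = 0 \<Longrightarrow> v = 0" "F (p0, x0) = 0"
  obtains W r where "open W" "p0 \<in> W" "smooth_in W r" "r p0 = x0"
    "\<And>p. p \<in> W \<Longrightarrow> (p, r p) \<in> U \<and> F (p, r p) = 0"
proof -
  let ?f = "\<lambda>q. (fst q, F q)" and ?f' = "\<lambda>q. (fst q, D q)"
  have lin: "linear D" using assms(4) by (rule has_derivative_linear)
  have f': "(?f has_derivative ?f') (at (p0, x0))"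
    by (intro has_derivative_Pair has_derivative_fst has_derivative_ident assms(4))
  have sf: "smooth_in U ?f"
    using assms(1,2) by (blast intro: cont_diff_on_Pair cont_diff_on_linear bounded_linear_fst)
  have inj: "inj ?f'"
  proof (rule injI)
    fix a b assume eq: "?f' a = ?f' b"
    then have "D (a - b) = 0" "a - b = (0, snd (a - b))"
      by (simp_all add: linear_diff[OF lin] prod_eq_iff)
    then show "a = b" using assms(5)[of "snd (a - b)"] by (metis eq_iff_diff_eq_0 zero_prod_def)
  qed
  from smooth_inverse_function[OF assms(1) sf assms(3) f' inj]
  obtain U' V g where g: "open U'" "U' \<subseteq> U" "(p0, x0) \<in> U'" "open V" "homeomorphism U' V ?f g" "smooth_in V g" .
  define W where "W = (\<lambda>p. (p, 0)) -` V"
  have V0: "(p0, 0) \<in> V" and g0: "g (p0, 0) = (p0, x0)"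
    using g(3,5) assms(6) unfolding homeomorphism_def by force+
  have W: "open W" unfolding W_def by (intro open_vimage g(4) continuous_intros)
  have gU: "g (p, 0) \<in> U" and "?f (g (p, 0)) = (p, 0)" if "p \<in> W" for p
    using that g(2) homeomorphism_image2[OF g(5)] homeomorphism_apply2[OF g(5)]
    unfolding W_def by blast+
  then have fg: "fst (g (p, 0)) = p" "F (g (p, 0)) = 0" if "p \<in> W" for p
    using that by simp_all
  show thesis
  proof (rule that[of W "\<lambda>p. snd (g (p, 0))"])
    have pair: "cont_diff_on k W (\<lambda>p. (p, 0::'a))" for k
      by (intro cont_diff_on_Pair cont_diff_on_const cont_diff_on_linear W bounded_linear_ident)
    have "cont_diff_on k W (\<lambda>p. g (p, 0))" for k
      by (rule cont_diff_on_compose[OF W _ pair, where V = V]) (use g(6) in \<open>auto simp: W_def\<close>)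
    then show "smooth_in W (\<lambda>p. snd (g (p, 0)))"
      by (intro allI cont_diff_on_linear_comp[OF W bounded_linear_snd])
    show "(p, snd (g (p, 0))) \<in> U \<and> F (p, snd (g (p, 0))) = 0" if "p \<in> W" for p
      using fg[OF that] gU[OF that] by (metis prod.collapse)
    show "p0 \<in> W" using V0 by (simp add: W_def)
  qed (use W g0 in simp_all)
qed

section \<open>Velocities of curves, level sets and a local equation\<close>

lemma dim_kernel_add_dim_image:
  fixes f :: "'a::euclidean_space \<Rightarrow> 'b::euclidean_space"
  assumes "linear f" "subspace W"
  shows "dim {x\<in>W. f x = 0} + dim (f ` W) = dim W"
proof -
  obtain g where g: "range g \<subseteq> W" "linear g" "\<And>y. y \<in> f ` W \<Longrightarrow> f (g y) = y"
    using linear_exists_right_inverse_on[OF assms] by blast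
  let ?K = "{x\<in>W. f x = 0}" and ?R = "g ` f ` W"
  have K: "subspace ?K"
    using assms by (auto simp: subspace_def linear_0 linear_add linear_scale)
  have R: "subspace ?R" using assms g(2) by (intro linear_subspace_image)
  have "x \<in> {x + y |x y. x \<in> ?K \<and> y \<in> ?R}" if "x \<in> W" for x
  proof -
    have "x - g (f x) \<in> ?K"
      using that g(1,3) assms by (auto simp: linear_diff intro!: subspace_diff)
    moreover have "x = (x - g (f x)) + g (f x)" by simp
    ultimately show ?thesis using that by blast
  qed
  moreover have "{x + y |x y. x \<in> ?K \<and> y \<in> ?R} \<subseteq> W"
    using g(1) assms(2) by (auto intro!: subspace_add)
  ultimately have sum: "{x + y |x y. x \<in> ?K \<and> y \<in> ?R} = W" by blast
  have int: "?K \<inter> ?R = {0}"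
    using subspace_0[OF K] subspace_0[OF R] g(2,3) by (auto simp: linear_0)
  have "inj_on g (span (f ` W))"
    using span_eq_iff[of "f ` W"] linear_subspace_image[OF assms] g(3) by (metis inj_on_inverseI)
  then have "dim ?R = dim (f ` W)" using g(2) by (intro dim_image_eq)
  then show ?thesis using dim_sums_Int[OF K R] sum int by simp
qed

text \<open>
  Tangent vectors are velocities at time \<open>0\<close> of curves. Constraints on a curve (constancy, membership in a
  subspace, staying on one side of a hyperplane that it meets at time \<open>0\<close>) pass to its velocity.
\<close>

lemma velocity_compose:
  assumes "(c has_vector_derivative v) (at 0)" "(f has_derivative D) (at (c 0))"
  shows "((\<lambda>\<tau>. f (c \<tau>)) has_vector_derivative D v) (at 0)"
  using vector_derivative_diff_chain_within[of c v 0 UNIV f D] assms has_derivative_at_withinI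
  by (auto simp: o_def)

lemma velocity_of_constant:
  assumes "(h has_vector_derivative w) (at 0)" "\<forall>\<^sub>F \<tau> in nhds 0. h \<tau> = k"
  shows "w = 0"
proof -
  have "h 0 = k" using assms(2) by (rule eventually_nhds_x_imp_x)
  then have "((\<lambda>_. k) has_vector_derivative w) (at 0)"
    using assms has_vector_derivative_cong_ev[of UNIV h "\<lambda>_. k" 0 w] by simp
  then show ?thesis using vector_derivative_unique_at has_vector_derivative_const by blast
qed

lemma velocity_unique:
  assumes "(h has_vector_derivative v) (at 0)" "(k has_vector_derivative w) (at 0)"
    and "\<forall>\<^sub>F \<tau> in nhds 0. h \<tau> = k \<tau>"
  shows "v = w"
proof -
  have "\<forall>\<^sub>F \<tau> in nhds 0. h \<tau> - k \<tau> = 0" using assms(3) by eventually_elim simp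
  from velocity_of_constant[OF has_vector_derivative_diff[OF assms(1,2)] this]
  show ?thesis by simp
qed

lemma velocity_in_subspace:
  fixes W :: "'a::euclidean_space set"
  assumes "(h has_vector_derivative w) (at 0)" "\<forall>\<^sub>F \<tau> in nhds 0. h \<tau> \<in> W" "subspace W"
  shows "w \<in> W"
proof -
  obtain g where g: "range g \<subseteq> W" "linear g" "\<And>y. y \<in> W \<Longrightarrow> g y = y"
    using linear_exists_right_inverse_on[OF linear_ident assms(3)] by auto
  have "((\<lambda>\<tau>. h \<tau> - g (h \<tau>)) has_vector_derivative w - g w) (at 0)"
    by (rule has_vector_derivative_diff[OF assms(1) velocity_compose[OF assms(1) linear_imp_has_derivative[OF g(2)]]])
  moreover have "\<forall>\<^sub>F \<tau> in nhds 0. h \<tau> - g (h \<tau>) = 0"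
    using assms(2) by eventually_elim (simp add: g(3))
  ultimately have "w - g w = 0" by (rule velocity_of_constant)
  then have "w = g w" by simp
  then show ?thesis using g(1) by (metis rangeI subsetD)
qed

lemma velocity_at_minimum:
  fixes h :: "real \<Rightarrow> real"
  assumes "(h has_vector_derivative w) (at 0)" "\<forall>\<^sub>F \<tau> in nhds 0. h 0 \<le> h \<tau>"
  shows "w = 0"
proof -
  have "\<forall>\<^sub>F \<tau> in at 0. h 0 \<le> h \<tau>"
    using assms(2) unfolding eventually_at_filter by eventually_elim simp
  with assms(1)[unfolded has_vector_derivative_def] have "(\<lambda>x. x *\<^sub>R w) = (\<lambda>_. 0)"
    by (rule has_derivative_local_min)
  then show ?thesis by (metis scaleR_one)
qed

lemma has_vector_derivative_line: "((\<lambda>\<tau>. a + \<tau> *\<^sub>R v) has_vector_derivative v) (at 0)"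
  by (auto intro!: derivative_eq_intros)

lemma eventually_curve:
  assumes "(c has_vector_derivative v) (at 0)" "open A" "c 0 \<in> A"
  shows "\<forall>\<^sub>F \<tau> in nhds 0. c \<tau> \<in> A"
proof -
  have "continuous (at 0) c" using assms(1) by (rule has_vector_derivative_continuous)
  then have "(c \<longlongrightarrow> c 0) (nhds 0)"
    by (simp add: isCont_def tendsto_at_iff_tendsto_nhds)
  then show ?thesis using assms(2,3) by (rule topological_tendstoD)
qed

text \<open>
  A derivative relative to a set is determined in every direction in which the set contains a segment.
\<close>

lemma has_derivative_within_line:
  assumes "(f has_derivative D) (at a within S)" "\<forall>\<^sub>F \<tau> in nhds 0. a + \<tau> *\<^sub>R v \<in> S"
  shows "((\<lambda>\<tau>. f (a + \<tau> *\<^sub>R v)) has_vector_derivative D v) (at 0)"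
proof -
  obtain N :: "real set" where N: "open N" "0 \<in> N" "\<And>\<tau>. \<tau> \<in> N \<Longrightarrow> a + \<tau> *\<^sub>R v \<in> S"
    using assms(2) by (auto simp: eventually_nhds)
  have "((\<lambda>\<tau>. a + \<tau> *\<^sub>R v) has_vector_derivative v) (at 0 within N)"
    using has_vector_derivative_line has_vector_derivative_at_within by blast
  moreover have "(f has_derivative D) (at (a + 0 *\<^sub>R v) within (\<lambda>\<tau>. a + \<tau> *\<^sub>R v) ` N)"
    using assms(1) N(3) by (auto intro: has_derivative_subset)
  ultimately have "((f \<circ> (\<lambda>\<tau>. a + \<tau> *\<^sub>R v)) has_vector_derivative D v) (at 0 within N)"
    by (rule vector_derivative_diff_chain_within)
  then show ?thesis by (simp add: at_within_open[OF N(2,1)] o_def)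
qed

lemma eventually_line_in:
  fixes a :: "'a::real_normed_vector"
  assumes "subspace W" "a \<in> W" "v \<in> W" "open A" "a \<in> A" "A \<inter> W \<subseteq> S"
  shows "\<forall>\<^sub>F \<tau> in nhds (0::real). a + \<tau> *\<^sub>R v \<in> S"
proof -
  have "\<forall>\<^sub>F \<tau> in nhds (0::real). a + \<tau> *\<^sub>R v \<in> A"
    by (rule eventually_curve[OF has_vector_derivative_line assms(4)]) (simp add: assms(5))
  then show ?thesis
    using assms by (auto elim!: eventually_mono intro!: subsetD[OF assms(6)] subspace_add subspace_scale)
qed

lemma smooth_in_linear: "linear L \<Longrightarrow> open U \<Longrightarrow> smooth_in U L"
  for L :: "'a::euclidean_space \<Rightarrow> 'b::real_normed_vector"
  by (simp add: cont_diff_on_linear linear_conv_bounded_linear)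

lemma smooth_in_linear_comp:
  fixes L :: "'b::euclidean_space \<Rightarrow> 'c::real_normed_vector"
  shows "linear L \<Longrightarrow> open U \<Longrightarrow> smooth_in U f \<Longrightarrow> smooth_in U (\<lambda>x. L (f x))"
  by (simp add: cont_diff_on_linear_comp linear_conv_bounded_linear)

lemma smooth_in_compose:
  fixes f :: "'a::euclidean_space \<Rightarrow> 'b::euclidean_space"
  shows "open U \<Longrightarrow> smooth_in U f \<Longrightarrow> smooth_in V g \<Longrightarrow> f ` U \<subseteq> V \<Longrightarrow> smooth_in U (\<lambda>x. g (f x))"
  by (simp add: cont_diff_on_compose)

lemma smooth_in_mono: "smooth_in U f \<Longrightarrow> V \<subseteq> U \<Longrightarrow> smooth_in V f"
  by (blast intro: cont_diff_on_mono)

lemma smooth_in_add: "open U \<Longrightarrow> smooth_in U f \<Longrightarrow> smooth_in U g \<Longrightarrow> smooth_in U (\<lambda>x. f x + g x)"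
  by (simp add: cont_diff_on_add)

lemma smooth_in_diff: "open U \<Longrightarrow> smooth_in U f \<Longrightarrow> smooth_in U g \<Longrightarrow> smooth_in U (\<lambda>x. f x - g x)"
  by (simp add: cont_diff_on_diff)

lemma smooth_in_const: "open U \<Longrightarrow> smooth_in U (\<lambda>x. c)"
  by (simp add: cont_diff_on_const)

text \<open>
  With a right inverse \<open>R\<close> of the derivative \<open>T\<close>, the map \<open>x \<mapsto> x + R (t x - T x)\<close> has derivative the
  identity and turns \<open>t\<close> into the linear map \<open>T\<close>; the curve is the preimage of a straight line.
\<close>

lemma level_curve:
  fixes t :: "'a::euclidean_space \<Rightarrow> 'b::euclidean_space"
  assumes "open A" "a \<in> A" "smooth_in A t" "(t has_derivative T) (at a)"
    and "subspace W" "T ` W = Y" "\<And>x. x \<in> A \<inter> W \<Longrightarrow> t x \<in> Y"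
    and "a \<in> W" "v \<in> W" "T v = 0"
  obtains c :: "real \<Rightarrow> 'a" where "c 0 = a" "(c has_vector_derivative v) (at 0)"
    "\<forall>\<^sub>F \<tau> in nhds 0. c \<tau> \<in> A \<inter> W \<and> t (c \<tau>) = t a"
proof -
  have linT: "linear T" using assms(4) by (rule has_derivative_linear)
  have Y: "subspace Y" using linear_subspace_image[OF linT assms(5)] assms(6) by simp
  obtain R where R: "range R \<subseteq> W" "linear R" "\<And>y. y \<in> Y \<Longrightarrow> T (R y) = y"
    using linear_exists_right_inverse_on[OF linT assms(5)] assms(6) by blast
  define F where "F = (\<lambda>(\<tau>::real, x). x + R (t x - T x) - a - R (t a - T a) - \<tau> *\<^sub>R v)"
  have F': "(F has_derivative (\<lambda>(s, u). u - s *\<^sub>R v)) (at (0, a))"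
  proof -
    have s: "(snd has_derivative snd) (at (0, a))" "(fst has_derivative fst) (at (0, a))"
      by (auto intro: derivative_intros)
    have t: "((\<lambda>p. t (snd p)) has_derivative (\<lambda>p. T (snd p))) (at (0::real, a))"
      using has_derivative_compose[OF s(1), of t T] assms(4) by simp
    have T: "((\<lambda>p. T (snd p)) has_derivative (\<lambda>p. T (snd p))) (at (0::real, a))"
      using has_derivative_compose[OF s(1), of T T] linear_imp_has_derivative[OF linT] by simp
    have "((\<lambda>p. R (t (snd p) - T (snd p))) has_derivative (\<lambda>p. R (T (snd p) - T (snd p)))) (at (0::real, a))"
      using has_derivative_compose[OF has_derivative_diff[OF t T], of R R] linear_imp_has_derivative[OF R(2)]
      by simp
    then have "((\<lambda>p. snd p + R (t (snd p) - T (snd p)) - a - R (t a - T a) - fst p *\<^sub>R v) has_derivative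
        (\<lambda>p. snd p + R (T (snd p) - T (snd p)) - 0 - 0 - fst p *\<^sub>R v)) (at (0, a))"
      by (intro has_derivative_diff has_derivative_add has_derivative_const s
          bounded_linear.has_derivative[OF bounded_linear_scaleR_left])
    then show ?thesis by (simp add: F_def case_prod_beta' linear_0[OF R(2)])
  qed
  have op: "open (UNIV \<times> A)" using assms(1) by (simp add: open_Times)
  have lin_v: "linear (\<lambda>s. s *\<^sub>R v)" by (simp add: linear_iff algebra_simps)
  have sF: "smooth_in (UNIV \<times> A) F"
  proof -
    have "smooth_in (UNIV \<times> A) (\<lambda>p::real \<times> 'a. t (snd p))"
      by (rule smooth_in_compose[OF op smooth_in_linear assms(3)]) (auto simp: op linear_snd)
    then have "smooth_in (UNIV \<times> A) (\<lambda>p::real \<times> 'a. R (t (snd p) - T (snd p)))"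
      by (intro smooth_in_linear_comp[OF R(2) op] smooth_in_diff[OF op]
          smooth_in_linear_comp[OF linT op smooth_in_linear[OF linear_snd op]])
    then have "smooth_in (UNIV \<times> A) (\<lambda>p. snd p + R (t (snd p) - T (snd p)) - a - R (t a - T a) - fst p *\<^sub>R v)"
      by (intro smooth_in_diff[OF op] smooth_in_add[OF op smooth_in_linear[OF linear_snd op]] smooth_in_const[OF op]
          smooth_in_linear_comp[OF lin_v op smooth_in_linear[OF linear_fst op]])
    then show ?thesis by (simp add: F_def case_prod_beta')
  qed
  obtain N c where N: "open N" "0 \<in> N" "smooth_in N c" "c 0 = a"
    and c: "\<And>\<tau>. \<tau> \<in> N \<Longrightarrow> (\<tau>, c \<tau>) \<in> UNIV \<times> A \<and> F (\<tau>, c \<tau>) = 0"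
    by (rule smooth_implicit_function[OF op sF _ F']) (use assms in \<open>auto simp: F_def\<close>)
  have cN: "c \<tau> \<in> A \<inter> W \<and> t (c \<tau>) = t a" if "\<tau> \<in> N" for \<tau>
  proof -
    have eq: "c \<tau> = a + R (t a - T a) + \<tau> *\<^sub>R v - R (t (c \<tau>) - T (c \<tau>))"
      using c[OF that] by (simp add: F_def algebra_simps)
    have "a + R (t a - T a) + \<tau> *\<^sub>R v - R (t (c \<tau>) - T (c \<tau>)) \<in> W"
      using assms R(1) by (intro subspace_diff subspace_add subspace_scale) auto
    then have W: "c \<tau> \<in> W" using eq by metis
    have inY: "t x - T x \<in> Y" if "x \<in> A \<inter> W" for x
      using that assms(6,7) by (intro subspace_diff[OF Y]) auto
    have "t (c \<tau>) - T (c \<tau>) \<in> Y" "t a - T a \<in> Y"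
      using inY c[OF that] W assms(2,8) by auto
    then have "T (c \<tau>) = T a + (t a - T a) + 0 - (t (c \<tau>) - T (c \<tau>))"
      using arg_cong[OF eq, of T] R(3) assms(10)
      by (simp add: linear_add[OF linT] linear_diff[OF linT] linear_scale[OF linT])
    then show ?thesis using W c[OF that] by simp
  qed
  have "c differentiable at 0" using smooth_in_derivative[OF N(3,2)] by (rule differentiableI)
  then obtain w where w: "(c has_vector_derivative w) (at 0)"
    using vector_derivative_works by blast
  have "((\<lambda>\<tau>. F (\<tau>, c \<tau>)) has_vector_derivative (\<lambda>(s, u). u - s *\<^sub>R v) (1, w)) (at 0)"
    by (rule velocity_compose[OF has_vector_derivative_Pair[OF _ w]])
      (use F' N(4) in \<open>auto intro!: derivative_eq_intros\<close>)
  moreover have ev: "\<forall>\<^sub>F \<tau> in nhds 0. \<tau> \<in> N" using N(1,2) by (rule eventually_nhds_in_open)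
  then have "\<forall>\<^sub>F \<tau> in nhds 0. F (\<tau>, c \<tau>) = 0" by eventually_elim (use c in blast)
  ultimately have "(\<lambda>(s, u). u - s *\<^sub>R v) (1, w) = 0" by (rule velocity_of_constant)
  then have "w = v" by simp
  moreover have "\<forall>\<^sub>F \<tau> in nhds 0. c \<tau> \<in> A \<inter> W \<and> t (c \<tau>) = t a"
    using ev by eventually_elim (use cN in blast)
  ultimately show thesis using that N(4) w by blast
qed

lemma locally_injective:
  fixes f :: "'a::euclidean_space \<Rightarrow> 'a"
  assumes "open U" "smooth_in U f" "a \<in> U" "(f has_derivative f') (at a)" "inj f'"
  obtains B where "open B" "a \<in> B" "B \<subseteq> U" "inj_on f B"
proof -
  from smooth_inverse_function[OF assms]
  obtain U' V g where g: "open U'" "U' \<subseteq> U" "a \<in> U'" "homeomorphism U' V f g" by metis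
  moreover have "inj_on f U'" using g(4) by (metis homeomorphism_apply1 inj_on_inverseI)
  ultimately show thesis using that by blast
qed

text \<open>
  The local form of solving \<open>g h = 1\<close> for \<open>h\<close> near an invertible arrow. In coordinates, \<open>s\<close> is the source
  of \<open>g\<close>, \<open>t\<close> the target of \<open>h\<close>, \<open>te\<close> the target of arrows near the unit, \<open>m\<close> the composition and
  \<open>u g\<close> the unit at the target of \<open>g\<close>. As \<open>m\<close> is an arbitrary extension off the composable pairs, only
  the fibrewise part of its derivative \<open>v \<mapsto> M (0, v)\<close> in \<open>h\<close> is known: there it is inverted by \<open>K\<close>. The
  implicit function theorem is applied to an equation \<open>F = 0\<close> that combines \<open>t h = s g\<close> with the fibrewise
  part of \<open>g h = 1\<close>, in such a way that the derivative in \<open>h\<close> is the identity.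
\<close>

lemma solve_right_inverse:
  fixes s t te :: "'a::euclidean_space \<Rightarrow> 'f::euclidean_space" and m :: "'a \<times> 'a \<Rightarrow> 'a"
  assumes W: "subspace W" "y0 \<in> W"
    and s: "open A1" "x0 \<in> A1" "smooth_in A1 s" and u: "smooth_in A1 u"
    and t: "open A2" "y0 \<in> A2" "smooth_in A2 t" "(t has_derivative T) (at y0)" "T ` W = Y"
      "\<And>y. y \<in> A2 \<inter> W \<Longrightarrow> t y \<in> Y"
    and te: "open A3" "e0 \<in> A3" "smooth_in A3 te" "(te has_derivative T1) (at e0)" "T1 ` W = Y1"
    and m: "open P" "(x0, y0) \<in> P" "smooth_in P m" "(m has_derivative M) (at (x0, y0))"
    and base: "t y0 = s x0" "m (x0, y0) = e0" "u x0 = e0"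
    and K: "linear K"
    and L: "\<And>v. v \<in> W \<Longrightarrow> T v = 0 \<Longrightarrow> M (0, v) \<in> W \<and> T1 (M (0, v)) = 0 \<and> K (M (0, v)) = v"
    and KL: "\<And>v. v \<in> W \<Longrightarrow> T1 v = 0 \<Longrightarrow> K v \<in> W \<and> T (K v) = 0 \<and> M (0, K v) = v"
  obtains Q r where "open Q" "x0 \<in> Q" "smooth_in Q r" "r x0 = y0"
    "\<forall>x\<in>Q. s x \<in> Y \<longrightarrow> x \<in> A1 \<and> r x \<in> A2 \<inter> W \<and> t (r x) = s x \<and> (x, r x) \<in> P \<and>
       m (x, r x) \<in> A3 \<and> u x \<in> A3 \<and>
       (m (x, r x) \<in> W \<longrightarrow> u x \<in> W \<longrightarrow> te (m (x, r x)) = te (u x) \<longrightarrow> m (x, r x) = u x)"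
proof -
  have linT: "linear T" and linT1: "linear T1" and linM: "linear M"
    using t(4) te(4) m(4) has_derivative_linear by blast+
  define L where "L v = M (0, v)" for v
  have linL: "linear L"
  proof (rule linearI)
    show "L (x + y) = L x + L y" for x y
      using linear_add[OF linM, of "(0, x)" "(0, y)"] by (simp add: L_def)
    show "L (c *\<^sub>R x) = c *\<^sub>R L x" for c x
      using linear_scale[OF linM, of c "(0, x)"] by (simp add: L_def)
  qed
  note KL = KL[folded L_def] and L = L[folded L_def]
  have Y: "subspace Y" using linear_subspace_image[OF linT W(1)] t(5) by simp
  obtain R where R: "range R \<subseteq> W" "linear R" "\<And>y. y \<in> Y \<Longrightarrow> T (R y) = y"
    using linear_exists_right_inverse_on[OF linT W(1)] t(5) by blast
  obtain R1 where R1: "range R1 \<subseteq> W" "linear R1" "\<And>y. y \<in> Y1 \<Longrightarrow> T1 (R1 y) = y"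
    using linear_exists_right_inverse_on[OF linT1 W(1)] te(5) by blast
  obtain pr where pr: "range pr \<subseteq> W" "linear pr" "\<And>y. y \<in> W \<Longrightarrow> pr y = y"
    using linear_exists_right_inverse_on[OF linear_ident W(1)] by auto
  \<comment> \<open>\<open>B\<close> projects onto the tangent space of the fibre through the unit and maps it back by \<open>K\<close>\<close>
  define B where "B z = K (pr z - R1 (T1 (pr z)))" for z
  have linB: "linear B"
    unfolding B_def
    by (rule linearI) (simp_all add: linear_add[OF K] linear_add[OF pr(2)] linear_add[OF R1(2)] linear_add[OF linT1]
        linear_scale[OF K] linear_scale[OF pr(2)] linear_scale[OF R1(2)] linear_scale[OF linT1]
        linear_diff[OF K] algebra_simps)
  have kerT1: "z - R1 (T1 z) \<in> W \<and> T1 (z - R1 (T1 z)) = 0" if "z \<in> W" for z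
    using that R1 te(5) by (auto intro!: subspace_diff W simp: linear_diff[OF linT1])
  have BW: "B z \<in> W \<and> T (B z) = 0" for z
    using KL kerT1[of "pr z"] pr(1) unfolding B_def by blast
  have BL: "B (L k) = k" if "k \<in> W" "T k = 0" for k
    using L[OF that] by (simp add: B_def pr(3) linear_0[OF R1(2)])
  \<comment> \<open>the correction of \<open>R\<close> makes \<open>S \<circ> T + B \<circ> L\<close> the identity on \<open>W\<close>, whatever \<open>L\<close> does off the fibre\<close>
  define S where "S y = R y - B (L (R y))" for y
  have linS: "linear S"
    unfolding S_def
    by (rule linearI) (simp_all add: linear_add[OF R(2)] linear_add[OF linB] linear_add[OF linL]
        linear_scale[OF R(2)] linear_scale[OF linB] linear_scale[OF linL] algebra_simps)
  have SW: "S y \<in> W" for y using R(1) BW by (auto simp: S_def intro!: subspace_diff W)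
  have TS: "T (S y) = y" if "y \<in> Y" for y using BW R(3)[OF that] by (simp add: S_def linear_diff[OF linT])
  have SB: "S (T v) + B (L v) = v" if "v \<in> W" for v
  proof -
    have k: "v - R (T v) \<in> W" "T (v - R (T v)) = 0"
      using that R t(5) by (auto intro!: subspace_diff W simp: linear_diff[OF linT])
    show ?thesis using BL[OF k] by (simp add: S_def linear_diff[OF linL] linear_diff[OF linB] algebra_simps)
  qed
  \<comment> \<open>subtracting the linear parts normalizes the derivative in the second variable; on \<open>W\<close> they add
    up to \<open>snd p\<close> and cancel\<close>
  define F where "F p = snd p + S (t (snd p) - s (fst p) - T (snd p)) + B (m p - u (fst p) - L (snd p))" for p
  define \<Omega> where "\<Omega> = P \<inter> (A1 \<times> A2)"
  have \<Omega>: "open \<Omega>" "(x0, y0) \<in> \<Omega>"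
    unfolding \<Omega>_def by (rule open_Int[OF m(1) open_Times[OF s(1) t(1)]]) (use s(2) t(2) m(2) in blast)
  have sf: "smooth_in \<Omega> (\<lambda>p. f (fst p))" if "smooth_in A1 f" for f :: "'a \<Rightarrow> 'c::real_normed_vector"
    by (rule smooth_in_compose[OF \<Omega>(1) smooth_in_linear[OF linear_fst \<Omega>(1)] that]) (auto simp: \<Omega>_def)
  have st: "smooth_in \<Omega> (\<lambda>p. t (snd p))"
    by (rule smooth_in_compose[OF \<Omega>(1) smooth_in_linear[OF linear_snd \<Omega>(1)] t(3)]) (auto simp: \<Omega>_def)
  have sm: "smooth_in \<Omega> m" using m(3) by (rule smooth_in_mono) (simp add: \<Omega>_def)
  have sl: "smooth_in \<Omega> (\<lambda>p. f (snd p))" if "linear f" for f :: "'a \<Rightarrow> 'c::real_normed_vector"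
    using smooth_in_linear_comp[OF that \<Omega>(1) smooth_in_linear[OF linear_snd \<Omega>(1)]] .
  note sd = smooth_in_diff[OF \<Omega>(1)] and sa = smooth_in_add[OF \<Omega>(1)] and slc = smooth_in_linear_comp[OF _ \<Omega>(1)]
  have sF: "smooth_in \<Omega> F"
    unfolding F_def
    by (rule sa[OF sa[OF smooth_in_linear[OF linear_snd \<Omega>(1)] slc[OF linS sd[OF sd[OF st sf[OF s(3)]] sl[OF linT]]]]
        slc[OF linB sd[OF sd[OF sm sf[OF u]] sl[OF linL]]]])
  define s' where "s' = frechet_derivative s (at x0)"
  define u' where "u' = frechet_derivative u (at x0)"
  have ds: "((\<lambda>p. s (fst p)) has_derivative (\<lambda>p. s' (fst p))) (at (x0, y0))"
    and du: "((\<lambda>p. u (fst p)) has_derivative (\<lambda>p. u' (fst p))) (at (x0, y0))"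
    using smooth_in_derivative[OF s(3,2)] smooth_in_derivative[OF u s(2)]
    by (auto intro!: has_derivative_compose[OF has_derivative_fst[OF has_derivative_ident]] simp: s'_def u'_def)
  have dt: "((\<lambda>p. t (snd p)) has_derivative (\<lambda>p. T (snd p))) (at (x0, y0))"
    and dT: "((\<lambda>p. T (snd p)) has_derivative (\<lambda>p. T (snd p))) (at (x0, y0))"
    and dL: "((\<lambda>p. L (snd p)) has_derivative (\<lambda>p. L (snd p))) (at (x0, y0))"
    using t(4) linear_imp_has_derivative[OF linT] linear_imp_has_derivative[OF linL]
    by (auto intro!: has_derivative_compose[OF has_derivative_snd[OF has_derivative_ident]])
  note dlin = has_derivative_compose[OF _ linear_imp_has_derivative]
  have dF: "(F has_derivative (\<lambda>p. snd p + S (T (snd p) - s' (fst p) - T (snd p)) +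
      B (M p - u' (fst p) - L (snd p)))) (at (x0, y0))"
    unfolding F_def
    by (rule has_derivative_add[OF has_derivative_add[OF has_derivative_snd[OF has_derivative_ident]
         dlin[OF has_derivative_diff[OF has_derivative_diff[OF dt ds] dT] linS]]
         dlin[OF has_derivative_diff[OF has_derivative_diff[OF m(4) du] dL] linB]])
  have s0: "s' 0 = 0" "u' 0 = 0"
    using smooth_in_derivative[OF s(3,2)] smooth_in_derivative[OF u s(2)]
    by (auto simp: s'_def u'_def linear_0 has_derivative_linear)
  obtain Q' r where Q': "open Q'" "x0 \<in> Q'" "smooth_in Q' r" "r x0 = y0"
    and r: "\<And>x. x \<in> Q' \<Longrightarrow> (x, r x) \<in> \<Omega> \<and> F (x, r x) = 0"
  proof (rule smooth_implicit_function[OF \<Omega>(1) sF \<Omega>(2) dF])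
    show "v = 0" if "snd (0::'a, v) + S (T (snd (0::'a, v)) - s' (fst (0, v)) - T (snd (0::'a, v))) +
      B (M (0, v) - u' (fst (0, v)) - L (snd (0::'a, v))) = 0" for v
      using that by (simp add: s0 L_def linear_0[OF linS] linear_0[OF linB])
    show "F (x0, y0) = 0"
      using SB[OF W(2)] by (simp add: F_def base linear_neg[OF linS] linear_neg[OF linB]) (simp add: algebra_simps)
  qed blast
  \<comment> \<open>near the unit, points of \<open>W\<close> are determined by their target and their component along the fibre\<close>
  have df2: "((\<lambda>q. q + R1 (te q - T1 q)) has_derivative (\<lambda>q. q + R1 (T1 q - T1 q))) (at e0)"
    by (rule has_derivative_add[OF has_derivative_ident dlin[OF has_derivative_diff[OF te(4) linear_imp_has_derivative[OF linT1]] R1(2)]])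
  have sf2: "smooth_in A3 (\<lambda>q. q + R1 (te q - T1 q))"
    by (rule smooth_in_add[OF te(1) smooth_in_linear[OF linear_ident te(1)]
        smooth_in_linear_comp[OF R1(2) te(1) smooth_in_diff[OF te(1) te(3) smooth_in_linear[OF linT1 te(1)]]]])
  obtain B3 where B3: "open B3" "e0 \<in> B3" "B3 \<subseteq> A3" "inj_on (\<lambda>q. q + R1 (te q - T1 q)) B3"
    by (rule locally_injective[OF te(1) sf2 te(2) df2]) (auto simp: inj_def linear_0[OF R1(2)])
  have cr: "continuous_on Q' r" using cont_diff_on_imp_continuous_on Q'(3) by blast
  have cm: "continuous_on Q' (\<lambda>x. m (x, r x))"
    by (rule continuous_on_compose2[OF cont_diff_on_imp_continuous_on[OF m(3)[rule_format, of 0]]])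
      (use r in \<open>auto intro!: continuous_intros cr simp: \<Omega>_def\<close>)
  have cu: "continuous_on Q' u"
    by (rule continuous_on_subset[OF cont_diff_on_imp_continuous_on[OF u[rule_format, of 0]]])
      (use r in \<open>auto simp: \<Omega>_def\<close>)
  define Q where "Q = (Q' \<inter> u -` B3) \<inter> (Q' \<inter> (\<lambda>x. m (x, r x)) -` B3)"
  show thesis
  proof (rule that[of Q r])
    show "open Q"
      unfolding Q_def using continuous_open_preimage[OF cu Q'(1) B3(1)] continuous_open_preimage[OF cm Q'(1) B3(1)]
      by blast
    show "x0 \<in> Q" using Q' B3(2) base by (simp add: Q_def)
    show "smooth_in Q r" using Q'(3) by (rule smooth_in_mono) (auto simp: Q_def)
    show "r x0 = y0" by fact
    show "\<forall>x\<in>Q. s x \<in> Y \<longrightarrow> x \<in> A1 \<and> r x \<in> A2 \<inter> W \<and> t (r x) = s x \<and> (x, r x) \<in> P \<and>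
       m (x, r x) \<in> A3 \<and> u x \<in> A3 \<and>
       (m (x, r x) \<in> W \<longrightarrow> u x \<in> W \<longrightarrow> te (m (x, r x)) = te (u x) \<longrightarrow> m (x, r x) = u x)"
    proof (intro ballI impI)
      fix x assume x: "x \<in> Q" and sx: "s x \<in> Y"
      define y where "y = r x"
      define z where "z = m (x, y) - u x"
      have xQ': "x \<in> Q'" using x by (simp add: Q_def)
      have y\<Omega>: "(x, y) \<in> P" "y \<in> A2" and F0: "F (x, y) = 0"
        using r[OF xQ'] by (auto simp: \<Omega>_def y_def)
      have eq0: "y + (S (t y - s x - T y) + B (z - L y)) = 0"
        using F0 by (simp add: F_def z_def add.assoc)
      from eq0 have "y = - (S (t y - s x - T y) + B (z - L y))" by (simp only: eq_neg_iff_add_eq_0)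
      moreover have "- (S (t y - s x - T y) + B (z - L y)) \<in> W"
        using SW BW W(1) by (intro subspace_neg subspace_add) auto
      ultimately have yW: "y \<in> W" by metis
      have "S (t y - s x) + B z = y + (S (t y - s x - T y) + B (z - L y)) - (y - (S (T y) + B (L y)))"
        by (simp add: linear_diff[OF linS] linear_diff[OF linB] linear_add[OF linS] linear_add[OF linB] algebra_simps)
      then have ST: "S (t y - s x) + B z = 0" using eq0 SB[OF yW] by simp
      have tY: "t y - s x \<in> Y" using t(6) yW y\<Omega> sx by (intro subspace_diff Y) auto
      have "T (S (t y - s x) + B z) = 0" using ST by (simp add: linear_0[OF linT])
      then have ts: "t y = s x" using TS[OF tY] BW by (simp add: linear_add[OF linT])
      then have Bz: "B z = 0" using ST by (simp add: linear_0[OF linS])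
      have "m (x, y) = u x" if mW: "m (x, y) \<in> W" "u x \<in> W" and te_eq: "te (m (x, y)) = te (u x)"
      proof -
        have zW: "z \<in> W" using mW W(1) by (auto simp: z_def intro: subspace_diff)
        have "K (z - R1 (T1 z)) = 0" using Bz by (simp add: B_def pr(3)[OF zW])
        then have "z = R1 (T1 z)"
          using KL kerT1[OF zW] by (metis eq_iff_diff_eq_0 linear_0[OF linL])
        then have "m (x, y) + R1 (te (m (x, y)) - T1 (m (x, y))) = u x + R1 (te (u x) - T1 (u x))"
          by (simp add: te_eq z_def linear_diff[OF linT1] linear_diff[OF R1(2)] algebra_simps)
        then show ?thesis
          using B3(4) x unfolding Q_def y_def inj_on_def by blast
      qed
      moreover have "m (x, r x) \<in> A3" "u x \<in> A3" "x \<in> A1"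
        using x B3(3) r[OF xQ'] by (auto simp: Q_def \<Omega>_def)
      ultimately show "x \<in> A1 \<and> r x \<in> A2 \<inter> W \<and> t (r x) = s x \<and> (x, r x) \<in> P \<and>
         m (x, r x) \<in> A3 \<and> u x \<in> A3 \<and>
         (m (x, r x) \<in> W \<longrightarrow> u x \<in> W \<longrightarrow> te (m (x, r x)) = te (u x) \<longrightarrow> m (x, r x) = u x)"
        using yW y\<Omega> ts unfolding y_def by blast
    qed
  qed
qed

section \<open>Coordinates on manifolds\<close>

text \<open>
  What the coordinate arguments use of a chart, apart from the shape of its image. Unlike the chart property it is inherited
  by product charts, whose images are in general open in no half-space.
\<close>

definition local_coords :: "'a topology \<Rightarrow> 'a set \<Rightarrow> ('a \<Rightarrow> 'e::topological_space) \<Rightarrow> bool" where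
  "local_coords X U \<phi> \<longleftrightarrow> openin X U \<and> inj_on \<phi> U \<and>
     (\<forall>p\<in>U. \<forall>N. openin X N \<and> p \<in> N \<longrightarrow> (\<exists>A. open A \<and> \<phi> p \<in> A \<and> (\<forall>q\<in>U. \<phi> q \<in> A \<longrightarrow> q \<in> N)))"

lemma local_coords_openD:
  assumes "local_coords X U \<phi>" "p \<in> U" "openin X N" "p \<in> N"
  obtains A where "open A" "\<phi> p \<in> A" "\<And>q. q \<in> U \<Longrightarrow> \<phi> q \<in> A \<Longrightarrow> q \<in> N"
  using assms(1)[unfolded local_coords_def, THEN conjunct2, THEN conjunct2, rule_format, of p N] assms(2-4)
    that by metis

lemma is_chart_local_coords:
  assumes "is_chart M U \<phi>"
  shows "local_coords (space_top M) U \<phi>"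
  unfolding local_coords_def
proof (intro conjI ballI allI impI)
  have op: "openin (space_top M) U"
    and hom: "homeomorphic_map (subtopology (space_top M) U) (top_of_set (\<phi> ` U)) \<phi>"
    using assms by (auto simp: is_chart_def)
  have top: "topspace (subtopology (space_top M) U) = U"
    using op openin_subset by (metis topspace_subtopology_subset)
  show "openin (space_top M) U" by fact
  show inj: "inj_on \<phi> U" using homeomorphic_imp_injective_map[OF hom] top by simp
  fix p N assume p: "p \<in> U" and N: "openin (space_top M) N \<and> p \<in> N"
  have "openin (subtopology (space_top M) U) (U \<inter> N)"
    using N by (simp add: openin_subtopology_Int2)
  then have "openin (top_of_set (\<phi> ` U)) (\<phi> ` (U \<inter> N))"
    using homeomorphic_map_openness[OF hom, of "U \<inter> N"] by (simp only: top Int_lower1)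
  then obtain A where A: "open A" "\<phi> ` (U \<inter> N) = \<phi> ` U \<inter> A" by (auto simp: openin_open)
  have "\<phi> p \<in> A" using A(2) p N by blast
  moreover have "q \<in> N" if "q \<in> U" "\<phi> q \<in> A" for q
  proof -
    have "\<phi> q \<in> \<phi> ` (U \<inter> N)" using A(2) that by blast
    then show ?thesis using inj that(1) by (auto dest: inj_onD)
  qed
  ultimately show "\<exists>A. open A \<and> \<phi> p \<in> A \<and> (\<forall>q\<in>U. \<phi> q \<in> A \<longrightarrow> q \<in> N)" using A(1) by blast
qed

lemma is_chart_open_preimage:
  assumes "is_chart M U \<phi>" "open A"
  shows "openin (space_top M) {p \<in> U. \<phi> p \<in> A}"
proof -
  have op: "openin (space_top M) U"
    and hom: "homeomorphic_map (subtopology (space_top M) U) (top_of_set (\<phi> ` U)) \<phi>"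
    using assms by (auto simp: is_chart_def)
  have top: "topspace (subtopology (space_top M) U) = U"
    using op openin_subset by (metis topspace_subtopology_subset)
  have "openin (top_of_set (\<phi> ` U)) (\<phi> ` U \<inter> A)" using assms(2) by (simp add: openin_open_Int)
  from openin_continuous_map_preimage[OF homeomorphic_imp_continuous_map[OF hom] this]
  have "openin (subtopology (space_top M) U) {p \<in> topspace (subtopology (space_top M) U). \<phi> p \<in> \<phi> ` U \<inter> A}" .
  moreover have "{p \<in> topspace (subtopology (space_top M) U). \<phi> p \<in> \<phi> ` U \<inter> A} = {p \<in> U. \<phi> p \<in> A}"
    unfolding top by blast
  ultimately have "openin (subtopology (space_top M) U) {p \<in> U. \<phi> p \<in> A}" by simp
  then show ?thesis using op openin_trans_full by blast
qed

lemma local_coords_prod: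
  assumes "local_coords X U \<phi>" "local_coords Y V \<psi>"
  shows "local_coords (prod_topology X Y) (U \<times> V) (map_prod \<phi> \<psi>)"
  unfolding local_coords_def
proof (intro conjI ballI allI impI)
  show "openin (prod_topology X Y) (U \<times> V)"
    using assms by (simp add: local_coords_def openin_prod_Times_iff)
  show "inj_on (map_prod \<phi> \<psi>) (U \<times> V)"
    using assms by (simp add: local_coords_def map_prod_inj_on)
  fix p N assume p: "p \<in> U \<times> V" and N: "openin (prod_topology X Y) N \<and> p \<in> N"
  obtain a b where ab: "p = (a, b)" "a \<in> U" "b \<in> V" using p by auto
  obtain N1 N2 where N12: "openin X N1" "openin Y N2" "a \<in> N1" "b \<in> N2" "N1 \<times> N2 \<subseteq> N"
    using N ab(1) unfolding openin_prod_topology_alt by blast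
  obtain A where A: "open A" "\<phi> a \<in> A" "\<And>q. q \<in> U \<Longrightarrow> \<phi> q \<in> A \<Longrightarrow> q \<in> N1"
    using local_coords_openD[OF assms(1) ab(2) N12(1,3)] by blast
  obtain B where B: "open B" "\<psi> b \<in> B" "\<And>q. q \<in> V \<Longrightarrow> \<psi> q \<in> B \<Longrightarrow> q \<in> N2"
    using local_coords_openD[OF assms(2) ab(3) N12(2,4)] by blast
  have "open (A \<times> B)" "map_prod \<phi> \<psi> p \<in> A \<times> B"
    using A B ab by (auto intro: open_Times)
  moreover have "\<forall>q\<in>U \<times> V. map_prod \<phi> \<psi> q \<in> A \<times> B \<longrightarrow> q \<in> N"
    using A(3) B(3) N12(5) by auto
  ultimately show "\<exists>A. open A \<and> map_prod \<phi> \<psi> p \<in> A \<and> (\<forall>q\<in>U \<times> V. map_prod \<phi> \<psi> q \<in> A \<longrightarrow> q \<in> N)"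
    by (intro exI[of _ "A \<times> B"] conjI)
qed

lemma smooth_onE:
  assumes "smooth_on S f" "p \<in> S"
  obtains A g where "open A" "p \<in> A" "smooth_in A g" "\<And>x. x \<in> S \<Longrightarrow> x \<in> A \<Longrightarrow> g x = f x"
proof -
  obtain A g where "open A" "p \<in> A" "smooth_in A g" "\<forall>x\<in>S \<inter> A. g x = f x"
    using assms unfolding smooth_on_def by blast
  then show thesis using that by blast
qed

lemma smooth_on_subset:
  assumes "smooth_on S f" "T \<subseteq> S" "\<And>x. x \<in> T \<Longrightarrow> g x = f x"
  shows "smooth_on T g"
  unfolding smooth_on_def
proof
  fix p assume "p \<in> T"
  then obtain A h where "open A" "p \<in> A" "smooth_in A h" "\<And>x. x \<in> S \<Longrightarrow> x \<in> A \<Longrightarrow> h x = f x"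
    using smooth_onE[OF assms(1)] assms(2) by blast
  then show "\<exists>U h. open U \<and> p \<in> U \<and> smooth_in U h \<and> (\<forall>x\<in>T \<inter> U. h x = g x)"
    using assms(2,3) by (intro exI[of _ A] exI[of _ h]) auto
qed

text \<open>
  Near any point a smooth map is represented in coordinates by a smooth map \<open>F\<close> on an open subset of the
  ambient Euclidean space, also at boundary points and corners. Continuity ensures that \<open>F\<close> is only
  compared with \<open>f\<close> where \<open>f\<close> takes values in the chosen chart.
\<close>

lemma smooth_map_on_coords:
  fixes f :: "'a \<Rightarrow> 'b" and \<phi> :: "'a \<Rightarrow> 'e::euclidean_space" and \<psi> :: "'b \<Rightarrow> 'f::euclidean_space"
  assumes "smooth_map_on M S N f" "(U, \<phi>) \<in> atlas M" "(V, \<psi>) \<in> atlas N"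
    and lc: "local_coords (space_top M) U \<phi>" and V: "openin (space_top N) V"
    and p: "p \<in> U" "p \<in> S" "f p \<in> V"
  obtains A F where "open A" "\<phi> p \<in> A" "smooth_in A F"
    "\<And>q. q \<in> U \<Longrightarrow> q \<in> S \<Longrightarrow> \<phi> q \<in> A \<Longrightarrow> f q \<in> V \<and> F (\<phi> q) = \<psi> (f q)"
proof -
  have cont: "continuous_map (subtopology (space_top M) S) (space_top N) f"
    and sm: "smooth_on (\<phi> ` (U \<inter> S \<inter> f -` V)) (\<psi> \<circ> f \<circ> inv_into U \<phi>)"
    using assms(1-3) unfolding smooth_map_on_def by blast+
  have inj: "inj_on \<phi> U" and U: "U \<subseteq> topspace (space_top M)"
    using lc openin_subset unfolding local_coords_def by blast+
  have "\<phi> p \<in> \<phi> ` (U \<inter> S \<inter> f -` V)" using p by blast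
  from smooth_onE[OF sm this] obtain A F where A: "open A" "\<phi> p \<in> A" "smooth_in A F"
    and F: "\<And>x. x \<in> \<phi> ` (U \<inter> S \<inter> f -` V) \<Longrightarrow> x \<in> A \<Longrightarrow> F x = (\<psi> \<circ> f \<circ> inv_into U \<phi>) x" by blast
  have "openin (subtopology (space_top M) S) {q \<in> topspace (subtopology (space_top M) S). f q \<in> V}"
    using openin_continuous_map_preimage[OF cont V] .
  then obtain N' where N': "openin (space_top M) N'"
      "{q \<in> topspace (subtopology (space_top M) S). f q \<in> V} = N' \<inter> S"
    unfolding openin_subtopology by blast
  have "p \<in> N'" using N'(2) p U by auto
  from local_coords_openD[OF lc p(1) N'(1) this]
  obtain B where B: "open B" "\<phi> p \<in> B" "\<And>q. q \<in> U \<Longrightarrow> \<phi> q \<in> B \<Longrightarrow> q \<in> N'" by blast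
  show thesis
  proof (rule that[of "A \<inter> B" F])
    show "open (A \<inter> B)" using A B by auto
    show "\<phi> p \<in> A \<inter> B" using A B by auto
    show "smooth_in (A \<inter> B) F" using A(3) by (rule smooth_in_mono) auto
    fix q assume q: "q \<in> U" "q \<in> S" "\<phi> q \<in> A \<inter> B"
    then have fq: "f q \<in> V" using B(3) N'(2) by blast
    then have "F (\<phi> q) = (\<psi> \<circ> f \<circ> inv_into U \<phi>) (\<phi> q)" using q by (intro F) auto
    then show "f q \<in> V \<and> F (\<phi> q) = \<psi> (f q)" using fq q(1) inj by simp
  qed
qed

lemma manifold_chartE:
  assumes "manifold M" "p \<in> points M"
  obtains U \<phi> where "(U, \<phi>) \<in> atlas M" "p \<in> U"
  using assms unfolding manifold_def by blast

lemma manifold_subspace: "manifold M \<Longrightarrow> subspace (model M)"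
  by (simp add: manifold_def)

lemma manifold_is_chart: "manifold M \<Longrightarrow> (U, \<phi>) \<in> atlas M \<Longrightarrow> is_chart M U \<phi>"
  unfolding manifold_def by blast

lemma manifold_local_coords: "manifold M \<Longrightarrow> (U, \<phi>) \<in> atlas M \<Longrightarrow> local_coords (space_top M) U \<phi>"
  by (simp add: manifold_is_chart is_chart_local_coords)

lemma manifold_chart_open: "manifold M \<Longrightarrow> (U, \<phi>) \<in> atlas M \<Longrightarrow> openin (space_top M) U"
  using manifold_is_chart is_chart_def by blast

lemma manifold_chart_inj: "manifold M \<Longrightarrow> (U, \<phi>) \<in> atlas M \<Longrightarrow> inj_on \<phi> U"
  using manifold_local_coords local_coords_def by blast

lemma manifold_chart_in_model:
  assumes "manifold M" "(U, \<phi>) \<in> atlas M" "p \<in> U"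
  shows "\<phi> p \<in> model M"
  using manifold_is_chart[OF assms(1,2)] assms(3) openin_imp_subset
  unfolding is_chart_def half_space_def by blast

lemma transition_coords:
  fixes \<phi> \<psi> :: "'a \<Rightarrow> 'e::euclidean_space"
  assumes M: "manifold M" and ch: "(U, \<phi>) \<in> atlas M" "(V, \<psi>) \<in> atlas M" and p: "p \<in> U" "p \<in> V"
  obtains A F where "open A" "\<phi> p \<in> A" "smooth_in A F"
    "\<And>q. q \<in> U \<Longrightarrow> \<phi> q \<in> A \<Longrightarrow> q \<in> V \<and> F (\<phi> q) = \<psi> q"
proof -
  have "\<forall>(U, \<phi>)\<in>atlas M. \<forall>(V, \<psi>)\<in>atlas M. smooth_on (\<phi> ` (U \<inter> V)) (\<psi> \<circ> inv_into U \<phi>)"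
    using M by (simp add: manifold_def)
  from bspec[OF bspec[OF this ch(1), simplified] ch(2)]
  have sm: "smooth_on (\<phi> ` (U \<inter> V)) (\<psi> \<circ> inv_into U \<phi>)" by simp
  have "\<phi> p \<in> \<phi> ` (U \<inter> V)" using p by blast
  from smooth_onE[OF sm this] obtain A F where A: "open A" "\<phi> p \<in> A" "smooth_in A F"
    "\<And>x. x \<in> \<phi> ` (U \<inter> V) \<Longrightarrow> x \<in> A \<Longrightarrow> F x = (\<psi> \<circ> inv_into U \<phi>) x"
    by metis
  obtain B where B: "open B" "\<phi> p \<in> B" "\<And>q. q \<in> U \<Longrightarrow> \<phi> q \<in> B \<Longrightarrow> q \<in> V"
    using local_coords_openD[OF manifold_local_coords[OF M ch(1)] p(1) manifold_chart_open[OF M ch(2)] p(2)]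
    by blast
  show thesis
  proof (rule that[of "A \<inter> B" F])
    show "open (A \<inter> B)" using A B by auto
    show "\<phi> p \<in> A \<inter> B" using A B by auto
    show "smooth_in (A \<inter> B) F" using A(3) by (rule smooth_in_mono) auto
    fix q assume q: "q \<in> U" "\<phi> q \<in> A \<inter> B"
    then have "F (\<phi> q) = (\<psi> \<circ> inv_into U \<phi>) (\<phi> q)" using B(3) by (intro A(4)) auto
    then show "q \<in> V \<and> F (\<phi> q) = \<psi> q" using q B(3) manifold_chart_inj[OF M ch(1)] by simp
  qed
qed

text \<open>
  The transition maps in the two directions undo each other, hence so do the differentials of their extensions in
  those directions in which the image of the chart contains a segment.
\<close>

lemma transition_differential:
  fixes \<phi> \<psi> :: "'a \<Rightarrow> 'e::euclidean_space"
  assumes M: "manifold M" and ch: "(U, \<phi>) \<in> atlas M" "(V, \<psi>) \<in> atlas M" and p: "p \<in> U" "p \<in> V"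
  obtains A F D E where "open A" "\<phi> p \<in> A" "(F has_derivative D) (at (\<phi> p))"
    "\<forall>q\<in>U. \<phi> q \<in> A \<longrightarrow> q \<in> V \<and> F (\<phi> q) = \<psi> q"
    "\<forall>v. (\<forall>\<^sub>F \<tau> in nhds (0::real). \<phi> p + \<tau> *\<^sub>R v \<in> \<phi> ` U) \<longrightarrow> E (D v) = v"
proof -
  obtain A1 F1 where F1: "open A1" "\<phi> p \<in> A1" "smooth_in A1 F1"
    "\<And>q. q \<in> U \<Longrightarrow> \<phi> q \<in> A1 \<Longrightarrow> q \<in> V \<and> F1 (\<phi> q) = \<psi> q"
    using transition_coords[OF M ch p] by blast
  obtain A2 F2 where F2: "open A2" "\<psi> p \<in> A2" "smooth_in A2 F2"
    "\<And>q. q \<in> V \<Longrightarrow> \<psi> q \<in> A2 \<Longrightarrow> q \<in> U \<and> F2 (\<psi> q) = \<phi> q"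
    using transition_coords[OF M ch(2,1) p(2,1)] by blast
  define D1 where "D1 = frechet_derivative F1 (at (\<phi> p))"
  define D2 where "D2 = frechet_derivative F2 (at (\<psi> p))"
  have D1: "(F1 has_derivative D1) (at (\<phi> p))"
    unfolding D1_def by (rule smooth_in_derivative[OF F1(3,2)])
  have D2: "(F2 has_derivative D2) (at (\<psi> p))"
    unfolding D2_def by (rule smooth_in_derivative[OF F2(3,2)])
  have F1p: "F1 (\<phi> p) = \<psi> p" using F1(2,4) p(1) by blast
  have "D2 (D1 v) = v" if ev: "\<forall>\<^sub>F \<tau> in nhds (0::real). \<phi> p + \<tau> *\<^sub>R v \<in> \<phi> ` U" for v
  proof -
    let ?k = "\<lambda>\<tau>::real. \<phi> p + \<tau> *\<^sub>R v"
    have k: "(?k has_vector_derivative v) (at 0)" by (rule has_vector_derivative_line)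
    have Fk: "((\<lambda>\<tau>. F1 (?k \<tau>)) has_vector_derivative D1 v) (at 0)"
      by (rule velocity_compose[OF k]) (simp add: D1)
    have FFk: "((\<lambda>\<tau>. F2 (F1 (?k \<tau>))) has_vector_derivative D2 (D1 v)) (at 0)"
      by (rule velocity_compose[OF Fk]) (simp add: D2 F1p)
    have e1: "\<forall>\<^sub>F \<tau> in nhds 0. ?k \<tau> \<in> A1"
      by (rule eventually_curve[OF k F1(1)]) (simp add: F1(2))
    have e2: "\<forall>\<^sub>F \<tau> in nhds 0. F1 (?k \<tau>) \<in> A2"
      by (rule eventually_curve[OF Fk F2(1)]) (simp add: F1p F2(2))
    have "\<forall>\<^sub>F \<tau> in nhds 0. F2 (F1 (?k \<tau>)) = ?k \<tau>"
      using ev e1 e2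
    proof eventually_elim
      case (elim \<tau>)
      then obtain q where "q \<in> U" "?k \<tau> = \<phi> q" by blast
      then show ?case using F1(4)[of q] F2(4)[of q] elim by simp
    qed
    from velocity_unique[OF FFk k this] show ?thesis .
  qed
  then show thesis using that[OF F1(1,2) D1, of D2] F1(4) by blast
qed

subsection \<open>Interior and boundary points\<close>

lemma velocity_at_boundary:
  assumes "(h has_vector_derivative w) (at 0)" "\<forall>\<^sub>F \<tau> in nhds 0. h \<tau> \<in> half_space M" "h 0 \<bullet> inward M = 0"
  shows "w \<bullet> inward M = 0"
proof (rule velocity_at_minimum)
  show "((\<lambda>\<tau>. h \<tau> \<bullet> inward M) has_vector_derivative w \<bullet> inward M) (at 0)"
    by (rule velocity_compose[OF assms(1)]) (auto intro!: derivative_eq_intros)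
  show "\<forall>\<^sub>F \<tau> in nhds 0. h 0 \<bullet> inward M \<le> h \<tau> \<bullet> inward M"
    using assms(2) by eventually_elim (simp add: half_space_def assms(3))
qed

lemma interior_or_boundary_coord:
  assumes M: "manifold M" and ch: "(U, \<phi>) \<in> atlas M" and p: "p \<in> U"
    and not_bdry: "\<not> (inward M \<noteq> 0 \<and> openin (top_of_set (half_space M)) (\<phi> ` U) \<and> \<phi> p \<bullet> inward M = 0)"
  obtains B where "open B" "\<phi> p \<in> B" "B \<inter> model M \<subseteq> \<phi> ` U"
proof -
  have "openin (top_of_set (model M)) (\<phi> ` U) \<or> openin (top_of_set (half_space M)) (\<phi> ` U)"
    using manifold_is_chart[OF M ch] by (simp add: is_chart_def)
  then show thesis
  proof
    assume "openin (top_of_set (model M)) (\<phi> ` U)"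
    then obtain B where "open B" "\<phi> ` U = model M \<inter> B" by (auto simp: openin_open)
    then show thesis using p by (intro that[of B]) auto
  next
    assume half: "openin (top_of_set (half_space M)) (\<phi> ` U)"
    then obtain B where B: "open B" "\<phi> ` U = half_space M \<inter> B" by (auto simp: openin_open)
    have pB: "\<phi> p \<in> half_space M \<inter> B" using B(2) p by blast
    show thesis
    proof (cases "inward M = 0")
      case True
      then show thesis using B pB by (intro that[of B]) (auto simp: half_space_def)
    next
      case False
      then have "\<phi> p \<in> B \<inter> {x. 0 < x \<bullet> inward M}"
        using pB half not_bdry by (auto simp: half_space_def)
      moreover have "open (B \<inter> {x. 0 < x \<bullet> inward M})"
        using B(1) by (intro open_Int open_Collect_less continuous_intros)
      ultimately show thesis using B(2) by (intro that) (auto simp: half_space_def)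
    qed
  qed
qed

lemma int_pts_interior:
  assumes "manifold M" "(U, \<phi>) \<in> atlas M" "p \<in> U" "p \<in> int_pts M"
  obtains B where "open B" "\<phi> p \<in> B" "B \<inter> model M \<subseteq> \<phi> ` U"
  using assms by (elim interior_or_boundary_coord) (auto simp: int_pts_def bdry_def)

text \<open>
  Invariance of the boundary. If a transition map sent an interior point to a boundary point, its
  image would stay on one side of the boundary hyperplane, so its derivative would map the model
  space into this hyperplane; but the derivative is injective.
\<close>

lemma interior_coord_not_boundary:
  fixes \<phi> \<psi> :: "'a \<Rightarrow> 'e::euclidean_space"
  assumes M: "manifold M" and ch: "(U, \<phi>) \<in> atlas M" "(V, \<psi>) \<in> atlas M" and p: "p \<in> U" "p \<in> V"
    and B: "open B" "\<phi> p \<in> B" "B \<inter> model M \<subseteq> \<phi> ` U"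
    and half: "openin (top_of_set (half_space M)) (\<psi> ` V)" "inward M \<noteq> 0"
  shows "\<psi> p \<bullet> inward M \<noteq> 0"
proof
  assume p0: "\<psi> p \<bullet> inward M = 0"
  let ?W = "model M"
  note W = manifold_subspace[OF M]
  from transition_differential[OF M ch p]
  obtain A F D E where A: "open A" "\<phi> p \<in> A" and D: "(F has_derivative D) (at (\<phi> p))"
    and F: "\<forall>q\<in>U. \<phi> q \<in> A \<longrightarrow> q \<in> V \<and> F (\<phi> q) = \<psi> q"
    and E: "\<forall>v. (\<forall>\<^sub>F \<tau> in nhds (0::real). \<phi> p + \<tau> *\<^sub>R v \<in> \<phi> ` U) \<longrightarrow> E (D v) = v" .
  have Fp: "F (\<phi> p) = \<psi> p" using F A(2) p(1) by blast
  have key: "D v \<in> ?W \<and> D v \<bullet> inward M = 0 \<and> E (D v) = v" if v: "v \<in> ?W" for v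
  proof -
    let ?k = "\<lambda>\<tau>::real. \<phi> p + \<tau> *\<^sub>R v"
    have Fk: "((\<lambda>\<tau>. F (?k \<tau>)) has_vector_derivative D v) (at 0)"
      by (rule velocity_compose[OF has_vector_derivative_line]) (simp add: D)
    have ev: "\<forall>\<^sub>F \<tau> in nhds 0. ?k \<tau> \<in> \<phi> ` U \<inter> A"
      by (rule eventually_line_in[OF W manifold_chart_in_model[OF M ch(1) p(1)] v, of "B \<inter> A"])
        (use B A in auto)
    then have half_ev: "\<forall>\<^sub>F \<tau> in nhds 0. F (?k \<tau>) \<in> half_space M"
    proof eventually_elim
      case (elim \<tau>)
      then obtain q where "q \<in> U" "?k \<tau> = \<phi> q" by blast
      then have "F (?k \<tau>) \<in> \<psi> ` V" using F elim by simp
      then show ?case using openin_imp_subset[OF half(1)] by blast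
    qed
    then have "\<forall>\<^sub>F \<tau> in nhds 0. F (?k \<tau>) \<in> ?W"
      by eventually_elim (simp add: half_space_def)
    moreover have "\<forall>\<^sub>F \<tau> in nhds 0. ?k \<tau> \<in> \<phi> ` U" using ev by eventually_elim blast
    ultimately show ?thesis
      using velocity_in_subspace[OF Fk _ W] velocity_at_boundary[OF Fk half_ev] p0 Fp E by simp
  qed
  have linD: "linear D" using D by (rule has_derivative_linear)
  have inj: "inj_on D ?W" by (rule inj_on_inverseI[where g = E]) (use key in blast)
  have "D ` ?W = ?W"
  proof (rule subspace_dim_equal[OF linear_subspace_image[OF linD W] W])
    show "D ` ?W \<subseteq> ?W" using key by blast
    have "span ?W = ?W" using W by (rule span_eq_iff[THEN iffD2])
    then have "dim (D ` ?W) = dim ?W" by (intro dim_image_eq[OF linD]) (simp only: inj)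
    then show "dim ?W \<le> dim (D ` ?W)" by simp
  qed
  moreover have "inward M \<in> ?W" using M by (simp add: manifold_def)
  ultimately obtain v where "v \<in> ?W" "D v = inward M" by (metis imageE)
  then show False using key[of v] half(2) by simp
qed

text \<open>Membership in the boundary, defined by the existence of one chart, can be tested in every chart.\<close>

lemma bdry_coords:
  assumes M: "manifold M" and ch: "(U, \<phi>) \<in> atlas M" and p: "p \<in> U"
  shows "p \<in> bdry M \<longleftrightarrow>
    inward M \<noteq> 0 \<and> openin (top_of_set (half_space M)) (\<phi> ` U) \<and> \<phi> p \<bullet> inward M = 0"
proof
  assume "p \<in> bdry M"
  then obtain V \<psi> where V: "(V, \<psi>) \<in> atlas M" "p \<in> V" "inward M \<noteq> 0"
      "openin (top_of_set (half_space M)) (\<psi> ` V)" "\<psi> p \<bullet> inward M = 0"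
    by (auto simp: bdry_def)
  have no: False if "open B" "\<phi> p \<in> B" "B \<inter> model M \<subseteq> \<phi> ` U" for B
    using interior_coord_not_boundary[OF M ch V(1) p V(2) that V(4,3)] V(5) by blast
  then show "inward M \<noteq> 0 \<and> openin (top_of_set (half_space M)) (\<phi> ` U) \<and> \<phi> p \<bullet> inward M = 0"
    using interior_or_boundary_coord[OF M ch p] by metis
next
  assume "inward M \<noteq> 0 \<and> openin (top_of_set (half_space M)) (\<phi> ` U) \<and> \<phi> p \<bullet> inward M = 0"
  then show "p \<in> bdry M" using ch p by (auto simp: bdry_def)
qed

section \<open>Translations in a Lie category\<close>

text \<open>
  Submersions are defined by derivatives relative to images of charts. This compares them with the derivatives
  of smooth extensions to open sets.
\<close>

lemma derivatives_agree_on_subspace: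
  assumes "(g has_derivative D) (at a within S)" "(t has_derivative T) (at a)"
    and "subspace W" "a \<in> W" "open B" "a \<in> B" "B \<inter> W \<subseteq> S" "\<And>x. x \<in> B \<inter> W \<Longrightarrow> g x = t x" "v \<in> W"
  shows "D v = T v"
proof (rule velocity_unique)
  have ev: "\<forall>\<^sub>F \<tau> in nhds 0. a + \<tau> *\<^sub>R v \<in> B \<inter> W"
    using assms by (intro eventually_line_in[of W a v B]) auto
  then have "\<forall>\<^sub>F \<tau> in nhds 0. a + \<tau> *\<^sub>R v \<in> S"
    by eventually_elim (use assms(7) in blast)
  with assms(1) show "((\<lambda>\<tau>. g (a + \<tau> *\<^sub>R v)) has_vector_derivative D v) (at 0)"
    by (rule has_derivative_within_line)
  show "((\<lambda>\<tau>. t (a + \<tau> *\<^sub>R v)) has_vector_derivative T v) (at 0)"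
    by (rule velocity_compose[OF has_vector_derivative_line]) (simp add: assms(2))
  from ev show "\<forall>\<^sub>F \<tau> in nhds 0. g (a + \<tau> *\<^sub>R v) = t (a + \<tau> *\<^sub>R v)"
    by eventually_elim (use assms(8) in blast)
qed

locale Lie_category =
  fixes C :: "('c, 'e::euclidean_space, 'x, 'f::euclidean_space) lie_cat"
  assumes lie: "lie_category C"
begin

abbreviation "M \<equiv> arrows C"
abbreviation "N \<equiv> objects C"

lemma cat: "small_category C" and M: "manifold M" and N: "manifold N"
  and submersions: "submersion M N (src C)" "submersion M N (tgt C)"
  and ident_smooth: "smooth_map N M (ident C)"
  and mult_smooth: "smooth_map_on (prod_charted M M) (composable C) M (\<lambda>(g, h). mult C g h)"
  and bdry_submersions: "submersion (bdry_mfd M) N (src C)" "submersion (bdry_mfd M) N (tgt C)"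
  using lie unfolding lie_category_def by blast+

lemma src_in: "g \<in> Arr C \<Longrightarrow> src C g \<in> Obj C" and tgt_in: "g \<in> Arr C \<Longrightarrow> tgt C g \<in> Obj C"
  and ident_in: "x \<in> Obj C \<Longrightarrow> ident C x \<in> Arr C"
  and src_ident: "x \<in> Obj C \<Longrightarrow> src C (ident C x) = x"
  and tgt_ident: "x \<in> Obj C \<Longrightarrow> tgt C (ident C x) = x"
  using cat unfolding small_category_def by blast+

lemma mult_in: "(g, h) \<in> composable C \<Longrightarrow> mult C g h \<in> Arr C"
  and src_mult: "(g, h) \<in> composable C \<Longrightarrow> src C (mult C g h) = src C h"
  and tgt_mult: "(g, h) \<in> composable C \<Longrightarrow> tgt C (mult C g h) = tgt C g"
  using cat unfolding small_category_def by blast+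

lemma mult_ident: "g \<in> Arr C \<Longrightarrow> mult C g (ident C (src C g)) = g"
  and ident_mult: "g \<in> Arr C \<Longrightarrow> mult C (ident C (tgt C g)) g = g"
  and assoc: "(g, h) \<in> composable C \<Longrightarrow> (h, k) \<in> composable C \<Longrightarrow>
    mult C (mult C g h) k = mult C g (mult C h k)"
  using cat unfolding small_category_def by blast+

lemma composable_iff: "(g, h) \<in> composable C \<longleftrightarrow> g \<in> Arr C \<and> h \<in> Arr C \<and> src C g = tgt C h"
  by (simp add: composable_def)

lemma inverse_sym: "is_inverse C g h \<Longrightarrow> is_inverse C h g"
  by (auto simp: is_inverse_def composable_iff)

lemma inverseD:
  assumes "is_inverse C g h"
  shows "g \<in> Arr C" "h \<in> Arr C" "src C g = tgt C h" "tgt C g = src C h"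
    "mult C h g = ident C (src C g)" "mult C g h = ident C (tgt C g)"
  using assms by (auto simp: is_inverse_def composable_iff)

lemma right_inverse_unique:
  assumes "is_inverse C g h" "(g, k) \<in> composable C" "mult C g k = ident C (tgt C g)"
  shows "k = h"
proof -
  note D = inverseD[OF assms(1)]
  have hg: "(h, g) \<in> composable C" using D by (simp add: composable_iff)
  have "k = mult C (ident C (tgt C k)) k" using assms(2) by (simp add: ident_mult composable_iff)
  also have "\<dots> = mult C (mult C h g) k" using D assms(2) by (simp add: composable_iff)
  also have "\<dots> = mult C h (ident C (src C h))" using assoc[OF hg assms(2)] assms(3) D by simp
  finally show ?thesis using D by (simp add: mult_ident)
qed

lemma arrow_inv_eq: "is_inverse C g h \<Longrightarrow> arrow_inv C g = h"
  unfolding arrow_inv_def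
  by (rule the_equality) (auto intro: right_inverse_unique simp: is_inverse_def)

lemma inverse_left_cancel:
  assumes "is_inverse C a b" "p \<in> Arr C" "tgt C p = src C a"
  shows "mult C b (mult C a p) = p"
proof -
  note D = inverseD[OF assms(1)]
  have "mult C b (mult C a p) = mult C (mult C b a) p"
    using assoc[of b a p] D assms(2,3) by (simp add: composable_iff)
  then show ?thesis using D assms(2,3) ident_mult by metis
qed

lemma Arr_chart: "g \<in> Arr C \<Longrightarrow> \<exists>U \<phi>. (U, \<phi>) \<in> atlas M \<and> g \<in> U"
  using manifold_chartE[OF M] by metis

lemma Obj_chart: "x \<in> Obj C \<Longrightarrow> \<exists>Z \<zeta>. (Z, \<zeta>) \<in> atlas N \<and> x \<in> Z"
  using manifold_chartE[OF N] by metis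

lemma chart_sub: "(U, \<phi>) \<in> atlas M \<Longrightarrow> U \<subseteq> Arr C"
  using manifold_chart_open[OF M] openin_subset by blast

subsection \<open>The structure maps in coordinates\<close>

lemma mult_coords:
  assumes "(U, \<phi>) \<in> atlas M" "(V, \<psi>) \<in> atlas M" "(X, \<eta>) \<in> atlas M"
    and "g \<in> U" "h \<in> V" "src C g = tgt C h" "mult C g h \<in> X"
  obtains P m where "open P" "(\<phi> g, \<psi> h) \<in> P" "smooth_in P m"
    "\<And>g h. g \<in> U \<Longrightarrow> h \<in> V \<Longrightarrow> src C g = tgt C h \<Longrightarrow> (\<phi> g, \<psi> h) \<in> P \<Longrightarrow>
       mult C g h \<in> X \<and> m (\<phi> g, \<psi> h) = \<eta> (mult C g h)"
proof -
  have "(U \<times> V, map_prod \<phi> \<psi>) \<in> atlas (prod_charted M M)"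
    using assms by (auto simp: prod_charted_def)
  moreover have "local_coords (space_top (prod_charted M M)) (U \<times> V) (map_prod \<phi> \<psi>)"
    using local_coords_prod[OF manifold_local_coords[OF M assms(1)] manifold_local_coords[OF M assms(2)]]
    by (simp add: prod_charted_def)
  moreover have comp: "(g, h) \<in> composable C" if "g \<in> U" "h \<in> V" "src C g = tgt C h" for g h
    using that chart_sub assms(1,2) by (auto simp: composable_iff)
  ultimately obtain P m where P: "open P" "map_prod \<phi> \<psi> (g, h) \<in> P" "smooth_in P m"
    and m: "\<And>q. q \<in> U \<times> V \<Longrightarrow> q \<in> composable C \<Longrightarrow> map_prod \<phi> \<psi> q \<in> P \<Longrightarrow>
      (case q of (g, h) \<Rightarrow> mult C g h) \<in> X \<and> m (map_prod \<phi> \<psi> q) = \<eta> (case q of (g, h) \<Rightarrow> mult C g h)"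
    using smooth_map_on_coords[OF mult_smooth _ assms(3) _ manifold_chart_open[OF M assms(3)], of "U \<times> V" "map_prod \<phi> \<psi>" "(g, h)"]
      assms(4-7) by (metis (no_types, lifting) SigmaI case_prod_conv)
  show thesis
    by (rule that[OF P(1) _ P(3)]) (use P(2) m comp in auto)
qed

text \<open>
  A coordinate representation of the target map near \<open>p\<close> by a smooth map \<open>t\<close> on an open set of the ambient
  Euclidean space; off the image of the chart \<open>t\<close> is arbitrary.
\<close>

definition tgt_rep where
  "tgt_rep U \<phi> Z \<zeta> p A t T \<longleftrightarrow> (U, \<phi>) \<in> atlas M \<and> (Z, \<zeta>) \<in> atlas N \<and> p \<in> U \<and> tgt C p \<in> Z \<and>
     open A \<and> \<phi> p \<in> A \<and> smooth_in A t \<and> (t has_derivative T) (at (\<phi> p)) \<and>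
     (\<forall>q\<in>U. \<phi> q \<in> A \<longrightarrow> tgt C q \<in> Z \<and> t (\<phi> q) = \<zeta> (tgt C q))"

text \<open>
  A coordinate representation of left translation by \<open>a\<close> near \<open>p\<close>. It is prescribed only on the target fibre of
  the arrows that \<open>a\<close> can be composed with.
\<close>

definition left_rep where
  "left_rep a U \<phi> p V \<psi> L D \<longleftrightarrow> (U, \<phi>) \<in> atlas M \<and> (V, \<psi>) \<in> atlas M \<and> p \<in> U \<and> mult C a p \<in> V \<and>
     (\<exists>A. open A \<and> \<phi> p \<in> A \<and> (L has_derivative D) (at (\<phi> p)) \<and>
       (\<forall>q\<in>U. \<phi> q \<in> A \<longrightarrow> tgt C q = src C a \<longrightarrow> mult C a q \<in> V \<and> L (\<phi> q) = \<psi> (mult C a q)))"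

lemma tgt_rep_exists:
  assumes "(U, \<phi>) \<in> atlas M" "(Z, \<zeta>) \<in> atlas N" "p \<in> U" "tgt C p \<in> Z"
  obtains A t T where "tgt_rep U \<phi> Z \<zeta> p A t T"
proof -
  have sm: "smooth_map M N (tgt C)" using submersions(2) by (simp add: submersion_def)
  have "p \<in> Arr C" using chart_sub assms(1,3) by blast
  then obtain A t where A: "open A" "\<phi> p \<in> A" "smooth_in A t"
    "\<And>q. q \<in> U \<Longrightarrow> q \<in> Arr C \<Longrightarrow> \<phi> q \<in> A \<Longrightarrow> tgt C q \<in> Z \<and> t (\<phi> q) = \<zeta> (tgt C q)"
    using smooth_map_on_coords[OF sm assms(1,2) manifold_local_coords[OF M assms(1)]
        manifold_chart_open[OF N assms(2)] assms(3) _ assms(4)] by metis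
  have "tgt_rep U \<phi> Z \<zeta> p A t (frechet_derivative t (at (\<phi> p)))"
    unfolding tgt_rep_def
    using assms A chart_sub[OF assms(1)] smooth_in_derivative[OF A(3,2)] by blast
  then show thesis by (rule that)
qed

lemma tgt_rep_exists':
  assumes "p \<in> Arr C"
  obtains U \<phi> Z \<zeta> A t T where "tgt_rep U \<phi> Z \<zeta> p A t T"
  using tgt_rep_exists Arr_chart[OF assms] Obj_chart[OF tgt_in[OF assms]] by metis

lemma left_rep_of_mult:
  assumes "(Ua, \<phi>a) \<in> atlas M" "(U, \<phi>) \<in> atlas M" "(V, \<psi>) \<in> atlas M"
    and "a \<in> Ua" "p \<in> U" "mult C a p \<in> V" and P: "open P" "(\<phi>a a, \<phi> p) \<in> P"
    and m: "(m has_derivative D) (at (\<phi>a a, \<phi> p))"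
      "\<And>g h. g \<in> Ua \<Longrightarrow> h \<in> U \<Longrightarrow> src C g = tgt C h \<Longrightarrow> (\<phi>a g, \<phi> h) \<in> P \<Longrightarrow>
       mult C g h \<in> V \<and> m (\<phi>a g, \<phi> h) = \<psi> (mult C g h)"
  shows "left_rep a U \<phi> p V \<psi> (\<lambda>x. m (\<phi>a a, x)) (\<lambda>v. D (0, v))"
proof -
  let ?A = "(\<lambda>x. (\<phi>a a, x)) -` P"
  have "open ?A" by (intro open_vimage P(1) continuous_intros)
  moreover have "\<phi> p \<in> ?A" using P by simp
  moreover have "((\<lambda>x. m (\<phi>a a, x)) has_derivative (\<lambda>v. D (0, v))) (at (\<phi> p))"
  proof (rule has_derivative_compose[where f = "\<lambda>x. (\<phi>a a, x)" and f' = "\<lambda>v. (0, v)" and g = m and g' = D])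
    show "((\<lambda>x. (\<phi>a a, x)) has_derivative (\<lambda>v. (0, v))) (at (\<phi> p))"
      by (intro has_derivative_Pair has_derivative_const has_derivative_ident)
  qed (use m(1) in simp)
  moreover have "\<forall>q\<in>U. \<phi> q \<in> ?A \<longrightarrow> tgt C q = src C a \<longrightarrow>
      mult C a q \<in> V \<and> m (\<phi>a a, \<phi> q) = \<psi> (mult C a q)"
    using m(2)[OF assms(4)] by simp
  ultimately show ?thesis
    unfolding left_rep_def using assms(2,3,5,6) by blast
qed

lemma left_rep_exists:
  assumes "(U, \<phi>) \<in> atlas M" "(V, \<psi>) \<in> atlas M" "a \<in> Arr C" "p \<in> U" "src C a = tgt C p" "mult C a p \<in> V"
  obtains L D where "left_rep a U \<phi> p V \<psi> L D"
proof -
  obtain Ua \<phi>a where a: "(Ua, \<phi>a) \<in> atlas M" "a \<in> Ua" using Arr_chart assms(3) by blast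
  obtain P m where P: "open P" "(\<phi>a a, \<phi> p) \<in> P" "smooth_in P m"
    "\<And>g h. g \<in> Ua \<Longrightarrow> h \<in> U \<Longrightarrow> src C g = tgt C h \<Longrightarrow> (\<phi>a g, \<phi> h) \<in> P \<Longrightarrow>
       mult C g h \<in> V \<and> m (\<phi>a g, \<phi> h) = \<psi> (mult C g h)"
    using mult_coords[OF a(1) assms(1,2) a(2) assms(4-6)] by metis
  show thesis
    by (rule that, rule left_rep_of_mult[OF a(1) assms(1,2) a(2) assms(4,6) P(1,2) smooth_in_derivative[OF P(3,2)] P(4)])
qed

text \<open>
  At an interior point the submersion property determines the image of the model space under the derivative of every
  extension, because the image of the chart contains segments in all directions of the model space; at
  a boundary point it contains those in the boundary hyperplane, and the restriction of the
  target map to the boundary takes over.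
\<close>

lemma tgt_rep_surj:
  assumes rep: "tgt_rep U \<phi> Z \<zeta> p A t T" and p: "p \<in> int_pts M"
  shows "T ` model M = model N"
proof -
  have ch: "(U, \<phi>) \<in> atlas M" "(Z, \<zeta>) \<in> atlas N" "p \<in> U" "tgt C p \<in> Z" and A: "open A" "\<phi> p \<in> A"
    and dT: "(t has_derivative T) (at (\<phi> p))"
    and t: "\<And>q. q \<in> U \<Longrightarrow> \<phi> q \<in> A \<Longrightarrow> tgt C q \<in> Z \<and> t (\<phi> q) = \<zeta> (tgt C q)"
    using rep unfolding tgt_rep_def by blast+
  obtain D where "differential_in_charts (U, \<phi>) (Z, \<zeta>) (tgt C) p D" and DW: "D ` model M = model N"
    using submersions(2) ch unfolding submersion_def by fastforce
  then have D: "((\<zeta> \<circ> tgt C \<circ> inv_into U \<phi>) has_derivative D) (at (\<phi> p) within \<phi> ` (U \<inter> tgt C -` Z))"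
    by (simp add: differential_in_charts_def)
  obtain B where B: "open B" "\<phi> p \<in> B" "B \<inter> model M \<subseteq> \<phi> ` U"
    using int_pts_interior[OF M ch(1,3) p] by blast
  have "D v = T v" if "v \<in> model M" for v
  proof (rule derivatives_agree_on_subspace[OF D dT manifold_subspace[OF M] _ _ _ _ _ that])
    show "\<phi> p \<in> model M" using manifold_chart_in_model[OF M ch(1,3)] .
    show "open (A \<inter> B)" "\<phi> p \<in> A \<inter> B" using A B by auto
    show "A \<inter> B \<inter> model M \<subseteq> \<phi> ` (U \<inter> tgt C -` Z)" using B(3) t by blast
    fix x assume "x \<in> A \<inter> B \<inter> model M"
    then obtain q where q: "q \<in> U" "x = \<phi> q" "\<phi> q \<in> A" using B(3) by blast
    then show "(\<zeta> \<circ> tgt C \<circ> inv_into U \<phi>) x = t x"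
      using t manifold_chart_inj[OF M ch(1)] by simp
  qed
  then have "D ` model M = T ` model M" by (intro image_cong refl)
  then show ?thesis using DW by simp
qed

lemma tgt_rep_bdry_surj:
  assumes rep: "tgt_rep U \<phi> Z \<zeta> p A t T" and p: "p \<in> bdry M"
  shows "T ` {x \<in> model M. x \<bullet> inward M = 0} = model N"
proof -
  have ch: "(U, \<phi>) \<in> atlas M" "(Z, \<zeta>) \<in> atlas N" "p \<in> U" "tgt C p \<in> Z" and A: "open A" "\<phi> p \<in> A"
    and dT: "(t has_derivative T) (at (\<phi> p))"
    and t: "\<And>q. q \<in> U \<Longrightarrow> \<phi> q \<in> A \<Longrightarrow> tgt C q \<in> Z \<and> t (\<phi> q) = \<zeta> (tgt C q)"
    using rep unfolding tgt_rep_def by blast+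
  let ?W = "{x \<in> model M. x \<bullet> inward M = 0}" and ?U = "U \<inter> bdry M"
  have W: "subspace ?W"
    using manifold_subspace[OF M] by (auto simp: subspace_def inner_add_left)
  have "(?U, \<phi>) \<in> atlas (bdry_mfd M)" using ch(1) by (force simp: bdry_mfd_def)
  then obtain D where "differential_in_charts (?U, \<phi>) (Z, \<zeta>) (tgt C) p D" and DW: "D ` model (bdry_mfd M) = model N"
    using bdry_submersions(2) ch p unfolding submersion_def by fastforce
  then have D: "((\<zeta> \<circ> tgt C \<circ> inv_into ?U \<phi>) has_derivative D) (at (\<phi> p) within \<phi> ` (?U \<inter> tgt C -` Z))"
    by (simp add: differential_in_charts_def)
  have half: "openin (top_of_set (half_space M)) (\<phi> ` U)" "\<phi> p \<bullet> inward M = 0"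
    using p bdry_coords[OF M ch(1,3)] by blast+
  then obtain B where B: "open B" "\<phi> ` U = half_space M \<inter> B" by (auto simp: openin_open)
  have pre: "\<exists>q\<in>?U. x = \<phi> q" if x: "x \<in> B \<inter> ?W" for x
  proof -
    have "x \<in> \<phi> ` U" using x B(2) by (simp add: half_space_def)
    then obtain q where q: "q \<in> U" "x = \<phi> q" by blast
    then have "q \<in> bdry M" using bdry_coords[OF M ch(1) q(1)] half(1) x p bdry_coords[OF M ch(1,3)] by blast
    then show ?thesis using q by blast
  qed
  have "D v = T v" if "v \<in> ?W" for v
  proof (rule derivatives_agree_on_subspace[OF D dT W _ _ _ _ _ that])
    show "\<phi> p \<in> ?W" using manifold_chart_in_model[OF M ch(1,3)] half(2) by simp
    show "open (A \<inter> B)" "\<phi> p \<in> A \<inter> B" using A B ch(3) by auto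
    show "A \<inter> B \<inter> ?W \<subseteq> \<phi> ` (?U \<inter> tgt C -` Z)" using pre t by blast
    fix x assume x: "x \<in> A \<inter> B \<inter> ?W"
    then obtain q where q: "q \<in> ?U" "x = \<phi> q" using pre by blast
    have "inj_on \<phi> ?U" using manifold_chart_inj[OF M ch(1)] by (rule inj_on_subset) blast
    then show "(\<zeta> \<circ> tgt C \<circ> inv_into ?U \<phi>) x = t x"
      using q x t by simp
  qed
  then have "D ` ?W = T ` ?W" by (intro image_cong refl)
  then show ?thesis using DW by (simp add: bdry_mfd_def)
qed

end

context Lie_category begin

subsection \<open>The differential of a translation along the target fibres\<close>

text \<open>
  The vector \<open>v\<close> is tangent to the target fibre of \<open>p\<close>, hence the velocity of a curve in this fibre, on which
  the translations by \<open>a\<close> and \<open>b\<close> are honest, mutually inverse maps.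
\<close>

lemma translation_differential:
  assumes inv: "is_inverse C a b" and p: "p \<in> int_pts M" "tgt C p = src C a"
    and tp: "tgt_rep U \<phi> Z \<zeta> p A t T" and tq: "tgt_rep V \<psi> Z' \<zeta>' (mult C a p) A' t' T'"
    and La: "left_rep a U \<phi> p V \<psi> L D" and Lb: "left_rep b V \<psi> (mult C a p) U \<phi> K E"
    and v: "v \<in> model M" "T v = 0"
  shows "D v \<in> model M" "T' (D v) = 0" "E (D v) = v"
    and "mult C a p \<in> bdry M \<Longrightarrow> D v \<bullet> inward M = 0"
proof -
  note I = inverseD[OF inv]
  let ?q = "mult C a p"
  have ch: "(U, \<phi>) \<in> atlas M" "(Z, \<zeta>) \<in> atlas N" "p \<in> U" "tgt C p \<in> Z"
    and A: "open A" "\<phi> p \<in> A" "smooth_in A t" "(t has_derivative T) (at (\<phi> p))"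
    and t: "\<And>q. q \<in> U \<Longrightarrow> \<phi> q \<in> A \<Longrightarrow> tgt C q \<in> Z \<and> t (\<phi> q) = \<zeta> (tgt C q)"
    using tp unfolding tgt_rep_def by blast+
  have ch': "(V, \<psi>) \<in> atlas M" "(Z', \<zeta>') \<in> atlas N" "?q \<in> V" "tgt C ?q \<in> Z'"
    and A': "open A'" "\<psi> ?q \<in> A'" "(t' has_derivative T') (at (\<psi> ?q))"
    and t': "\<And>q. q \<in> V \<Longrightarrow> \<psi> q \<in> A' \<Longrightarrow> tgt C q \<in> Z' \<and> t' (\<psi> q) = \<zeta>' (tgt C q)"
    using tq unfolding tgt_rep_def by blast+
  obtain A1 where A1: "open A1" "\<phi> p \<in> A1" "(L has_derivative D) (at (\<phi> p))"
    and L: "\<And>q. q \<in> U \<Longrightarrow> \<phi> q \<in> A1 \<Longrightarrow> tgt C q = src C a \<Longrightarrow> mult C a q \<in> V \<and> L (\<phi> q) = \<psi> (mult C a q)"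
    using La unfolding left_rep_def by blast
  obtain A2 where A2: "open A2" "\<psi> ?q \<in> A2" "(K has_derivative E) (at (\<psi> ?q))"
    and K: "\<And>q. q \<in> V \<Longrightarrow> \<psi> q \<in> A2 \<Longrightarrow> tgt C q = src C b \<Longrightarrow> mult C b q \<in> U \<and> K (\<psi> q) = \<phi> (mult C b q)"
    using Lb unfolding left_rep_def by blast
  obtain B where B: "open B" "\<phi> p \<in> B" "B \<inter> model M \<subseteq> \<phi> ` U"
    using int_pts_interior[OF M ch(1,3) p(1)] by blast
  have TW: "T ` model M = model N" using tgt_rep_surj[OF tp p(1)] .
  have pW: "\<phi> p \<in> model M" using manifold_chart_in_model[OF M ch(1,3)] .
  have oAB: "open (A \<inter> B)" "\<phi> p \<in> A \<inter> B" using A B by auto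
  have sAB: "smooth_in (A \<inter> B) t" using A(3) by (rule smooth_in_mono) auto
  have tY: "t x \<in> model N" if x: "x \<in> A \<inter> B \<inter> model M" for x
  proof -
    obtain q where "q \<in> U" "x = \<phi> q" "\<phi> q \<in> A" using x B(3) by blast
    then show ?thesis using t manifold_chart_in_model[OF N ch(2)] by simp
  qed
  obtain c :: "real \<Rightarrow> 'e" where c: "c 0 = \<phi> p" "(c has_vector_derivative v) (at 0)"
    "\<forall>\<^sub>F \<tau> in nhds 0. c \<tau> \<in> A \<inter> B \<inter> model M \<and> t (c \<tau>) = t (\<phi> p)"
    using level_curve[OF oAB sAB A(4) manifold_subspace[OF M] TW tY pW v] by blast
  have Lc: "((\<lambda>\<tau>. L (c \<tau>)) has_vector_derivative D v) (at 0)"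
    by (rule velocity_compose[OF c(2)]) (simp add: c(1) A1(3))
  have Lp: "L (\<phi> p) = \<psi> ?q" using L[OF ch(3) A1(2) p(2)] by simp
  have KLc: "((\<lambda>\<tau>. K (L (c \<tau>))) has_vector_derivative E (D v)) (at 0)"
    by (rule velocity_compose[OF Lc]) (simp add: c(1) Lp A2(3))
  have tLc: "((\<lambda>\<tau>. t' (L (c \<tau>))) has_vector_derivative T' (D v)) (at 0)"
    by (rule velocity_compose[OF Lc]) (simp add: c(1) Lp A'(3))
  have cA1: "\<forall>\<^sub>F \<tau> in nhds 0. c \<tau> \<in> A1"
    by (rule eventually_curve[OF c(2) A1(1)]) (simp add: c(1) A1(2))
  have LA: "\<forall>\<^sub>F \<tau> in nhds 0. L (c \<tau>) \<in> A' \<inter> A2"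
    by (rule eventually_curve[OF Lc open_Int[OF A'(1) A2(1)]]) (simp add: c(1) Lp A'(2) A2(2))
  \<comment> \<open>the curve lies in the target fibre of \<open>p\<close>, which \<open>a\<close> translates to the target fibre of \<open>a p\<close>\<close>
  have curve: "\<forall>\<^sub>F \<tau> in nhds 0. L (c \<tau>) \<in> \<psi> ` V \<and> K (L (c \<tau>)) = c \<tau> \<and> t' (L (c \<tau>)) = \<zeta>' (tgt C ?q)"
    using c(3) cA1 LA
  proof eventually_elim
    case (elim \<tau>)
    then obtain x where x: "x \<in> U" "c \<tau> = \<phi> x" using B(3) by blast
    have "\<zeta> (tgt C x) = \<zeta> (tgt C p)" "tgt C x \<in> Z"
      using t[OF x(1)] t[OF ch(3) A(2)] elim x(2) by auto
    then have tx: "tgt C x = src C a"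
      using inj_onD[OF manifold_chart_inj[OF N ch(2)]] ch(4) p(2) by metis
    have xA: "x \<in> Arr C" using x(1) chart_sub[OF ch(1)] by blast
    have pA: "p \<in> Arr C" using ch(3) chart_sub[OF ch(1)] by blast
    have ax: "mult C a x \<in> V" "L (c \<tau>) = \<psi> (mult C a x)"
      using L[OF x(1) _ tx] elim x(2) by auto
    have tax: "tgt C (mult C a x) = tgt C a" "tgt C ?q = tgt C a"
      using tgt_mult I(1) xA pA tx p(2) by (simp_all add: composable_iff)
    have "K (L (c \<tau>)) = c \<tau>"
      using K[OF ax(1)] elim ax(2) tax(1) I(4) inverse_left_cancel[OF inv xA tx] x(2) by simp
    moreover have "t' (L (c \<tau>)) = \<zeta>' (tgt C ?q)"
      using t'[OF ax(1)] elim ax(2) tax by simp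
    ultimately show ?case using ax by blast
  qed
  have VW: "\<psi> ` V \<subseteq> model M" using manifold_chart_in_model[OF M ch'(1)] by blast
  from curve have "\<forall>\<^sub>F \<tau> in nhds 0. L (c \<tau>) \<in> model M" by eventually_elim (use VW in blast)
  from velocity_in_subspace[OF Lc this manifold_subspace[OF M]] show "D v \<in> model M" .
  from curve have "\<forall>\<^sub>F \<tau> in nhds 0. t' (L (c \<tau>)) = \<zeta>' (tgt C ?q)" by eventually_elim blast
  from velocity_of_constant[OF tLc this] show "T' (D v) = 0" .
  from curve have "\<forall>\<^sub>F \<tau> in nhds 0. K (L (c \<tau>)) = c \<tau>" by eventually_elim blast
  from velocity_unique[OF KLc c(2) this] show "E (D v) = v" .
  assume "?q \<in> bdry M"
  then have half: "openin (top_of_set (half_space M)) (\<psi> ` V)" "\<psi> ?q \<bullet> inward M = 0"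
    using bdry_coords[OF M ch'(1,3)] by blast+
  from curve have "\<forall>\<^sub>F \<tau> in nhds 0. L (c \<tau>) \<in> half_space M"
    by eventually_elim (use openin_imp_subset[OF half(1)] in blast)
  from velocity_at_boundary[OF Lc this] show "D v \<bullet> inward M = 0" by (simp add: c(1) Lp half(2))
qed

text \<open>
  A translation by an invertible arrow cannot move an interior point \<open>p\<close> to a boundary point \<open>q\<close>: it
  would embed the tangent space of the target fibre at \<open>p\<close>, of codimension \<open>dim X\<close> in the model
  space, into that of the boundary fibre at \<open>q\<close>, of codimension \<open>dim X\<close> in a hyperplane.
\<close>

lemma translation_preserves_interior:
  assumes inv: "is_inverse C a b" and p: "p \<in> int_pts M" "tgt C p = src C a"
  shows "mult C a p \<in> int_pts M"
proof (rule ccontr)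
  let ?q = "mult C a p"
  note I = inverseD[OF inv]
  have pA: "p \<in> Arr C" using p(1) by (simp add: int_pts_def)
  have ap: "(a, p) \<in> composable C" using I(1) pA p(2) by (simp add: composable_iff)
  have qA: "?q \<in> Arr C" and tq: "tgt C ?q = src C b" using mult_in[OF ap] tgt_mult[OF ap] I(4) by simp_all
  assume "?q \<notin> int_pts M"
  then have q: "?q \<in> bdry M" using qA by (simp add: int_pts_def)
  obtain U \<phi> Z \<zeta> A t T where tp: "tgt_rep U \<phi> Z \<zeta> p A t T" using tgt_rep_exists'[OF pA] by blast
  obtain V \<psi> Z' \<zeta>' A' t' T' where tq': "tgt_rep V \<psi> Z' \<zeta>' ?q A' t' T'" using tgt_rep_exists'[OF qA] by blast
  have ch: "(U, \<phi>) \<in> atlas M" "p \<in> U" "(V, \<psi>) \<in> atlas M" "?q \<in> V"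
    and dT: "(t has_derivative T) (at (\<phi> p))" "(t' has_derivative T') (at (\<psi> ?q))"
    using tp tq' unfolding tgt_rep_def by blast+
  obtain L D where La: "left_rep a U \<phi> p V \<psi> L D"
    using left_rep_exists[OF ch(1,3) I(1) ch(2) p(2)[symmetric] ch(4)] by blast
  have "mult C b ?q \<in> U" using inverse_left_cancel[OF inv pA p(2)] ch(2) by simp
  then obtain K E where Lb: "left_rep b V \<psi> ?q U \<phi> K E"
    using left_rep_exists[OF ch(3,1) I(2) ch(4) tq[symmetric]] by blast
  note key = translation_differential[OF inv p tp tq' La Lb]
  let ?W = "model M" and ?H = "{x \<in> model M. x \<bullet> inward M = 0}"
  let ?K1 = "{v \<in> ?W. T v = 0}" and ?K2 = "{v \<in> ?H. T' v = 0}"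
  have W: "subspace ?W" using manifold_subspace[OF M] .
  have H: "subspace ?H" using W by (auto simp: subspace_def inner_add_left)
  have linT: "linear T" "linear T'" using dT has_derivative_linear by blast+
  have linD: "linear D" using La unfolding left_rep_def using has_derivative_linear by blast
  have K1: "subspace ?K1" using W linT by (auto simp: subspace_def linear_0 linear_add linear_scale)
  have K12: "D ` ?K1 \<subseteq> ?K2" using key q by blast
  have "inj_on D ?K1" by (rule inj_on_inverseI[where g = E]) (use key(3) in blast)
  then have "inj_on D (span ?K1)" using span_eq_iff[THEN iffD2, OF K1] by (simp only:)
  then have "dim (D ` ?K1) = dim ?K1" by (rule dim_image_eq[OF linD])
  then have "dim ?K1 \<le> dim ?K2" using dim_subset[OF K12] by simp
  moreover have "dim ?K1 + dim (model N) = dim ?W"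
    using dim_kernel_add_dim_image[OF linT(1) W] tgt_rep_surj[OF tp p(1)] by simp
  moreover have "dim ?K2 + dim (model N) = dim ?H"
    using dim_kernel_add_dim_image[OF linT(2) H] tgt_rep_bdry_surj[OF tq' q] by simp
  ultimately have "?H = ?W" by (intro subspace_dim_equal[OF H W]) auto
  moreover have "inward M \<in> ?W" "inward M \<noteq> 0"
    using M bdry_coords[OF M ch(3,4)] q by (simp_all add: manifold_def)
  ultimately show False by (metis (mono_tags, lifting) inner_eq_zero_iff mem_Collect_eq)
qed

subsection \<open>Inverting arrows smoothly\<close>

text \<open>
  The hypotheses of \<open>solve_right_inverse\<close> on the derivatives are \<open>translation_differential\<close> for \<open>g0\<close>
  acting at \<open>h0\<close> and for \<open>h0\<close> acting at the unit. A solution \<open>r x\<close> lies in the model space near \<open>\<psi> h0\<close>, so it is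
  the coordinate of an arrow because \<open>h0\<close> is an interior point.
\<close>

lemma local_right_inverse:
  assumes inv: "is_inverse C g0 h0" and int: "h0 \<in> int_pts M" "ident C (tgt C g0) \<in> int_pts M"
    and ch: "(U, \<phi>) \<in> atlas M" "g0 \<in> U" "(V, \<psi>) \<in> atlas M" "h0 \<in> V"
  obtains A r where "open A" "\<phi> g0 \<in> A" "smooth_in A r" "r (\<phi> g0) = \<psi> h0"
    "\<And>g. g \<in> U \<Longrightarrow> \<phi> g \<in> A \<Longrightarrow>
       \<exists>h\<in>V. \<psi> h = r (\<phi> g) \<and> (g, h) \<in> composable C \<and> mult C g h = ident C (tgt C g)"
proof -
  note I = inverseD[OF inv]
  let ?e = "ident C (tgt C g0)" and ?W = "model M" and ?Y = "model N"
  have eA: "?e \<in> Arr C" using I(1) by (simp add: ident_in tgt_in)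
  have te: "tgt C ?e = tgt C g0" using I(1) by (simp add: tgt_ident tgt_in)
  obtain Ue \<phi>e where che: "(Ue, \<phi>e) \<in> atlas M" "?e \<in> Ue" using Arr_chart[OF eA] by blast
  obtain Z \<zeta> where Z: "(Z, \<zeta>) \<in> atlas N" "src C g0 \<in> Z" using Obj_chart src_in[OF I(1)] by blast
  obtain Z1 \<zeta>1 where Z1: "(Z1, \<zeta>1) \<in> atlas N" "tgt C g0 \<in> Z1" using Obj_chart tgt_in[OF I(1)] by blast
  obtain A t T where th: "tgt_rep V \<psi> Z \<zeta> h0 A t T"
    using tgt_rep_exists[OF ch(3) Z(1) ch(4)] Z(2) I(3) by metis
  obtain Ae te' T1 where tee: "tgt_rep Ue \<phi>e Z1 \<zeta>1 ?e Ae te' T1"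
    using tgt_rep_exists[OF che(1) Z1(1) che(2)] Z1(2) te by metis
  obtain Ag tg Tg where tgg: "tgt_rep U \<phi> Z1 \<zeta>1 g0 Ag tg Tg"
    using tgt_rep_exists[OF ch(1) Z1(1) ch(2) Z1(2)] by blast
  have sms: "smooth_map M N (src C)" using submersions(1) by (simp add: submersion_def)
  obtain As s where s: "open As" "\<phi> g0 \<in> As" "smooth_in As s"
    "\<And>q. q \<in> U \<Longrightarrow> q \<in> Arr C \<Longrightarrow> \<phi> q \<in> As \<Longrightarrow> src C q \<in> Z \<and> s (\<phi> q) = \<zeta> (src C q)"
    using smooth_map_on_coords[OF sms ch(1) Z(1) manifold_local_coords[OF M ch(1)]
        manifold_chart_open[OF N Z(1)] ch(2) I(1) Z(2)] by metis
  obtain Ai i where i: "open Ai" "\<zeta>1 (tgt C g0) \<in> Ai" "smooth_in Ai i"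
    "\<And>x. x \<in> Z1 \<Longrightarrow> x \<in> Obj C \<Longrightarrow> \<zeta>1 x \<in> Ai \<Longrightarrow> ident C x \<in> Ue \<and> i (\<zeta>1 x) = \<phi>e (ident C x)"
    using smooth_map_on_coords[OF ident_smooth Z1(1) che(1) manifold_local_coords[OF N Z1(1)]
        manifold_chart_open[OF M che(1)] Z1(2) tgt_in[OF I(1)] che(2)] by metis
  have Ag: "open Ag" "\<phi> g0 \<in> Ag" "smooth_in Ag tg"
    "\<And>q. q \<in> U \<Longrightarrow> \<phi> q \<in> Ag \<Longrightarrow> tgt C q \<in> Z1 \<and> tg (\<phi> q) = \<zeta>1 (tgt C q)"
    using tgg unfolding tgt_rep_def by blast+
  have Ah: "open A" "\<psi> h0 \<in> A" "smooth_in A t" "(t has_derivative T) (at (\<psi> h0))"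
    "\<And>q. q \<in> V \<Longrightarrow> \<psi> q \<in> A \<Longrightarrow> tgt C q \<in> Z \<and> t (\<psi> q) = \<zeta> (tgt C q)"
    using th unfolding tgt_rep_def by blast+
  have Ae: "open Ae" "\<phi>e ?e \<in> Ae" "smooth_in Ae te'" "(te' has_derivative T1) (at (\<phi>e ?e))"
    "\<And>q. q \<in> Ue \<Longrightarrow> \<phi>e q \<in> Ae \<Longrightarrow> tgt C q \<in> Z1 \<and> te' (\<phi>e q) = \<zeta>1 (tgt C q)"
    using tee unfolding tgt_rep_def by blast+
  define A1 where "A1 = As \<inter> (Ag \<inter> tg -` Ai)"
  define u where "u x = i (tg x)" for x
  have "continuous_on Ag tg" using cont_diff_on_imp_continuous_on Ag(3) by blast
  then have A1: "open A1" unfolding A1_def by (intro open_Int s(1) continuous_open_preimage Ag(1) i(1))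
  have g0A1: "\<phi> g0 \<in> A1" using s(2) Ag(2) Ag(4)[OF ch(2)] i(2) by (simp add: A1_def)
  have s_A1: "smooth_in A1 s" using s(3) by (rule smooth_in_mono) (auto simp: A1_def)
  have "smooth_in A1 tg" using Ag(3) by (rule smooth_in_mono) (auto simp: A1_def)
  then have u_A1: "smooth_in A1 u"
    unfolding u_def by (rule smooth_in_compose[OF A1 _ i(3)]) (auto simp: A1_def)
  have u: "ident C (tgt C g) \<in> Ue \<and> u (\<phi> g) = \<phi>e (ident C (tgt C g))" if "g \<in> U" "\<phi> g \<in> A1" for g
    using that Ag(4)[of g] i(4)[of "tgt C g"] tgt_in[of g] chart_sub[OF ch(1)] by (auto simp: A1_def u_def)
  have gh: "mult C g0 h0 = ?e" and he: "mult C h0 ?e = h0"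
    using I mult_ident[OF I(2)] by simp_all
  obtain P m where P: "open P" "(\<phi> g0, \<psi> h0) \<in> P" "smooth_in P m"
    and m: "\<And>g h. g \<in> U \<Longrightarrow> h \<in> V \<Longrightarrow> src C g = tgt C h \<Longrightarrow> (\<phi> g, \<psi> h) \<in> P \<Longrightarrow>
       mult C g h \<in> Ue \<and> m (\<phi> g, \<psi> h) = \<phi>e (mult C g h)"
    using mult_coords[OF ch(1,3) che(1) ch(2,4) I(3)] gh che(2) by metis
  define D where "D = frechet_derivative m (at (\<phi> g0, \<psi> h0))"
  have dm: "(m has_derivative D) (at (\<phi> g0, \<psi> h0))"
    unfolding D_def by (rule smooth_in_derivative[OF P(3,2)])
  have Lg: "left_rep g0 V \<psi> h0 Ue \<phi>e (\<lambda>x. m (\<phi> g0, x)) (\<lambda>v. D (0, v))"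
    by (rule left_rep_of_mult[OF ch(1,3) che(1) ch(2,4) _ P(1,2) dm m]) (simp_all add: gh che(2))
  obtain L E where Lh: "left_rep h0 Ue \<phi>e ?e V \<psi> L E"
    using left_rep_exists[OF che(1) ch(3) I(2) che(2)] te I(4) he ch(4) by metis
  have linE: "linear E" using Lh unfolding left_rep_def using has_derivative_linear by blast
  note inv' = inverse_sym[OF inv]
  have tee': "tgt_rep Ue \<phi>e Z1 \<zeta>1 (mult C g0 h0) Ae te' T1"
    and Lh': "left_rep h0 Ue \<phi>e (mult C g0 h0) V \<psi> L E" using tee Lh gh by simp_all
  have th': "tgt_rep V \<psi> Z \<zeta> (mult C h0 ?e) A t T"
    and Lg': "left_rep g0 V \<psi> (mult C h0 ?e) Ue \<phi>e (\<lambda>x. m (\<phi> g0, x)) (\<lambda>v. D (0, v))" using th Lg he by simp_all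
  have te_src: "tgt C ?e = src C h0" using te I(4) by simp
  note d1 = translation_differential[OF inv int(1) I(3)[symmetric] th tee' Lg Lh']
  note d2 = translation_differential[OF inv' int(2) te_src tee th' Lh Lg']
  obtain Bh where Bh: "open Bh" "\<psi> h0 \<in> Bh" "Bh \<inter> ?W \<subseteq> \<psi> ` V"
    using int_pts_interior[OF M ch(3,4) int(1)] by blast
  have A2: "open (A \<inter> Bh)" "\<psi> h0 \<in> A \<inter> Bh" using Ah(1,2) Bh(1,2) by auto
  have t_A2: "smooth_in (A \<inter> Bh) t" using Ah(3) by (rule smooth_in_mono) auto
  have tY: "t y \<in> ?Y" if y: "y \<in> A \<inter> Bh \<inter> ?W" for y
  proof -
    obtain q where "q \<in> V" "y = \<psi> q" "\<psi> q \<in> A" using y Bh(3) by blast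
    then show ?thesis using Ah(5) manifold_chart_in_model[OF N Z(1)] by simp
  qed
  have base: "t (\<psi> h0) = s (\<phi> g0)" "m (\<phi> g0, \<psi> h0) = \<phi>e ?e" "u (\<phi> g0) = \<phi>e ?e"
    using Ah(5)[OF ch(4) Ah(2)] s(4)[OF ch(2) I(1) s(2)] I(3) m[OF ch(2,4) I(3) P(2)] gh u[OF ch(2) g0A1]
    by simp_all
  have L: "D (0, v) \<in> ?W \<and> T1 (D (0, v)) = 0 \<and> E (D (0, v)) = v" if "v \<in> ?W" "T v = 0" for v
    by (intro conjI d1(1-3) that)
  have KL: "E v \<in> ?W \<and> T (E v) = 0 \<and> D (0, E v) = v" if "v \<in> ?W" "T1 v = 0" for v
    by (intro conjI d2(1-3) that)
  from solve_right_inverse[OF manifold_subspace[OF M] manifold_chart_in_model[OF M ch(3,4)]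
        A1 g0A1 s_A1 u_A1 A2 t_A2 Ah(4) tgt_rep_surj[OF th int(1)] tY
        Ae(1-4) tgt_rep_surj[OF tee int(2)] P dm base linE L KL]
  obtain Q r where Q: "open Q" "\<phi> g0 \<in> Q" "smooth_in Q r" "r (\<phi> g0) = \<psi> h0"
    and r: "\<forall>x\<in>Q. s x \<in> ?Y \<longrightarrow> x \<in> A1 \<and> r x \<in> A \<inter> Bh \<inter> ?W \<and> t (r x) = s x \<and> (x, r x) \<in> P \<and>
       m (x, r x) \<in> Ae \<and> u x \<in> Ae \<and>
       (m (x, r x) \<in> ?W \<longrightarrow> u x \<in> ?W \<longrightarrow> te' (m (x, r x)) = te' (u x) \<longrightarrow> m (x, r x) = u x)" .
  have oQ: "open (Q \<inter> A1)" "\<phi> g0 \<in> Q \<inter> A1" using Q A1 g0A1 by auto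
  show thesis
  proof (rule that[of "Q \<inter> A1" r, OF oQ _ Q(4)])
    show "smooth_in (Q \<inter> A1) r" using Q(3) by (rule smooth_in_mono) auto
    fix g assume g: "g \<in> U" "\<phi> g \<in> Q \<inter> A1"
    have gA: "g \<in> Arr C" using g(1) chart_sub[OF ch(1)] by blast
    have sg: "src C g \<in> Z" "s (\<phi> g) = \<zeta> (src C g)"
      using s(4)[OF g(1) gA] g(2) by (auto simp: A1_def)
    then have sY: "s (\<phi> g) \<in> ?Y" using manifold_chart_in_model[OF N Z(1)] by simp
    have "\<phi> g \<in> Q" using g(2) by simp
    note R = mp[OF bspec[OF r this] sY]
    have rg: "r (\<phi> g) \<in> A" "r (\<phi> g) \<in> Bh \<inter> ?W" "t (r (\<phi> g)) = s (\<phi> g)" "(\<phi> g, r (\<phi> g)) \<in> P"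
      using R g(2) by blast+
    then obtain h where h: "h \<in> V" "r (\<phi> g) = \<psi> h" using Bh(3) by blast
    have "tgt C h \<in> Z" "\<zeta> (tgt C h) = \<zeta> (src C g)"
      using Ah(5)[OF h(1)] rg h(2) sg(2) by auto
    then have ts: "src C g = tgt C h"
      using inj_onD[OF manifold_chart_inj[OF N Z(1)]] sg(1) by metis
    have hA: "h \<in> Arr C" using h(1) chart_sub[OF ch(3)] by blast
    have comp: "(g, h) \<in> composable C" using gA hA ts by (simp add: composable_iff)
    have mg: "mult C g h \<in> Ue" "m (\<phi> g, r (\<phi> g)) = \<phi>e (mult C g h)"
      using m[OF g(1) h(1) ts] rg(4) h(2) by auto
    have ug: "ident C (tgt C g) \<in> Ue" "u (\<phi> g) = \<phi>e (ident C (tgt C g))"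
      using u[OF g(1)] g(2) by auto
    have "te' (m (\<phi> g, r (\<phi> g))) = te' (u (\<phi> g))"
      using Ae(5)[OF mg(1)] Ae(5)[OF ug(1)] R g(2) mg(2) ug(2) tgt_mult[OF comp] tgt_ident[OF tgt_in[OF gA]]
      by simp
    then have "\<phi>e (mult C g h) = \<phi>e (ident C (tgt C g))"
      using R g(2) mg ug manifold_chart_in_model[OF M che(1)] by auto
    then have "mult C g h = ident C (tgt C g)"
      using inj_onD[OF manifold_chart_inj[OF M che(1)]] mg(1) ug(1) by metis
    then show "\<exists>h\<in>V. \<psi> h = r (\<phi> g) \<and> (g, h) \<in> composable C \<and> mult C g h = ident C (tgt C g)"
      using h comp by metis
  qed
qed

text \<open>
  Right inverses suffice: if \<open>h\<close> is a right inverse of \<open>g\<close> and \<open>k\<close> one of \<open>h\<close>, then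
  \<open>g = g (h k) = (g h) k = k\<close>, so \<open>h\<close> is a two-sided inverse of \<open>g\<close>.
\<close>

lemma local_inverse:
  assumes inv: "is_inverse C g0 h0" and int: "g0 \<in> int_pts M" "h0 \<in> int_pts M"
      "ident C (tgt C g0) \<in> int_pts M" "ident C (src C g0) \<in> int_pts M"
    and ch: "(U, \<phi>) \<in> atlas M" "g0 \<in> U" "(V, \<psi>) \<in> atlas M" "h0 \<in> V"
  obtains A r where "open A" "\<phi> g0 \<in> A" "smooth_in A r" "r (\<phi> g0) = \<psi> h0"
    "\<And>g. g \<in> U \<Longrightarrow> \<phi> g \<in> A \<Longrightarrow> \<exists>h\<in>V. \<psi> h = r (\<phi> g) \<and> is_inverse C g h"
proof -
  note I = inverseD[OF inv]
  obtain A r where A: "open A" "\<phi> g0 \<in> A" "smooth_in A r" "r (\<phi> g0) = \<psi> h0"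
    and r: "\<And>g. g \<in> U \<Longrightarrow> \<phi> g \<in> A \<Longrightarrow>
       \<exists>h\<in>V. \<psi> h = r (\<phi> g) \<and> (g, h) \<in> composable C \<and> mult C g h = ident C (tgt C g)"
    using local_right_inverse[OF inv int(2,3) ch] by blast
  have "ident C (tgt C h0) \<in> int_pts M" using int(4) I(3) by simp
  from local_right_inverse[OF inverse_sym[OF inv] int(1) this ch(3,4,1,2)]
  obtain A' r' where A': "open A'" "\<psi> h0 \<in> A'"
    and r': "\<And>h. h \<in> V \<Longrightarrow> \<psi> h \<in> A' \<Longrightarrow>
       \<exists>k\<in>U. \<phi> k = r' (\<psi> h) \<and> (h, k) \<in> composable C \<and> mult C h k = ident C (tgt C h)"
    by metis
  let ?A = "A \<inter> r -` A'"
  have "continuous_on A r" using cont_diff_on_imp_continuous_on A(3) by blast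
  then have oA: "open ?A" by (intro continuous_open_preimage A(1) A'(1))
  have gA: "\<phi> g0 \<in> ?A" using A A' by simp
  show thesis
  proof (rule that[of ?A r, OF oA gA _ A(4)])
    show "smooth_in ?A r" using A(3) by (rule smooth_in_mono) auto
    fix g assume g: "g \<in> U" "\<phi> g \<in> ?A"
    obtain h where h: "h \<in> V" "\<psi> h = r (\<phi> g)" "(g, h) \<in> composable C" "mult C g h = ident C (tgt C g)"
      using r[OF g(1)] g(2) by blast
    obtain k where k: "(h, k) \<in> composable C" "mult C h k = ident C (tgt C h)"
      using r'[OF h(1)] h(2) g(2) by auto
    have gA: "g \<in> Arr C" and hA: "h \<in> Arr C" and kA: "k \<in> Arr C" and gh: "src C g = tgt C h" and hk: "src C h = tgt C k"
      using h(3) k(1) by (auto simp: composable_iff)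
    have "src C h = tgt C g" using src_mult[OF h(3)] h(4) src_ident[OF tgt_in[OF gA]] by simp
    then have tk: "tgt C k = tgt C g" using hk by simp
    have "g = mult C g (mult C h k)" using k(2) gh mult_ident[OF gA] by simp
    also have "\<dots> = mult C (ident C (tgt C k)) k" using assoc[OF h(3) k(1)] h(4) tk by simp
    also have "\<dots> = k" by (rule ident_mult[OF kA])
    finally have "g = k" .
    then have "is_inverse C g h" using h(3,4) k gh unfolding is_inverse_def by simp
    then show "\<exists>h\<in>V. \<psi> h = r (\<phi> g) \<and> is_inverse C g h" using h by blast
  qed
qed

end

section \<open>Submanifolds given by restricted charts\<close>

text \<open>
  The common shape of open submanifolds, of the boundary, and of products of these: the topology is the
  subspace topology and the charts are restrictions of charts. The model space may shrink.
\<close>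

definition restricts ::
  "('a, 'e, 'm) charted_scheme \<Rightarrow> ('a, 'e, 'n) charted_scheme \<Rightarrow> 'a set \<Rightarrow> bool" where
  "restricts M' M S \<longleftrightarrow> space_top M' = subtopology (space_top M) S \<and>
     (\<forall>U' \<phi>. (U', \<phi>) \<in> atlas M' \<longrightarrow> (\<exists>U. (U, \<phi>) \<in> atlas M \<and> U' = U \<inter> S))"

lemma restricts_refl: "restricts M M UNIV"
  by (auto simp: restricts_def)

lemma restricts_prod:
  assumes "restricts M' M S" "restricts N' N R"
  shows "restricts (prod_charted M' N') (prod_charted M N) (S \<times> R)"
  unfolding restricts_def
proof (intro conjI allI impI)
  show "space_top (prod_charted M' N') = subtopology (space_top (prod_charted M N)) (S \<times> R)"
    using assms by (simp add: prod_charted_def restricts_def subtopology_Times)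
  fix Q \<theta> assume "(Q, \<theta>) \<in> atlas (prod_charted M' N')"
  then obtain U \<phi> V \<psi> where Q: "Q = U \<times> V" "\<theta> = map_prod \<phi> \<psi>" and U: "(U, \<phi>) \<in> atlas M'" and V: "(V, \<psi>) \<in> atlas N'"
    by (auto simp: prod_charted_def)
  obtain U0 where U0: "(U0, \<phi>) \<in> atlas M" "U = U0 \<inter> S" using assms(1) U unfolding restricts_def by metis
  obtain V0 where V0: "(V0, \<psi>) \<in> atlas N" "V = V0 \<inter> R" using assms(2) V unfolding restricts_def by metis
  have "(U0 \<times> V0, \<theta>) \<in> atlas (prod_charted M N)" using U0 V0 Q by (auto simp: prod_charted_def)
  moreover have "Q = (U0 \<times> V0) \<inter> (S \<times> R)" using U0 V0 Q by auto
  ultimately show "\<exists>P. (P, \<theta>) \<in> atlas (prod_charted M N) \<and> Q = P \<inter> (S \<times> R)" by metis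
qed

lemma smooth_map_onI:
  assumes "continuous_map (subtopology (space_top M) S) (space_top N) f"
    and "\<And>U \<phi> V \<psi>. (U, \<phi>) \<in> atlas M \<Longrightarrow> (V, \<psi>) \<in> atlas N \<Longrightarrow>
      smooth_on (\<phi> ` (U \<inter> S \<inter> f -` V)) (\<psi> \<circ> f \<circ> inv_into U \<phi>)"
  shows "smooth_map_on M S N f"
  using assms unfolding smooth_map_on_def by blast

lemma manifold_transition:
  assumes "manifold M" "(U, \<phi>) \<in> atlas M" "(V, \<psi>) \<in> atlas M"
  shows "smooth_on (\<phi> ` (U \<inter> V)) (\<psi> \<circ> inv_into U \<phi>)"
  using assms unfolding manifold_def by fast

text \<open>Restriction only shrinks the sets on which smooth extensions have to agree with the map.\<close>

lemma smooth_map_on_restricts: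
  assumes "smooth_map_on M T N f" "restricts M' M S" "restricts N' N R"
    and inj: "\<And>U \<phi>. (U, \<phi>) \<in> atlas M \<Longrightarrow> inj_on \<phi> U"
    and T': "T' \<subseteq> T" "T' \<subseteq> S" "f ` T' \<subseteq> R"
  shows "smooth_map_on M' T' N' f"
proof (rule smooth_map_onI)
  have top: "space_top M' = subtopology (space_top M) S" "space_top N' = subtopology (space_top N) R"
    using assms(2,3) by (simp_all add: restricts_def)
  have "continuous_map (subtopology (space_top M) T) (space_top N) f"
    using assms(1) by (simp add: smooth_map_on_def)
  then have "continuous_map (subtopology (space_top M) T') (space_top N) f"
    using T'(1) by (rule continuous_map_from_subtopology_mono)
  moreover have "subtopology (space_top M') T' = subtopology (space_top M) T'"
    using T'(2) by (simp add: top subtopology_subtopology Int_absorb1)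
  ultimately show "continuous_map (subtopology (space_top M') T') (space_top N') f"
    using T'(3) by (auto simp: top continuous_map_in_subtopology)
  fix U' \<phi> V' \<psi> assume U': "(U', \<phi>) \<in> atlas M'" and V': "(V', \<psi>) \<in> atlas N'"
  obtain U where U: "(U, \<phi>) \<in> atlas M" "U' = U \<inter> S" using assms(2) U' unfolding restricts_def by metis
  obtain V where V: "(V, \<psi>) \<in> atlas N" "V' = V \<inter> R" using assms(3) V' unfolding restricts_def by metis
  have sm: "smooth_on (\<phi> ` (U \<inter> T \<inter> f -` V)) (\<psi> \<circ> f \<circ> inv_into U \<phi>)"
    using assms(1) U(1) V(1) unfolding smooth_map_on_def by fast
  show "smooth_on (\<phi> ` (U' \<inter> T' \<inter> f -` V')) (\<psi> \<circ> f \<circ> inv_into U' \<phi>)"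
  proof (rule smooth_on_subset[OF sm])
    show "\<phi> ` (U' \<inter> T' \<inter> f -` V') \<subseteq> \<phi> ` (U \<inter> T \<inter> f -` V)" using U V T' by blast
    fix x assume "x \<in> \<phi> ` (U' \<inter> T' \<inter> f -` V')"
    then obtain q where q: "q \<in> U'" "x = \<phi> q" by blast
    have "inj_on \<phi> U'" using inj[OF U(1)] U(2) by (simp add: inj_on_Int)
    then show "(\<psi> \<circ> f \<circ> inv_into U' \<phi>) x = (\<psi> \<circ> f \<circ> inv_into U \<phi>) x"
      using q U inj[OF U(1)] by simp
  qed
qed

definition restrict_mfd ::
  "('a, 'e::euclidean_space) mfd \<Rightarrow> 'a set \<Rightarrow> 'e set \<Rightarrow> ('a, 'e) mfd" where
  "restrict_mfd M S W =
     \<lparr>space_top = subtopology (space_top M) S, atlas = (\<lambda>(U, \<phi>). (U \<inter> S, \<phi>)) ` atlas M,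
      model = W, inward = 0\<rparr>"

lemma restrict_mfd_sel [simp]:
  "space_top (restrict_mfd M S W) = subtopology (space_top M) S"
  "model (restrict_mfd M S W) = W" "inward (restrict_mfd M S W) = 0"
  by (simp_all add: restrict_mfd_def)

lemma atlas_restrict_mfd:
  "(U', \<phi>) \<in> atlas (restrict_mfd M S W) \<longleftrightarrow> (\<exists>U. (U, \<phi>) \<in> atlas M \<and> U' = U \<inter> S)"
  by (force simp: restrict_mfd_def)

lemma restricts_restrict_mfd: "restricts (restrict_mfd M S W) M S"
  by (simp add: restricts_def atlas_restrict_mfd)

lemma restrict_mfd_restrict_mfd:
  assumes "T \<subseteq> S" shows "restrict_mfd (restrict_mfd M S W) T W' = restrict_mfd M T W'"
proof -
  have "S \<inter> T = T" "\<And>U. U \<inter> S \<inter> T = U \<inter> T" using assms by auto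
  then show ?thesis
    by (simp add: restrict_mfd_def subtopology_subtopology image_image case_prod_beta')
qed

lemma bdry_restrict_mfd [simp]: "bdry (restrict_mfd M S W) = {}"
  by (simp add: bdry_def)

lemma bdry_mfd_eq_restrict_mfd:
  "bdry_mfd M = restrict_mfd M (bdry M) {x \<in> model M. x \<bullet> inward M = 0}"
  by (simp add: bdry_mfd_def restrict_mfd_def)

lemma is_chart_restrict_mfd:
  assumes "is_chart M U \<phi>" "openin (top_of_set W) (\<phi> ` (U \<inter> S))"
  shows "is_chart (restrict_mfd M S W) (U \<inter> S) \<phi>"
proof -
  have op: "openin (space_top M) U"
    and hom: "homeomorphic_map (subtopology (space_top M) U) (top_of_set (\<phi> ` U)) \<phi>"
    using assms by (auto simp: is_chart_def)
  have top: "topspace (subtopology (space_top M) U) = U"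
    using op openin_subset by (metis topspace_subtopology_subset)
  have "homeomorphic_map (subtopology (subtopology (space_top M) U) S)
      (subtopology (top_of_set (\<phi> ` U)) (\<phi> ` (U \<inter> S))) \<phi>"
    by (rule homeomorphic_map_subtopologies[OF hom]) (use top in auto)
  moreover have "subtopology (subtopology (space_top M) U) S = subtopology (subtopology (space_top M) S) (U \<inter> S)"
    by (simp add: subtopology_subtopology Int_ac)
  moreover have "subtopology (top_of_set (\<phi> ` U)) (\<phi> ` (U \<inter> S)) = top_of_set (\<phi> ` (U \<inter> S))"
    by (simp add: subtopology_subtopology Int_absorb1 image_mono)
  ultimately show ?thesis
    using op assms(2) by (simp add: is_chart_def openin_subtopology_Int)
qed

lemma manifold_restrict_mfd:
  assumes M: "manifold M" and S: "S \<subseteq> points M" and W: "subspace W"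
    and op: "\<And>U \<phi>. (U, \<phi>) \<in> atlas M \<Longrightarrow> openin (top_of_set W) (\<phi> ` (U \<inter> S))"
  shows "manifold (restrict_mfd M S W)"
proof -
  have "Hausdorff_space (subtopology (space_top M) S)" "second_countable (subtopology (space_top M) S)"
    using M by (simp_all add: manifold_def Hausdorff_space_subtopology second_countable_subtopology)
  moreover have "(\<Union>(U, \<phi>)\<in>atlas (restrict_mfd M S W). U) = points M \<inter> S"
  proof -
    have "(\<Union>(U, \<phi>)\<in>atlas (restrict_mfd M S W). U) = (\<Union>(U, \<phi>)\<in>atlas M. U) \<inter> S"
      by (auto simp: restrict_mfd_def)
    then show ?thesis using M by (simp add: manifold_def)
  qed
  moreover have "is_chart (restrict_mfd M S W) U' \<phi>" if U': "(U', \<phi>) \<in> atlas (restrict_mfd M S W)" for U' \<phi>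
  proof -
    obtain U where "(U, \<phi>) \<in> atlas M" "U' = U \<inter> S" using U' by (auto simp: atlas_restrict_mfd)
    then show ?thesis using is_chart_restrict_mfd[OF manifold_is_chart[OF M] op] by simp
  qed
  moreover have "smooth_on (\<phi> ` (U' \<inter> V')) (\<psi> \<circ> inv_into U' \<phi>)"
    if U': "(U', \<phi>) \<in> atlas (restrict_mfd M S W)" and V': "(V', \<psi>) \<in> atlas (restrict_mfd M S W)" for U' \<phi> V' \<psi>
  proof -
    obtain U V where U: "(U, \<phi>) \<in> atlas M" "U' = U \<inter> S" and V: "(V, \<psi>) \<in> atlas M" "V' = V \<inter> S"
      using U' V' by (auto simp: atlas_restrict_mfd)
    show ?thesis
    proof (rule smooth_on_subset[OF manifold_transition[OF M U(1) V(1)]])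
      show "\<phi> ` (U' \<inter> V') \<subseteq> \<phi> ` (U \<inter> V)" using U V by blast
      fix x assume "x \<in> \<phi> ` (U' \<inter> V')"
      then obtain q where q: "q \<in> U'" "x = \<phi> q" by blast
      have inj: "inj_on \<phi> U" by (rule manifold_chart_inj[OF M U(1)])
      then have "inj_on \<phi> U'" using U(2) by (simp add: inj_on_Int)
      then show "(\<psi> \<circ> inv_into U' \<phi>) x = (\<psi> \<circ> inv_into U \<phi>) x" using q U inj by simp
    qed
  qed
  ultimately show ?thesis
    unfolding manifold_def by (auto simp: W subspace_0)
qed

text \<open>
  By invariance of the boundary a chart either misses the boundary or cuts it out by the equation of the boundary hyperplane.
\<close>

lemma bdry_chart_open:
  assumes M: "manifold M" and ch: "(U, \<phi>) \<in> atlas M"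
  shows "openin (top_of_set {x \<in> model M. x \<bullet> inward M = 0}) (\<phi> ` (U \<inter> bdry M))"
proof (cases "U \<inter> bdry M = {}")
  case False
  then obtain p where "p \<in> U" "p \<in> bdry M" by blast
  then have half: "openin (top_of_set (half_space M)) (\<phi> ` U)" "inward M \<noteq> 0"
    using bdry_coords[OF M ch] by blast+
  then obtain B where B: "open B" "\<phi> ` U = half_space M \<inter> B" by (auto simp: openin_open)
  have "\<phi> ` (U \<inter> bdry M) = {x \<in> \<phi> ` U. x \<bullet> inward M = 0}"
    using bdry_coords[OF M ch] half by blast
  also have "\<dots> = {x \<in> model M. x \<bullet> inward M = 0} \<inter> B"
    using B(2) by (auto simp: half_space_def)
  finally show ?thesis using B(1) by (auto simp: openin_open)
qed simp

lemma submersion_from_empty_bdry: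
  assumes "bdry M = {}" shows "submersion (bdry_mfd M) N f"
proof -
  have "continuous_map (space_top (bdry_mfd M)) (space_top N) f"
    by (simp add: bdry_mfd_def assms continuous_map_def)
  then show ?thesis
    by (auto simp: submersion_def smooth_map_on_def bdry_mfd_def assms smooth_on_def)
qed

lemma submersion_restrict_mfd:
  assumes "submersion M N f" and M: "manifold M"
  shows "submersion (restrict_mfd M S (model M)) N f"
  unfolding submersion_def
proof (intro conjI ballI)
  show "smooth_map (restrict_mfd M S (model M)) N f"
    using assms(1) manifold_chart_inj[OF M]
    by (intro smooth_map_on_restricts[OF _ restricts_restrict_mfd restricts_refl, of M "points M"])
      (auto simp: submersion_def)
  fix c d p assume c: "c \<in> atlas (restrict_mfd M S (model M))" and d: "d \<in> atlas N" and p: "p \<in> fst c \<inter> f -` fst d"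
  obtain U' \<phi> V \<psi> where cd: "c = (U', \<phi>)" "d = (V, \<psi>)" by (metis prod.collapse)
  then obtain U where U: "(U, \<phi>) \<in> atlas M" "U' = U \<inter> S" using c by (auto simp: atlas_restrict_mfd)
  obtain D where "differential_in_charts (U, \<phi>) (V, \<psi>) f p D" and DW: "D ` model M = model N"
    using assms(1) U d p cd unfolding submersion_def by fastforce
  then have "((\<psi> \<circ> f \<circ> inv_into U \<phi>) has_derivative D) (at (\<phi> p) within \<phi> ` (U \<inter> f -` V))"
    by (simp add: differential_in_charts_def)
  then have "((\<psi> \<circ> f \<circ> inv_into U \<phi>) has_derivative D) (at (\<phi> p) within \<phi> ` (U' \<inter> f -` V))"
    by (rule has_derivative_subset) (use U(2) in blast)
  then have "((\<psi> \<circ> f \<circ> inv_into U' \<phi>) has_derivative D) (at (\<phi> p) within \<phi> ` (U' \<inter> f -` V))"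
  proof (rule has_derivative_transform[rotated 2])
    show "\<phi> p \<in> \<phi> ` (U' \<inter> f -` V)" using p cd by auto
    fix x assume "x \<in> \<phi> ` (U' \<inter> f -` V)"
    then obtain q where q: "q \<in> U'" "x = \<phi> q" by blast
    have inj: "inj_on \<phi> U" by (rule manifold_chart_inj[OF M U(1)])
    then have "inj_on \<phi> U'" using U(2) by (simp add: inj_on_Int)
    then show "(\<psi> \<circ> f \<circ> inv_into U' \<phi>) x = (\<psi> \<circ> f \<circ> inv_into U \<phi>) x" using q U inj by simp
  qed
  then show "\<exists>D. differential_in_charts c d f p D \<and> D ` model (restrict_mfd M S (model M)) = model N"
    using DW cd by (auto simp: differential_in_charts_def)
qed

lemma smooth_map_id: 
  assumes M: "manifold M" shows "smooth_map M M id"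
proof (rule smooth_map_onI)
  show "continuous_map (subtopology (space_top M) (points M)) (space_top M) id" by simp
  fix U \<phi> V \<psi> assume ch: "(U, \<phi>) \<in> atlas M" "(V, \<psi>) \<in> atlas M"
  have "smooth_on (\<phi> ` (U \<inter> V)) (\<psi> \<circ> inv_into U \<phi>)"
    by (rule manifold_transition[OF M ch])
  then show "smooth_on (\<phi> ` (U \<inter> points M \<inter> id -` V)) (\<psi> \<circ> id \<circ> inv_into U \<phi>)"
    by (rule smooth_on_subset) auto
qed

text \<open>
  In coordinates the inclusion is a transition map, whose differential is injective on the model space of the
  submanifold because the chart images are open in it.
\<close>

lemma smooth_embedding_restricts:
  fixes M M' :: "('a, 'e::euclidean_space) mfd"
  assumes M: "manifold M" and res: "restricts M' M S"
    and W: "subspace (model M')"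
    and op: "\<And>U \<phi>. (U, \<phi>) \<in> atlas M' \<Longrightarrow> openin (top_of_set (model M')) (\<phi> ` U)"
  shows "smooth_embedding M' M id"
  unfolding smooth_embedding_def immersion_def
proof (intro conjI ballI)
  have top: "space_top M' = subtopology (space_top M) S" using res by (simp add: restricts_def)
  show "smooth_map M' M id"
    by (rule smooth_map_on_restricts[OF smooth_map_id[OF M] res restricts_refl manifold_chart_inj[OF M]])
      (auto simp: top)
  have "subtopology (space_top M) (points M \<inter> S) = subtopology (space_top M) S"
    by (simp add: subtopology_restrict)
  then show "embedding_map (space_top M') (space_top M) id"
    by (simp add: embedding_map_def top homeomorphic_map_id)
  fix c d p assume c: "c \<in> atlas M'" and d: "d \<in> atlas M" and p: "p \<in> fst c \<inter> id -` fst d"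
  obtain U' \<phi> V \<psi> where cd: "c = (U', \<phi>)" "d = (V, \<psi>)" by (metis prod.collapse)
  obtain U where U: "(U, \<phi>) \<in> atlas M" "U' = U \<inter> S" using res c cd(1) unfolding restricts_def by metis
  have V: "(V, \<psi>) \<in> atlas M" and pU: "p \<in> U'" "p \<in> U" and pV: "p \<in> V" using d cd p U by auto
  have inj: "inj_on \<phi> U" by (rule manifold_chart_inj[OF M U(1)])
  then have inj': "inj_on \<phi> U'" using U(2) by (simp add: inj_on_Int)
  from transition_differential[OF M U(1) V pU(2) pV]
  obtain A F D E where A: "open A" "\<phi> p \<in> A" and D: "(F has_derivative D) (at (\<phi> p))"
    and F: "\<forall>q\<in>U. \<phi> q \<in> A \<longrightarrow> q \<in> V \<and> F (\<phi> q) = \<psi> q"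
    and E: "\<forall>v. (\<forall>\<^sub>F \<tau> in nhds (0::real). \<phi> p + \<tau> *\<^sub>R v \<in> \<phi> ` U) \<longrightarrow> E (D v) = v" .
  obtain B where B: "open B" "\<phi> ` U' = model M' \<inter> B"
    using op c cd(1) by (metis openin_open)
  have pW: "\<phi> p \<in> model M'" "\<phi> p \<in> B" using B(2) pU(1) by blast+
  have "E (D v) = v" if v: "v \<in> model M'" for v
  proof -
    have "\<forall>\<^sub>F \<tau> in nhds (0::real). \<phi> p + \<tau> *\<^sub>R v \<in> \<phi> ` U"
      by (rule eventually_line_in[OF W pW(1) v B(1) pW(2)]) (use B(2) U(2) in blast)
    then show ?thesis using E by blast
  qed
  then have "inj_on D (model M')" by (intro inj_on_inverseI[where g = E])
  moreover have "differential_in_charts c d id p D"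
    unfolding differential_in_charts_def cd prod.case
  proof -
    obtain e where e: "e > 0" "ball (\<phi> p) e \<subseteq> A" using A open_contains_ball by blast
    show "((\<psi> \<circ> id \<circ> inv_into U' \<phi>) has_derivative D) (at (\<phi> p) within \<phi> ` (U' \<inter> id -` V))"
    proof (rule has_derivative_transform_within[OF has_derivative_at_withinI[OF D] e(1)])
      show "\<phi> p \<in> \<phi> ` (U' \<inter> id -` V)" using pU pV by simp
      fix x assume x: "x \<in> \<phi> ` (U' \<inter> id -` V)" "dist x (\<phi> p) < e"
      then obtain q where q: "q \<in> U'" "x = \<phi> q" by blast
      have "x \<in> A" using x(2) e(2) by (auto simp: dist_commute)
      then show "F x = (\<psi> \<circ> id \<circ> inv_into U' \<phi>) x"
        using q inj' F U(2) by simp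
    qed
  qed
  ultimately show "\<exists>D. differential_in_charts c d id p D \<and> inj_on D (model M')" by blast
qed

section \<open>Wide subcategories and the groupoid of invertible arrows\<close>

context Lie_category begin

text \<open>
  Only openness of the restricted charts and the submersion property have to be checked for a wide
  subcategory; all other structure is inherited by restriction.
\<close>

lemma lie_category_restrict:
  fixes S W
  defines "M' \<equiv> restrict_mfd M S W"
  assumes S: "wide_subcategory C S" and W: "subspace W"
    and op: "\<And>U \<phi>. (U, \<phi>) \<in> atlas M \<Longrightarrow> openin (top_of_set W) (\<phi> ` (U \<inter> S))"
    and sub: "submersion M' N (src C)" "submersion M' N (tgt C)"
  shows "lie_category (C\<lparr>arrows := M'\<rparr>)"
proof -
  let ?C = "C\<lparr>arrows := M'\<rparr>"
  have SA: "S \<subseteq> Arr C" and SI: "ident C ` Obj C \<subseteq> S"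
    and SM: "\<And>g h. g \<in> S \<Longrightarrow> h \<in> S \<Longrightarrow> src C g = tgt C h \<Longrightarrow> mult C g h \<in> S"
    using S unfolding wide_subcategory_def by blast+
  have pts: "points M' = S" using SA by (auto simp: M'_def)
  have comp: "composable ?C = composable C \<inter> S \<times> S"
    using SA by (auto simp: composable_def pts)
  have inj: "\<And>U \<phi>. (U, \<phi>) \<in> atlas M \<Longrightarrow> inj_on \<phi> U" by (rule manifold_chart_inj[OF M])
  have injN: "\<And>U \<phi>. (U, \<phi>) \<in> atlas N \<Longrightarrow> inj_on \<phi> U" by (rule manifold_chart_inj[OF N])
  have res: "restricts M' M S" unfolding M'_def by (rule restricts_restrict_mfd)
  have "small_category ?C"
    unfolding small_category_def comp
    using SA SI SM src_in tgt_in src_ident tgt_ident src_mult tgt_mult mult_ident ident_mult assoc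
    by (auto simp: pts composable_iff subset_iff)
  moreover have "manifold M'" unfolding M'_def by (rule manifold_restrict_mfd[OF M SA W op])
  moreover have "smooth_map N M' (ident C)"
    by (rule smooth_map_on_restricts[OF ident_smooth restricts_refl res injN]) (use SI in auto)
  moreover have "smooth_map_on (prod_charted M' M') (composable ?C) M' (\<lambda>(g, h). mult C g h)"
  proof (rule smooth_map_on_restricts[OF mult_smooth restricts_prod[OF res res] res])
    show "inj_on \<theta> Q" if "(Q, \<theta>) \<in> atlas (prod_charted M M)" for Q \<theta>
      using that inj by (auto simp: prod_charted_def intro!: map_prod_inj_on)
    show "(\<lambda>(g, h). mult C g h) ` composable ?C \<subseteq> S" using SM by (auto simp: comp composable_iff)
  qed (auto simp: comp)
  moreover have "submersion (bdry_mfd M') N (src C)" "submersion (bdry_mfd M') N (tgt C)"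
    by (rule submersion_from_empty_bdry, simp add: M'_def)+
  moreover have "bdry N = {}" using lie by (simp add: lie_category_def)
  ultimately show ?thesis
    using sub N by (simp add: lie_category_def)
qed

lemma inverse_ident: "x \<in> Obj C \<Longrightarrow> is_inverse C (ident C x) (ident C x)"
  using mult_ident[OF ident_in] by (simp add: is_inverse_def composable_iff ident_in src_ident tgt_ident)

lemma inverse_mult:
  assumes g: "is_inverse C g g'" and h: "is_inverse C h h'" and gh: "src C g = tgt C h"
  shows "is_inverse C (mult C g h) (mult C h' g')"
proof -
  have half: "mult C (mult C h' g') (mult C g h) = ident C (src C h)"
    if g: "is_inverse C g g'" and h: "is_inverse C h h'" and gh: "src C g = tgt C h" for g g' h h'
  proof -
    note G = inverseD[OF g] and H = inverseD[OF h]
    have c: "(h', g') \<in> composable C" "(g, h) \<in> composable C" using G H gh by (auto simp: composable_iff)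
    then have "mult C (mult C h' g') (mult C g h) = mult C h' (mult C g' (mult C g h))"
      using G H gh src_mult[OF c(1)] tgt_mult[OF c(2)] mult_in[OF c(2)] by (intro assoc) (auto simp: composable_iff)
    then show ?thesis using inverse_left_cancel[OF g, of h] G H gh by simp
  qed
  note G = inverseD[OF g] and H = inverseD[OF h]
  have c: "(h', g') \<in> composable C" "(g, h) \<in> composable C" using G H gh by (auto simp: composable_iff)
  show ?thesis
    using half[OF g h gh] half[OF inverse_sym[OF h] inverse_sym[OF g]] G H gh
      mult_in[OF c(1)] mult_in[OF c(2)] src_mult[OF c(1)] src_mult[OF c(2)] tgt_mult[OF c(1)] tgt_mult[OF c(2)]
    by (simp add: is_inverse_def composable_iff)
qed

lemma invertibles_iff: "g \<in> invertibles C \<longleftrightarrow> (\<exists>h. is_inverse C g h)"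
  using inverseD(1) by (auto simp: invertibles_def)

lemma wide_invertibles: "wide_subcategory C (invertibles C)"
  unfolding wide_subcategory_def
proof (intro conjI ballI impI)
  show "invertibles C \<subseteq> Arr C" by (auto simp: invertibles_def)
  show "ident C ` Obj C \<subseteq> invertibles C" using inverse_ident unfolding image_subset_iff invertibles_iff by blast
  show "mult C g h \<in> invertibles C" if "g \<in> invertibles C" "h \<in> invertibles C" "src C g = tgt C h" for g h
    using that inverse_mult unfolding invertibles_iff by blast
qed

text \<open>An invertible arrow \<open>g = g 1\<close> is the translate of a unit.\<close>

lemma invertible_interior_if_units_interior:
  assumes "ident C ` Obj C \<subseteq> int_pts M" shows "invertibles C \<subseteq> int_pts M"
proof
  fix g assume "g \<in> invertibles C"
  then obtain h where h: "is_inverse C g h" unfolding invertibles_iff by blast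
  note I = inverseD[OF h]
  have "ident C (src C g) \<in> int_pts M" using assms src_in[OF I(1)] by blast
  then have "mult C g (ident C (src C g)) \<in> int_pts M"
    by (rule translation_preserves_interior[OF h]) (simp add: tgt_ident src_in I(1))
  then show "g \<in> int_pts M" by (simp add: mult_ident I(1))
qed

text \<open>A unit \<open>1 = g\<^sup>-\<^sup>1 g\<close> is the translate of the invertible arrow \<open>g\<close>.\<close>

lemma invertible_boundary_if_units_boundary:
  assumes "ident C ` Obj C \<subseteq> bdry M" shows "invertibles C \<subseteq> bdry M"
proof
  fix g assume "g \<in> invertibles C"
  then obtain h where h: "is_inverse C g h" unfolding invertibles_iff by blast
  note I = inverseD[OF h]
  have "ident C (src C g) \<in> bdry M" using assms src_in[OF I(1)] by blast
  then have "mult C h g \<notin> int_pts M" by (simp add: I(5) int_pts_def)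
  then have "g \<notin> int_pts M"
    using translation_preserves_interior[OF inverse_sym[OF h]] I(4) by blast
  then show "g \<in> bdry M" using I(1) by (simp add: int_pts_def)
qed

text \<open>When all invertible arrows are interior points, they form an open subgroupoid.\<close>

context
  assumes interior: "invertibles C \<subseteq> int_pts M"
begin

lemma local_inverse_invertible:
  assumes "is_inverse C g0 h0" "(U, \<phi>) \<in> atlas M" "g0 \<in> U" "(V, \<psi>) \<in> atlas M" "h0 \<in> V"
  obtains A r where "open A" "\<phi> g0 \<in> A" "smooth_in A r" "r (\<phi> g0) = \<psi> h0"
    "\<And>g. g \<in> U \<Longrightarrow> \<phi> g \<in> A \<Longrightarrow> \<exists>h\<in>V. \<psi> h = r (\<phi> g) \<and> is_inverse C g h"
proof (rule local_inverse[OF assms(1) _ _ _ _ assms(2-5)])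
  note I = inverseD[OF assms(1)]
  show "g0 \<in> int_pts M" using interior assms(1) invertibles_iff by blast
  show "h0 \<in> int_pts M" using interior inverse_sym[OF assms(1)] invertibles_iff by blast
  show "ident C (tgt C g0) \<in> int_pts M" "ident C (src C g0) \<in> int_pts M"
    using interior inverse_ident src_in[OF I(1)] tgt_in[OF I(1)] invertibles_iff by blast+
qed (rule that)

lemma invertibles_open: "openin (space_top M) (invertibles C)"
proof (subst openin_subopen, intro ballI)
  fix g0 assume "g0 \<in> invertibles C"
  then obtain h0 where h0: "is_inverse C g0 h0" unfolding invertibles_iff by blast
  obtain U \<phi> where U: "(U, \<phi>) \<in> atlas M" "g0 \<in> U" using Arr_chart inverseD(1)[OF h0] by blast
  obtain V \<psi> where V: "(V, \<psi>) \<in> atlas M" "h0 \<in> V" using Arr_chart inverseD(2)[OF h0] by blast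
  obtain A r where A: "open A" "\<phi> g0 \<in> A"
    "\<And>g. g \<in> U \<Longrightarrow> \<phi> g \<in> A \<Longrightarrow> \<exists>h\<in>V. \<psi> h = r (\<phi> g) \<and> is_inverse C g h"
    using local_inverse_invertible[OF h0 U V] by metis
  have "{g \<in> U. \<phi> g \<in> A} \<subseteq> invertibles C"
  proof
    fix g assume "g \<in> {g \<in> U. \<phi> g \<in> A}"
    then have "\<exists>h\<in>V. \<psi> h = r (\<phi> g) \<and> is_inverse C g h" using A(3)[of g] by simp
    then show "g \<in> invertibles C" unfolding invertibles_iff by blast
  qed
  then show "\<exists>T. openin (space_top M) T \<and> g0 \<in> T \<and> T \<subseteq> invertibles C"
    using is_chart_open_preimage[OF manifold_is_chart[OF M U(1)] A(1)] U(2) A(2) by blast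
qed

lemma invertibles_chart_open:
  assumes "(U, \<phi>) \<in> atlas M"
  shows "openin (top_of_set (model M)) (\<phi> ` (U \<inter> invertibles C))"
proof (subst openin_subopen, intro ballI)
  fix x assume "x \<in> \<phi> ` (U \<inter> invertibles C)"
  then obtain p where p: "p \<in> U" "p \<in> invertibles C" "x = \<phi> p" by blast
  obtain B where B: "open B" "\<phi> p \<in> B" "B \<inter> model M \<subseteq> \<phi> ` U"
    using int_pts_interior[OF M assms p(1)] interior p(2) by blast
  obtain A where A: "open A" "\<phi> p \<in> A" "\<And>q. q \<in> U \<Longrightarrow> \<phi> q \<in> A \<Longrightarrow> q \<in> invertibles C"
    using local_coords_openD[OF manifold_local_coords[OF M assms] p(1) invertibles_open p(2)] by metis
  have "openin (top_of_set (model M)) (model M \<inter> (A \<inter> B))"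
    using A(1) B(1) by (intro openin_open_Int open_Int)
  moreover have "x \<in> model M \<inter> (A \<inter> B)"
    using p A B manifold_chart_in_model[OF M assms] by simp
  moreover have "model M \<inter> (A \<inter> B) \<subseteq> \<phi> ` (U \<inter> invertibles C)" using A(3) B(3) by blast
  ultimately show "\<exists>T. openin (top_of_set (model M)) T \<and> x \<in> T \<and> T \<subseteq> \<phi> ` (U \<inter> invertibles C)" by blast
qed

lemma arrow_inv_smooth: "smooth_map_on M (invertibles C) M (arrow_inv C)"
proof (rule smooth_map_onI)
  have "openin (space_top M) {g \<in> invertibles C. arrow_inv C g \<in> O'}" if O': "openin (space_top M) O'" for O'
  proof (subst openin_subopen, intro ballI)
    fix g0 assume g0: "g0 \<in> {g \<in> invertibles C. arrow_inv C g \<in> O'}"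
    then obtain h0 where h0: "is_inverse C g0 h0" unfolding invertibles_iff by blast
    then have h0O: "h0 \<in> O'" using g0 arrow_inv_eq by simp
    obtain U \<phi> where U: "(U, \<phi>) \<in> atlas M" "g0 \<in> U" using Arr_chart inverseD(1)[OF h0] by blast
    obtain V \<psi> where V: "(V, \<psi>) \<in> atlas M" "h0 \<in> V" using Arr_chart inverseD(2)[OF h0] by blast
    obtain A r where A: "open A" "\<phi> g0 \<in> A" "smooth_in A r" "r (\<phi> g0) = \<psi> h0"
      "\<And>g. g \<in> U \<Longrightarrow> \<phi> g \<in> A \<Longrightarrow> \<exists>h\<in>V. \<psi> h = r (\<phi> g) \<and> is_inverse C g h"
      using local_inverse_invertible[OF h0 U V] by metis
    obtain B where B: "open B" "\<psi> h0 \<in> B" "\<And>q. q \<in> V \<Longrightarrow> \<psi> q \<in> B \<Longrightarrow> q \<in> O'"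
      using local_coords_openD[OF manifold_local_coords[OF M V(1)] V(2) O' h0O] by metis
    have "continuous_on A r" using cont_diff_on_imp_continuous_on A(3) by blast
    then have oA: "open (A \<inter> r -` B)" by (intro continuous_open_preimage A(1) B(1))
    have "{g \<in> U. \<phi> g \<in> A \<inter> r -` B} \<subseteq> {g \<in> invertibles C. arrow_inv C g \<in> O'}"
    proof
      fix g assume g: "g \<in> {g \<in> U. \<phi> g \<in> A \<inter> r -` B}"
      then obtain h where h: "h \<in> V" "\<psi> h = r (\<phi> g)" "is_inverse C g h" using A(5) by blast
      then show "g \<in> {g \<in> invertibles C. arrow_inv C g \<in> O'}"
        using g B(3)[OF h(1)] arrow_inv_eq[OF h(3)] unfolding invertibles_iff by auto
    qed
    moreover have "g0 \<in> {g \<in> U. \<phi> g \<in> A \<inter> r -` B}" using U A B by simp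
    ultimately show "\<exists>T. openin (space_top M) T \<and> g0 \<in> T \<and> T \<subseteq> {g \<in> invertibles C. arrow_inv C g \<in> O'}"
      using is_chart_open_preimage[OF manifold_is_chart[OF M U(1)] oA] by blast
  qed
  moreover have "arrow_inv C g \<in> Arr C" if "g \<in> invertibles C" for g
    using that arrow_inv_eq inverseD(2) unfolding invertibles_iff by metis
  moreover have "Arr C \<inter> invertibles C = invertibles C" by (auto simp: invertibles_def)
  ultimately show "continuous_map (subtopology (space_top M) (invertibles C)) (space_top M) (arrow_inv C)"
    using invertibles_open by (auto simp: continuous_map_def openin_open_subtopology)
  fix U \<phi> V \<psi> assume U: "(U, \<phi>) \<in> atlas M" and V: "(V, \<psi>) \<in> atlas M"
  let ?S = "U \<inter> invertibles C \<inter> arrow_inv C -` V"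
  show "smooth_on (\<phi> ` ?S) (\<psi> \<circ> arrow_inv C \<circ> inv_into U \<phi>)"
    unfolding smooth_on_def
  proof
    fix x assume "x \<in> \<phi> ` ?S"
    then obtain g0 where g0: "g0 \<in> ?S" "x = \<phi> g0" by blast
    then obtain h0 where h0: "is_inverse C g0 h0" using invertibles_iff by blast
    then have h0V: "h0 \<in> V" using g0(1) arrow_inv_eq[OF h0] by simp
    obtain A r where A: "open A" "\<phi> g0 \<in> A" "smooth_in A r"
      "\<And>g. g \<in> U \<Longrightarrow> \<phi> g \<in> A \<Longrightarrow> \<exists>h\<in>V. \<psi> h = r (\<phi> g) \<and> is_inverse C g h"
      using local_inverse_invertible[OF h0 U _ V h0V] g0(1) by (metis IntD1)
    have "\<forall>y\<in>\<phi> ` ?S \<inter> A. r y = (\<psi> \<circ> arrow_inv C \<circ> inv_into U \<phi>) y"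
    proof
      fix y assume y: "y \<in> \<phi> ` ?S \<inter> A"
      then obtain g where g: "g \<in> U" "y = \<phi> g" by blast
      then obtain h where h: "\<psi> h = r (\<phi> g)" "is_inverse C g h" using A(4) y by blast
      then show "r y = (\<psi> \<circ> arrow_inv C \<circ> inv_into U \<phi>) y"
        using g arrow_inv_eq[OF h(2)] manifold_chart_inj[OF M U] by simp
    qed
    then show "\<exists>A r. open A \<and> x \<in> A \<and> smooth_in A r \<and>
        (\<forall>y\<in>\<phi> ` ?S \<inter> A. r y = (\<psi> \<circ> arrow_inv C \<circ> inv_into U \<phi>) y)"
      using A(1-3) g0(2) by (intro exI[of _ A] exI[of _ r]) simp
  qed
qed

lemma lie_groupoid_invertibles:
  "lie_groupoid (C\<lparr>arrows := restrict_mfd M (invertibles C) (model M)\<rparr>)"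
proof -
  let ?G = "invertibles C"
  let ?M = "restrict_mfd M ?G (model M)"
  let ?C = "C\<lparr>arrows := ?M\<rparr>"
  have lc: "lie_category ?C"
    by (rule lie_category_restrict[OF wide_invertibles manifold_subspace[OF M] invertibles_chart_open])
      (simp_all add: submersion_restrict_mfd[OF _ M] submersions)
  have G: "Arr C \<inter> ?G = ?G" by (auto simp: invertibles_def)
  have inv: "is_inverse ?C g h \<longleftrightarrow> is_inverse C g h" for g h
  proof -
    have "is_inverse C g h \<Longrightarrow> g \<in> ?G \<and> h \<in> ?G" using inverse_sym unfolding invertibles_iff by blast
    then show ?thesis using G by (auto simp: is_inverse_def composable_def)
  qed
  then have inv_eq: "is_inverse ?C = is_inverse C" by (intro ext)
  then have "arrow_inv ?C = arrow_inv C" by (simp add: fun_eq_iff arrow_inv_def)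
  moreover have "smooth_map_on ?M ?G ?M (arrow_inv C)"
  proof (rule smooth_map_on_restricts[OF arrow_inv_smooth restricts_restrict_mfd restricts_restrict_mfd
        manifold_chart_inj[OF M]])
    show "arrow_inv C ` ?G \<subseteq> ?G"
      using arrow_inv_eq inverse_sym by (force simp: invertibles_iff)
  qed auto
  moreover have "invertibles ?C = ?G"
  proof (rule set_eqI)
    fix g
    have "points ?M = ?G" using G by simp
    then show "g \<in> invertibles ?C \<longleftrightarrow> g \<in> ?G"
      unfolding invertibles_def[of ?C] inv_eq using invertibles_iff[of g] by simp
  qed
  ultimately show ?thesis using lc by (simp add: lie_groupoid_def G)
qed

end

text \<open>
  The manifold of objects has empty boundary but possibly charts onto open subsets of a half-space. These
  avoid the boundary hyperplane, so they are open in the model space and the identity is an embedding.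
\<close>

lemma embedded_restriction:
  assumes lc: "lie_category (C\<lparr>arrows := restrict_mfd M S W\<rparr>)" and S: "S \<subseteq> Arr C"
    and W: "subspace W" and op: "\<And>U \<phi>. (U, \<phi>) \<in> atlas M \<Longrightarrow> openin (top_of_set W) (\<phi> ` (U \<inter> S))"
  shows "embedded_lie_subcategory (C\<lparr>arrows := restrict_mfd M S W\<rparr>) C id id"
proof -
  let ?M = "restrict_mfd M S W"
  have emb: "smooth_embedding ?M M id"
    by (rule smooth_embedding_restricts[OF M restricts_restrict_mfd])
      (use W op in \<open>auto simp: atlas_restrict_mfd\<close>)
  have "openin (top_of_set (model N)) (\<zeta> ` Z)" if Z: "(Z, \<zeta>) \<in> atlas N" for Z \<zeta>
  proof (subst openin_subopen, intro ballI)
    fix x assume "x \<in> \<zeta> ` Z"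
    then obtain p where p: "p \<in> Z" "x = \<zeta> p" by blast
    have "p \<in> int_pts N"
      using p(1) Z manifold_chart_open[OF N Z] openin_subset lie by (fastforce simp: int_pts_def lie_category_def)
    then obtain B where "open B" "\<zeta> p \<in> B" "B \<inter> model N \<subseteq> \<zeta> ` Z"
      using int_pts_interior[OF N Z p(1)] by blast
    then show "\<exists>T. openin (top_of_set (model N)) T \<and> x \<in> T \<and> T \<subseteq> \<zeta> ` Z"
      using p(2) manifold_chart_in_model[OF N Z p(1)]
      by (intro exI[of _ "model N \<inter> B"]) (auto intro: openin_open_Int)
  qed
  then have embN: "smooth_embedding N N id"
    using smooth_embedding_restricts[OF N restricts_refl manifold_subspace[OF N]] by blast
  have "is_functor (C\<lparr>arrows := ?M\<rparr>) C id id" using S by (auto simp: is_functor_def)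
  then show ?thesis
    using lc emb embN by (simp add: embedded_lie_subcategory_def lie_subcategory_def smooth_embedding_def)
qed

text \<open>
  If the boundary is a wide subcategory, it is a Lie category without boundary that has the same
  invertible arrows.
\<close>

lemma lie_category_bdry:
  assumes "wide_subcategory C (bdry M)"
  shows "lie_category (C\<lparr>arrows := bdry_mfd M\<rparr>)"
proof -
  have "subspace {x \<in> model M. x \<bullet> inward M = 0}"
    using manifold_subspace[OF M] by (auto simp: subspace_def inner_add_left)
  from lie_category_restrict[OF assms this bdry_chart_open[OF M]] show ?thesis
    using bdry_submersions by (simp add: bdry_mfd_eq_restrict_mfd)
qed

lemma invertibles_bdry:
  assumes "wide_subcategory C (bdry M)"
  shows "invertibles (C\<lparr>arrows := bdry_mfd M\<rparr>) = invertibles C"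
proof -
  have sub: "bdry M \<subseteq> Arr C" "invertibles C \<subseteq> bdry M"
    using assms invertible_boundary_if_units_boundary by (auto simp: wide_subcategory_def)
  then have Arr: "Arr (C\<lparr>arrows := bdry_mfd M\<rparr>) = bdry M" by (auto simp: bdry_mfd_def)
  have "is_inverse (C\<lparr>arrows := bdry_mfd M\<rparr>) = is_inverse C"
  proof (intro ext)
    fix g h
    have "is_inverse C g h \<Longrightarrow> g \<in> bdry M \<and> h \<in> bdry M"
      using sub(2) inverse_sym invertibles_iff by blast
    then show "is_inverse (C\<lparr>arrows := bdry_mfd M\<rparr>) g h = is_inverse C g h"
      using sub(1) Arr by (auto simp: is_inverse_def composable_def)
  qed
  then show ?thesis
    unfolding invertibles_def[of "C\<lparr>arrows := bdry_mfd M\<rparr>"] Arr using sub(2) by (auto simp: invertibles_iff)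
qed

end

theorem theorem1:
  fixes C :: "('c, 'e::euclidean_space, 'x, 'f::euclidean_space) lie_cat"
  assumes "lie_category C"
    and "normal_boundary C"
  shows "(\<exists>M :: ('c, 'e) mfd.
            points M = invertibles C \<and>
            embedded_lie_subcategory (C\<lparr>arrows := M\<rparr>) C id id \<and>
            lie_groupoid (C\<lparr>arrows := M\<rparr>)) \<and>
         (ident C ` Obj C \<subseteq> int_pts (arrows C) \<longrightarrow>
            openin (subtopology (space_top (arrows C)) (int_pts (arrows C))) (invertibles C)) \<and>
         (wide_subcategory C (bdry (arrows C)) \<longrightarrow>
            openin (subtopology (space_top (arrows C)) (bdry (arrows C))) (invertibles C))"
proof -
  interpret Lie_category C by standard (rule assms(1))
  let ?G = "invertibles C"
  let ?P = "\<exists>M :: ('c, 'e) mfd. points M = ?G \<and>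
      embedded_lie_subcategory (C\<lparr>arrows := M\<rparr>) C id id \<and> lie_groupoid (C\<lparr>arrows := M\<rparr>)"
  have G: "?G \<subseteq> Arr C" by (auto simp: invertibles_def)
  have int: "?P \<and> openin (subtopology (space_top M) (int_pts M)) ?G" if "ident C ` Obj C \<subseteq> int_pts M"
  proof
    have int: "?G \<subseteq> int_pts M" by (rule invertible_interior_if_units_interior[OF that])
    let ?M = "restrict_mfd M ?G (model M)"
    have gp: "lie_groupoid (C\<lparr>arrows := ?M\<rparr>)" by (rule lie_groupoid_invertibles[OF int])
    then have "lie_category (C\<lparr>arrows := ?M\<rparr>)" by (simp add: lie_groupoid_def)
    then have "embedded_lie_subcategory (C\<lparr>arrows := ?M\<rparr>) C id id"
      by (rule embedded_restriction[OF _ G manifold_subspace[OF M] invertibles_chart_open[OF int]])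
    moreover have "points ?M = ?G" using G by auto
    ultimately show ?P using gp by blast
    have "openin (subtopology (space_top M) (int_pts M)) (?G \<inter> int_pts M)"
      using invertibles_open[OF int] by (rule openin_subtopology_Int)
    then show "openin (subtopology (space_top M) (int_pts M)) ?G" using int by (simp add: Int_absorb2)
  qed
  have bd: "?P \<and> openin (subtopology (space_top M) (bdry M)) ?G" if wide: "wide_subcategory C (bdry M)"
  proof
    let ?B = "C\<lparr>arrows := bdry_mfd M\<rparr>" and ?W = "{x \<in> model M. x \<bullet> inward M = 0}"
    interpret B: Lie_category ?B by standard (rule lie_category_bdry[OF wide])
    have GB: "invertibles ?B = ?G" by (rule invertibles_bdry[OF wide])
    have sub: "?G \<subseteq> bdry M"
      using wide by (intro invertible_boundary_if_units_boundary) (simp add: wide_subcategory_def)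
    have pts: "points (bdry_mfd M) = bdry M"
      using wide by (auto simp: bdry_mfd_def wide_subcategory_def)
    have int: "invertibles ?B \<subseteq> int_pts (arrows ?B)"
      using sub by (simp add: GB int_pts_def pts) (simp add: bdry_mfd_eq_restrict_mfd)
    \<comment> \<open>the invertible arrows carry the same structure whether seen in the boundary or in all arrows\<close>
    let ?M = "restrict_mfd M ?G ?W"
    have restr: "restrict_mfd (bdry_mfd M) ?G (model (bdry_mfd M)) = ?M"
      by (simp add: bdry_mfd_eq_restrict_mfd restrict_mfd_restrict_mfd[OF sub])
    have gp: "lie_groupoid (C\<lparr>arrows := ?M\<rparr>)"
      using B.lie_groupoid_invertibles[OF int] by (simp add: GB restr)
    then have lc: "lie_category (C\<lparr>arrows := ?M\<rparr>)" by (simp add: lie_groupoid_def)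
    have W: "subspace ?W"
      using manifold_subspace[OF M] by (auto simp: subspace_def inner_add_left)
    have "openin (top_of_set ?W) (\<phi> ` (U \<inter> ?G))" if "(U, \<phi>) \<in> atlas M" for U \<phi>
    proof -
      have "(U \<inter> bdry M, \<phi>) \<in> atlas (arrows ?B)"
        using that by (auto simp: bdry_mfd_eq_restrict_mfd atlas_restrict_mfd)
      from B.invertibles_chart_open[OF int this]
      have "openin (top_of_set (model (arrows ?B))) (\<phi> ` (U \<inter> bdry M \<inter> ?G))" by (simp only: GB)
      moreover have "model (arrows ?B) = ?W" by (simp add: bdry_mfd_eq_restrict_mfd)
      moreover have "U \<inter> bdry M \<inter> ?G = U \<inter> ?G" using sub by blast
      ultimately show ?thesis by simp
    qed
    then have "embedded_lie_subcategory (C\<lparr>arrows := ?M\<rparr>) C id id"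
      by (rule embedded_restriction[OF lc G W])
    moreover have "points ?M = ?G" using G by auto
    ultimately show ?P using gp by blast
    show "openin (subtopology (space_top M) (bdry M)) ?G"
      using B.invertibles_open[OF int] unfolding GB by (simp add: bdry_mfd_eq_restrict_mfd)
  qed
  show ?thesis using assms(2) int bd unfolding normal_boundary_def by blast
qed

end
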